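(* Let $K$ be an algebraically closed field of characteristic $0$. Let $a=2$ and let $b\ge 2$ be an integer relatively prime to $a$. Suppose $F,G\in K[x,y]$ are such that the pair $(F,G)$ has generic boundaries (with these $a,b$). Then $$F=P^2+u_0$$ for some $P\in K[x,y]$ and some $u_0\in K$. In particular, $[F,G]=0$.
   Context: $[f,g]=\frac{\partial f}{\partial x}\frac{\partial g}{\partial y}-\frac{\partial g}{\partial x}\frac{\partial f}{\partial y}$. For $f=\sum f_{ij}x^iy^j$, $\mathrm{supp}(f)=\{(i,j): f_{ij}\ne0\}$ and the Newton polygon $N(f)$ is the convex hull of $\mathrm{supp}(f)$ in $\mathbb{R}^2$. Directions: $W=\{(u,v)\in\mathbb{Z}^2: u>0\text{ or }v>0,\ \gcd(|u|,|v|)=1\}$. For $w=(u,v)\in W$ the $w$-degree of $x^iy^j$ is $ui+vj$, and $P_+$ denotes the $w$-leading form of a nonzero polynomial $P$ (its homogeneous component of highest $w$-degree). For relatively prime positive integers $a,b$, the pair $(F,G)$ has generic boundaries if: (1) $[F,G]\in K$; (2) $\{(1,0),(0,1),(0,0)\}\subset N(F)\cap N(G)$, and $N(F)$ is similar to $N(G)$ with the origin as center of similarity and with ratio $\deg(F):\deg(G)=a:b$; and moreover, for every direction $w\in W$, the polynomial $F_+^{1/a}$ is not divisible by the square of any polynomial in $\mathcal{T}$. Here $\mathcal{T}$ is the set of polynomials $f\in K[x,y]$ such that $N(f)$ contains exactly two distinct lattice points (i.e. $N(f)$ is a line segment containing no lattice points other than its endpoints), and $F_+^{1/a}$ denotes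 an $a$-th root of $F_+$ in $K[x,y]$, where it is a known fact that under (1) and (2) $F_+$ is an $a$-th power in $K[x,y]$ for every $w\in W$. *)

theory Defs
  imports
    "HOL-Analysis.Analysis"
    "HOL-Computational_Algebra.Computational_Algebra"
begin

text \<open>The ring \<open>K[x,y]\<close> is represented as \<open>K[x][y]\<close>, that is, by the type \<open>'a poly poly\<close>
  with \<open>x\<close> the inner and \<open>y\<close> the outer variable.\<close>

definition coeff_xy :: "'a::zero poly poly \<Rightarrow> nat \<Rightarrow> nat \<Rightarrow> 'a" where
  "coeff_xy f i j = coeff (coeff f j) i"

definition monom_xy :: "'a::zero \<Rightarrow> nat \<Rightarrow> nat \<Rightarrow> 'a poly poly" where
  "monom_xy c i j = monom (monom c i) j"

definition const_xy :: "'a::zero \<Rightarrow> 'a poly poly" where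
  "const_xy c = [:[:c:]:]"

definition deriv_x :: "'a::idom poly poly \<Rightarrow> 'a poly poly" where
  "deriv_x f = map_poly pderiv f"

definition deriv_y :: "'a::idom poly poly \<Rightarrow> 'a poly poly" where
  "deriv_y f = pderiv f"

definition jacobian_xy :: "'a::idom poly poly \<Rightarrow> 'a poly poly \<Rightarrow> 'a poly poly" where
  "jacobian_xy f g = deriv_x f * deriv_y g - deriv_x g * deriv_y f"

definition supp_xy :: "'a::zero poly poly \<Rightarrow> (nat \<times> nat) set" where
  "supp_xy f = {(i, j). coeff_xy f i j \<noteq> 0}"

definition newton_polygon :: "'a::zero poly poly \<Rightarrow> (real \<times> real) set" where
  "newton_polygon f = convex hull ((\<lambda>(i, j). (real i, real j)) ` supp_xy f)"

text \<open>The total degree; meaningful for nonzero polynomials only.\<close>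

definition total_degree :: "'a::zero poly poly \<Rightarrow> nat" where
  "total_degree f = Max ((\<lambda>(i, j). i + j) ` supp_xy f)"

definition directions :: "(int \<times> int) set" where
  "directions = {(u, v). (u > 0 \<or> v > 0) \<and> gcd \<bar>u\<bar> \<bar>v\<bar> = 1}"

fun weight :: "int \<times> int \<Rightarrow> nat \<times> nat \<Rightarrow> int" where
  "weight (u, v) (i, j) = u * int i + v * int j"

definition homogeneous_component ::
    "int \<times> int \<Rightarrow> int \<Rightarrow> 'a::comm_monoid_add poly poly \<Rightarrow> 'a poly poly" where
  "homogeneous_component w d f =
     (\<Sum>(i, j) \<in> {m \<in> supp_xy f. weight w m = d}. monom_xy (coeff_xy f i j) i j)"

text \<open>Meaningful for nonzero \<open>f\<close> only, where the maximum ranges over a nonempty set.\<close>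

definition leading_form ::
    "int \<times> int \<Rightarrow> 'a::comm_monoid_add poly poly \<Rightarrow> 'a poly poly" where
  "leading_form w f = homogeneous_component w (Max (weight w ` supp_xy f)) f"

text \<open>The set \<open>\<T>\<close> of polynomials whose Newton polygon has exactly two lattice points.\<close>

definition two_point_polys :: "'a::zero poly poly set" where
  "two_point_polys = {f. card (newton_polygon f \<inter> \<int> \<times> \<int>) = 2}"

text \<open>The \<open>a\<close>-th root of \<open>F\<^sub>+\<close> is only determined up to an \<open>a\<close>-th root of unity, which does
  not affect divisibility, so the last condition is imposed on every such root. That a root
  exists is not assumed: over an algebraically closed field of characteristic 0 and for
  coprime positive \<open>a, b\<close> it follows from the other conditions.\<close>

definition generic_boundaries ::
    "nat \<Rightarrow> nat \<Rightarrow> 'a::idom poly poly \<Rightarrow> 'a poly poly \<Rightarrow> bool" where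
  "generic_boundaries a b F G \<longleftrightarrow>
     jacobian_xy F G \<in> range const_xy \<and>
     {(1, 0), (0, 1), (0, 0)} \<subseteq> newton_polygon F \<inter> newton_polygon G \<and>
     newton_polygon F =
       (\<lambda>p. (real (total_degree F) / real (total_degree G)) *\<^sub>R p) ` newton_polygon G \<and>
     real (total_degree F) / real (total_degree G) = real a / real b \<and>
     (\<forall>w \<in> directions. \<forall>R. R ^ a = leading_form w F \<longrightarrow>
        (\<forall>t \<in> two_point_polys. \<not> t\<^sup>2 dvd R))"

end

theory Submission
  imports "HOL-Algebra.Algebraic_Closure_Type" Defs
begin

text \<open>A place of \<open>K(x, y)\<close> at which \<open>F\<close> is finite but \<open>x\<close> or \<open>y\<close> is not approaches infinity along a
  direction \<open>w\<close> in which \<open>F\<close> has an edge, and its residue is a root of the leading form \<open>F\<^sub>+\<close>. The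
  leading forms of \<open>F\<close> and \<open>G\<close> have vanishing Jacobian, so \<open>F\<^sub>+\<close> is a square, and by genericity the
  root is exactly double. Moving to a critical point of \<open>F\<close> near that root (Hensel), one compares the
  next leading terms of \<open>F\<close> and \<open>G\<close>: as long as their weights are positive they again have vanishing
  Jacobian, so that the \<open>b\<close>-th power of a quadratic polynomial is a square up to a constant, and
  since \<open>b\<close> is odd the root stays double. Hence \<open>F\<close> only splits off a simple pair of roots at weight
  \<open>0\<close>, and there the Jacobian condition forces \<open>G\<close> to be finite as well.

  So \<open>G\<close> is finite at all places where \<open>F\<close> is finite, that is, \<open>G\<close> is integral over \<open>K[F]\<close>, and in
  characteristic \<open>0\<close> the Jacobian vanishes. Among the polynomials commuting with \<open>F\<close>, all of which
  have leading forms proportional to powers of \<open>F\<^sub>+\<^sup>1\<^sup>/\<^sup>2\<close> along an edge, choose \<open>Y\<close> of minimal odd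
  degree. After completing the square, \<open>Y\<^sup>2 = \<gamma>(F)\<close> with \<open>\<gamma>\<close> squarefree of odd degree, and \<open>\<gamma>\<close>
  must be linear, because otherwise \<open>Y\<close> would divide \<open>\<partial>F/\<partial>y\<close> while having at least the degree of \<open>F\<close>
  in \<open>y\<close>.\<close>

text \<open>A place is any valuation ring of an algebraically closed field containing K[x,y]; no
  Puiseux series are used. The expansions in t are polynomial and are made without reference to a
  place: powers of t clear the denominators, and the critical point is needed only modulo a power of
  t. At a critical point the linear term is absent, so a next edge of F carries a quadratic
  polynomial without linear term, which has a double root only if its constant term vanishes; one
  comparison of leading terms therefore replaces an endless sequence of substitutions. The obstacle
  is numerical: the Jacobian must not interfere before weight 0. With 2d the weight of F along the
  edge this needs u + v \<le> d + 1, and it holds because a double root makes an edge at least two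
  primitive steps long. That b is odd serves a second time for the centralizer: G itself has odd
  weight there, so K[F] is not everything.\<close>

locale ring_map =
  fixes h :: "'a::comm_ring_1 \<Rightarrow> 'b::comm_ring_1"
  assumes map_add [simp]: "h (x + y) = h x + h y"
    and map_mult [simp]: "h (x * y) = h x * h y"
    and map_1 [simp]: "h 1 = 1"
begin

lemma map_0 [simp]: "h 0 = 0"
  using map_add[of 0 0] by simp

lemma map_uminus [simp]: "h (- x) = - h x"
  using map_add[of x "- x"] by (simp add: eq_neg_iff_add_eq_0 add.commute)

lemma map_diff [simp]: "h (x - y) = h x - h y"
  using map_add[of x "- y"] by simp

lemma map_power [simp]: "h (x ^ n) = h x ^ n"
  by (induction n) simp_all

lemma map_sum: "h (\<Sum>i\<in>A. f i) = (\<Sum>i\<in>A. h (f i))"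
  by (induction A rule: infinite_finite_induct) simp_all

lemma map_of_nat [simp]: "h (of_nat n) = of_nat n"
  by (induction n) simp_all

lemma map_of_int [simp]: "h (of_int k) = of_int k"
  by (cases k rule: int_diff_cases) simp

end

lemma ring_map_comp: "ring_map f \<Longrightarrow> ring_map g \<Longrightarrow> ring_map (\<lambda>x. f (g x))"
  unfolding ring_map_def by simp

lemma ring_map_poly: "ring_map (\<lambda>p. poly p x)"
  by unfold_locales simp_all

lemma ring_map_pcompose: "ring_map (\<lambda>p. pcompose p q)"
  by unfold_locales (simp_all add: pcompose_add pcompose_mult pcompose_1)

lemma ring_map_const: "ring_map (\<lambda>c. [:c:])"
  by unfold_locales (simp_all add: pCons_one)

lemma ring_map_const_xy: "ring_map const_xy"
  by unfold_locales (simp_all add: const_xy_def pCons_one)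

lemma ring_map_map_poly:
  assumes "ring_map h"
  shows "ring_map (map_poly h)"
proof -
  interpret ring_map h by fact
  have add: "map_poly h (p + q) = map_poly h p + map_poly h q" for p q
    by (rule poly_eqI) (simp add: coeff_map_poly)
  have mult: "map_poly h (p * q) = map_poly h p * map_poly h q" for p q
    by (rule poly_eqI) (simp add: coeff_map_poly coeff_mult map_sum)
  show ?thesis
    by unfold_locales (simp_all add: add mult map_poly_1')
qed

lemma map_poly_pderiv:
  assumes "ring_map h"
  shows "map_poly h (pderiv p) = pderiv (map_poly h p)"
proof -
  interpret ring_map h by fact
  show ?thesis
    by (rule poly_eqI) (simp add: coeff_map_poly coeff_pderiv del: of_nat_Suc)
qed

lemma map_poly_pcompose:
  assumes "ring_map h"
  shows "map_poly h (pcompose p q) = pcompose (map_poly h p) (map_poly h q)"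
proof -
  interpret ring_map h by fact
  interpret m: ring_map "map_poly h" by (rule ring_map_map_poly) fact
  show ?thesis
    by (induction p) (simp_all add: pcompose_pCons map_poly_pCons)
qed

lemma map_poly_poly:
  assumes "ring_map h"
  shows "h (poly p x) = poly (map_poly h p) (h x)"
proof -
  interpret ring_map h by fact
  show ?thesis by (induction p) (simp_all add: map_poly_pCons)
qed

lemma map_poly_injD:
  assumes "ring_map h" "inj h" "map_poly h p = map_poly h q"
  shows "p = q"
proof -
  interpret ring_map h by fact
  show ?thesis
    by (rule poly_eqI) (metis assms(2,3) coeff_map_poly injD map_0)
qed

section \<open>Univariate polynomials\<close>

text \<open>Compares the coefficients of degree \<open>degree h + degree k - 1\<close>. There
  \<open>pderiv p * q\<close> contributes \<open>degree p\<close> times the product of the leading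
  coefficients, also for constant p; this is the behaviour of logarithmic derivatives at
  infinity.\<close>

lemma pderiv_eq_degree:
  fixes h k :: "'a::field_char_0 poly"
  assumes eq: "smult \<alpha> (pderiv h * k) = smult \<beta> (h * pderiv k)" and "h \<noteq> 0" "k \<noteq> 0"
  shows "\<alpha> * of_nat (degree h) = \<beta> * of_nat (degree k)"
proof -
  have co: "coeff (pderiv p * q) (degree p + degree q - 1) = of_nat (degree p) * lead_coeff p * lead_coeff q"
    if "degree p > 0" for p q :: "'a poly"
  proof -
    have "degree p + degree q - 1 = degree (pderiv p) + degree q"
      using that by (simp add: degree_pderiv)
    then have "coeff (pderiv p * q) (degree p + degree q - 1) = lead_coeff (pderiv p) * lead_coeff q"
      by (simp only: coeff_mult_degree_sum)
    moreover have "lead_coeff (pderiv p) = of_nat (degree p) * lead_coeff p"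
      using that by (simp add: degree_pderiv coeff_pderiv del: of_nat_Suc)
    ultimately show ?thesis by simp
  qed
  have co': "coeff (pderiv p * q) (degree p + degree q - 1) = of_nat (degree p) * lead_coeff p * lead_coeff q"
    for p q :: "'a poly"
  proof (cases "degree p > 0")
    case False
    then have "pderiv p = 0" by (simp add: pderiv_eq_0_iff)
    with False show ?thesis by simp
  qed (rule co)
  have "\<alpha> * (of_nat (degree h) * lead_coeff h * lead_coeff k)
      = \<beta> * (of_nat (degree k) * lead_coeff k * lead_coeff h)"
    using arg_cong[OF eq, of "\<lambda>p. coeff p (degree h + degree k - 1)"]
      co'[of h k] co'[of k h] by (simp add: mult.commute add.commute)
  then show ?thesis using \<open>h \<noteq> 0\<close> \<open>k \<noteq> 0\<close> by simp
qed

text \<open>The solutions h form a vector space in which every nonzero element has the degree of k.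
  Subtracting the multiple of k with the same leading coefficient therefore leaves 0.\<close>

lemma wronskian_eq_0_imp_smult:
  fixes h k :: "'a::field_char_0 poly"
  assumes eq: "pderiv h * k = h * pderiv k" and "k \<noteq> 0"
  shows "\<exists>c. h = smult c k"
proof (cases "h = 0")
  case False
  have deg: "degree r = degree k" if "pderiv r * k = r * pderiv k" "r \<noteq> 0" for r
    using pderiv_eq_degree[of 1 r k 1] that \<open>k \<noteq> 0\<close> by simp
  define c where "c = lead_coeff h / lead_coeff k"
  define r where "r = h - smult c k"
  have w: "pderiv r * k = r * pderiv k"
    unfolding r_def using eq by (simp add: pderiv_diff pderiv_smult algebra_simps)
  have "r = 0"
  proof (rule ccontr)
    assume "r \<noteq> 0"
    then have dr: "degree r = degree k" using deg w by blast
    moreover have "degree h = degree k" using deg eq False by blast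
    then have "coeff r (degree k) = 0" using \<open>k \<noteq> 0\<close> by (simp add: r_def c_def)
    ultimately show False using \<open>r \<noteq> 0\<close> by (metis leading_coeff_neq_0)
  qed
  then show ?thesis unfolding r_def by auto
qed (auto intro: exI[of _ 0])

text \<open>The hypothesis says that \<open>g ^ m\<close> and \<open>f ^ e\<close> have the same
  logarithmic derivative, so their Wronskian vanishes. In this way a vanishing Jacobian of leading
  terms becomes an algebraic relation between them.\<close>

lemma log_derivative_eq:
  fixes f g :: "'a::field_char_0 poly"
  assumes eq: "smult (of_nat m) (f * pderiv g) = smult (of_nat e) (g * pderiv f)"
    and "f \<noteq> 0" "g \<noteq> 0"
  shows "\<exists>c. c \<noteq> 0 \<and> g ^ m = smult c (f ^ e)"
proof -
  have pw: "pderiv (p ^ n) * p = smult (of_nat n) (p ^ n * pderiv p)" for p :: "'a poly" and n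
    by (cases n) (simp_all add: pderiv_power_Suc mult_ac del: power_Suc of_nat_Suc, simp add: mult_ac)
  have "pderiv (g ^ m) * f ^ e * (f * g) = (pderiv (g ^ m) * g) * f ^ e * f"
    by (simp add: mult_ac)
  also have "\<dots> = smult (of_nat m) (g ^ m * pderiv g) * f ^ e * f"
    by (simp only: pw)
  also have "\<dots> = g ^ m * f ^ e * smult (of_nat m) (f * pderiv g)"
    by (simp add: mult_ac)
  also have "\<dots> = g ^ m * g * smult (of_nat e) (f ^ e * pderiv f)"
    by (simp add: eq mult_ac)
  also have "\<dots> = g ^ m * g * (pderiv (f ^ e) * f)"
    by (simp only: pw)
  also have "\<dots> = g ^ m * pderiv (f ^ e) * (f * g)"
    by (simp only: mult_ac)
  finally have "pderiv (g ^ m) * f ^ e = g ^ m * pderiv (f ^ e)"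
    using assms(2,3) by simp
  then obtain c where "g ^ m = smult c (f ^ e)"
    using wronskian_eq_0_imp_smult[of "g ^ m" "f ^ e"] \<open>f \<noteq> 0\<close> by auto
  moreover from this have "c \<noteq> 0" using \<open>g \<noteq> 0\<close> by auto
  ultimately show ?thesis by blast
qed

lemma order_power: "p \<noteq> 0 \<Longrightarrow> Polynomial.order a (p ^ n) = n * Polynomial.order a p"
  for p :: "'a::idom poly"
  by (induction n) (simp_all add: order_mult order_0I)

lemma taylor_first_order:
  fixes p :: "'a::idom poly"
  shows "\<exists>q. poly p (a + e) = poly p a + e * poly (pderiv p) a + e\<^sup>2 * q"
proof (induction p)
  case (pCons c p)
  then obtain q where "poly p (a + e) = poly p a + e * poly (pderiv p) a + e\<^sup>2 * q" by blast
  then have "poly (pCons c p) (a + e) = poly (pCons c p) a + e * poly (pderiv (pCons c p)) a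
      + e\<^sup>2 * (poly (pderiv p) a + a * q + e * q)"
    by (simp add: pderiv_pCons algebra_simps power2_eq_square)
  then show ?case by blast
qed (auto intro: exI[of _ 0])

section \<open>Divisibility of squares in \<open>K[x,y]\<close>\<close>

text \<open>The gcd type classes are not available for \<open>K\<close> itself, but they are for its algebraic closure,
  which is isomorphic to \<open>K\<close>.\<close>

lemma surj_to_ac:
  "range (to_ac :: 'a::alg_closed_field \<Rightarrow> _) = UNIV"
proof (intro equalityI subset_UNIV subsetI)
  fix z :: "'a alg_closure"
  obtain p :: "'a poly" where p: "p \<noteq> 0" "poly (map_poly to_ac p) z = 0"
    using alg_closure_algebraic by blast
  interpret ring_map "to_ac :: 'a \<Rightarrow> _" by unfold_locales simp_all
  have "\<exists>r. z = to_ac r" if "p \<noteq> 0" "poly (map_poly to_ac p) z = 0" for p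
    using that
  proof (induction "degree p" arbitrary: p)
    case 0
    then obtain c where "p = [:c:]" by (metis degree_eq_zeroE)
    with 0 show ?case by (simp add: map_poly_pCons)
  next
    case (Suc n)
    then obtain r where "poly p r = 0"
      using alg_closed_imp_poly_has_root[of p] by auto
    then obtain q where q: "p = [:- r, 1:] * q" by (metis dvdE poly_eq_0_iff_dvd)
    interpret m: ring_map "map_poly (to_ac :: 'a \<Rightarrow> _)" by (rule ring_map_map_poly) unfold_locales
    have "(z - to_ac r) * poly (map_poly to_ac q) z = 0"
      using Suc.prems(2) by (simp add: q map_poly_pCons del: mult_pCons_left)
    then consider "z = to_ac r" | "poly (map_poly to_ac q) z = 0" by auto
    then show ?case
    proof cases
      case 2
      have "q \<noteq> 0" using Suc.prems q by auto
      moreover have "n = degree q"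
        using Suc.hyps(2) \<open>q \<noteq> 0\<close> unfolding q by (subst (asm) degree_mult_eq) auto
      ultimately show ?thesis using Suc.hyps(1) 2 by blast
    qed blast
  qed
  with p show "z \<in> range to_ac" by blast
qed

lemma square_dvd_square_imp_dvd:
  fixes D Y :: "'a::alg_closed_field poly poly"
  assumes "D\<^sup>2 dvd Y\<^sup>2"
  shows "D dvd Y"
proof -
  let ?h = "to_ac :: 'a \<Rightarrow> 'a alg_closure"
  have h: "ring_map ?h" by unfold_locales simp_all
  have bij: "bij ?h" using surj_to_ac inj_to_ac by (auto simp: bij_def)
  let ?m = "map_poly (map_poly ?h)"
  have m: "ring_map ?m" by (intro ring_map_map_poly h)
  interpret m: ring_map ?m by (rule m)
  have "?m D ^ 2 dvd ?m Y ^ 2" 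
  proof -
    obtain Z where "Y\<^sup>2 = D\<^sup>2 * Z" using assms by blast
    from arg_cong[OF this, of ?m] show ?thesis
      unfolding m.map_mult m.map_power by (rule dvdI)
  qed
  then have "?m D dvd ?m Y" by (rule iffD1[OF pow_divides_pow_iff, rotated]) simp
  then obtain Q where Q: "?m Y = ?m D * Q" by blast
  have inv: "?h (inv_into UNIV ?h x) = x" for x using bij by (simp add: bij_is_surj surj_f_inv_f)
  have inv0: "inv_into UNIV ?h 0 = 0" using bij by (metis bij_inv_eq_iff to_ac_0)
  have mp0: "map_poly (inv_into UNIV ?h) 0 = 0" by simp
  define Q' where "Q' = map_poly (map_poly (inv_into UNIV ?h)) Q"
  have "?m Q' = Q"
    unfolding Q'_def
    by (rule poly_eqI, rule poly_eqI) (simp add: coeff_map_poly inv0 inv)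
  then have "?m Y = ?m (D * Q')" by (simp add: Q)
  moreover have "inj (map_poly ?h)"
    using map_poly_injD[OF h inj_to_ac] by (auto simp: inj_def)
  ultimately have eq: "Y = D * Q'"
    by (rule map_poly_injD[OF ring_map_map_poly[OF h], rotated])
  show ?thesis unfolding eq by (rule dvd_triv_left)
qed

text \<open>For b = 2k + 1 the element x is the quotient of the squares of y and
  \<open>x ^ k\<close>; divisibility of squares descends to y and \<open>x ^ k\<close>, so the root
  of the quotient lies in the ring.\<close>

lemma odd_power_eq_square_imp_square:
  fixes x y :: "'a::alg_closed_field poly poly"
  assumes "odd b" "x ^ b = y\<^sup>2"
  shows "\<exists>r. x = r\<^sup>2"
proof (cases "x = 0")
  case False
  obtain k where k: "b = k * 2 + 1" using \<open>odd b\<close> by (metis oddE mult.commute)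
  have eq: "y\<^sup>2 = x * (x ^ k)\<^sup>2"
    unfolding assms(2)[symmetric] k by (simp only: power_add power_mult power_one_right mult.commute)
  have "(x ^ k)\<^sup>2 dvd y\<^sup>2" unfolding eq by (rule dvd_triv_right)
  then have "x ^ k dvd y" by (rule square_dvd_square_imp_dvd)
  then obtain r where "y = x ^ k * r" by blast
  then have "(x ^ k)\<^sup>2 * x = (x ^ k)\<^sup>2 * r\<^sup>2" using eq by (metis power_mult_distrib mult.commute)
  with False have "x = r\<^sup>2" by simp
  then show ?thesis by blast
qed (auto intro: exI[of _ 0])

section \<open>Valuation rings\<close>

definition subring_set :: "'e::field set \<Rightarrow> bool" where
  "subring_set R \<longleftrightarrow> 1 \<in> R \<and> (\<forall>x\<in>R. \<forall>y\<in>R. x - y \<in> R \<and> x * y \<in> R)"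

lemma subring_setD:
  assumes "subring_set R"
  shows "1 \<in> R" "0 \<in> R" "x \<in> R \<Longrightarrow> - x \<in> R" "x \<in> R \<Longrightarrow> y \<in> R \<Longrightarrow> x - y \<in> R"
    "x \<in> R \<Longrightarrow> y \<in> R \<Longrightarrow> x + y \<in> R" "x \<in> R \<Longrightarrow> y \<in> R \<Longrightarrow> x * y \<in> R"
proof -
  have one: "1 \<in> R" and d: "\<And>x y. x \<in> R \<Longrightarrow> y \<in> R \<Longrightarrow> x - y \<in> R"
    and m: "\<And>x y. x \<in> R \<Longrightarrow> y \<in> R \<Longrightarrow> x * y \<in> R"
    using assms by (auto simp: subring_set_def)
  have zero: "0 \<in> R" using d[OF one one] by simp
  have neg: "- x \<in> R" if "x \<in> R" for x using d[OF zero that] by simp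
  show "1 \<in> R" "0 \<in> R" "x \<in> R \<Longrightarrow> - x \<in> R" "x \<in> R \<Longrightarrow> y \<in> R \<Longrightarrow> x - y \<in> R"
    "x \<in> R \<Longrightarrow> y \<in> R \<Longrightarrow> x * y \<in> R"
    using one zero neg d m by auto
  show "x \<in> R \<Longrightarrow> y \<in> R \<Longrightarrow> x + y \<in> R" using d[of x "- y"] neg[of y] by simp
qed

lemma subring_set_power: "subring_set R \<Longrightarrow> x \<in> R \<Longrightarrow> x ^ n \<in> R"
  by (induction n) (auto intro: subring_setD)

lemma subring_set_sum: "subring_set R \<Longrightarrow> (\<And>i. i \<in> A \<Longrightarrow> f i \<in> R) \<Longrightarrow> sum f A \<in> R"
  by (induction A rule: infinite_finite_induct) (auto intro: subring_setD)

lemma subring_set_adjoin: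
  assumes R: "subring_set R"
  shows "subring_set {poly p z | p. \<forall>i. coeff p i \<in> R}" (is "subring_set ?S")
    and "R \<subseteq> {poly p z | p. \<forall>i. coeff p i \<in> R}"
    and "z \<in> {poly p z | p. \<forall>i. coeff p i \<in> R}"
proof -
  note D = subring_setD[OF R]
  have one: "\<forall>i. coeff (1 :: 'a poly) i \<in> R" by (auto simp: coeff_1 D)
  have "1 = poly 1 z" by simp
  with one have "1 \<in> ?S" by blast
  moreover have "x - y \<in> ?S \<and> x * y \<in> ?S" if xy: "x \<in> ?S" "y \<in> ?S" for x y
  proof -
    from xy obtain p q where p: "x = poly p z" "\<forall>i. coeff p i \<in> R"
      and q: "y = poly q z" "\<forall>i. coeff q i \<in> R" by blast
    have "\<forall>i. coeff (p - q) i \<in> R" "\<forall>i. coeff (p * q) i \<in> R"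
      using p q by (auto simp: coeff_mult intro!: subring_set_sum[OF R] D)
    moreover have "x - y = poly (p - q) z" "x * y = poly (p * q) z" using p q by auto
    ultimately show ?thesis by blast
  qed
  ultimately show "subring_set ?S" unfolding subring_set_def by blast
  show "R \<subseteq> ?S"
  proof
    fix x assume "x \<in> R"
    then have "\<forall>i. coeff [:x:] i \<in> R" by (auto simp: coeff_pCons D split: nat.splits)
    moreover have "x = poly [:x:] z" by simp
    ultimately show "x \<in> ?S" by blast
  qed
  have "\<forall>i. coeff [:0, 1:] i \<in> R" by (auto simp: coeff_pCons D split: nat.splits)
  moreover have "z = poly [:0, 1:] z" by simp
  ultimately show "z \<in> ?S" by blast
qed

definition valuation_ring :: "'e::field set \<Rightarrow> bool" where
  "valuation_ring R \<longleftrightarrow> subring_set R \<and> (\<forall>z. z \<in> R \<or> inverse z \<in> R)"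

text \<open>The descent in Chevalley's extension theorem. As \<open>1 - s * q0\<close> is a unit,
  the relation for \<open>inverse z\<close>, multiplied by \<open>z ^ degree q\<close>, expresses
  that power of z by lower ones, and the degree of p drops. If q has the larger degree, z and
  \<open>inverse z\<close> change roles.\<close>

lemma no_simultaneous_extension:
  fixes R :: "'e::field set"
  assumes R: "subring_set R" and s: "s \<in> R" "\<forall>r\<in>R. s * r \<noteq> 1"
    and unit: "\<And>r. r \<in> R \<Longrightarrow> inverse (1 - s * r) \<in> R"
  shows "z \<noteq> 0 \<Longrightarrow> degree p + degree q = N \<Longrightarrow> \<forall>i. coeff p i \<in> R \<Longrightarrow> \<forall>i. coeff q i \<in> R
    \<Longrightarrow> s * poly p z = 1 \<Longrightarrow> s * poly q (inverse z) = 1 \<Longrightarrow> False"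
proof (induction N arbitrary: z p q rule: less_induct)
  case (less N)
  note D = subring_setD[OF R]
  have step: False
    if z: "z \<noteq> 0" and N: "degree p + degree q = N" and p: "\<forall>i. coeff p i \<in> R" and q: "\<forall>i. coeff q i \<in> R"
      and pz: "s * poly p z = 1" and qz: "s * poly q (inverse z) = 1" and le: "degree q \<le> degree p"
    for z p q
  proof -
    obtain q0 q' where q': "q = pCons q0 q'" by (cases q)
    have q0: "q0 \<in> R" using q[rule_format, of 0] by (simp add: q')
    have cq': "coeff q' i \<in> R" for i using q[rule_format, of "Suc i"] by (simp add: q')
    define m where "m = degree q"
    have "q' \<noteq> 0"
    proof
      assume "q' = 0"
      then have "s * q0 = 1" using qz by (simp add: q')
      with s q0 show False by blast
    qed
    then have m: "m = Suc (degree q')" by (simp add: m_def q')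
    define w where "w = inverse (1 - s * q0)"
    have w: "w \<in> R" unfolding w_def by (rule unit[OF q0])
    have "1 - s * q0 \<noteq> 0" using s q0 by auto
    have e: "(1 - s * q0) = s * inverse z * poly q' (inverse z)"
      using qz by (simp add: q' algebra_simps)
    define r where "r = smult (w * s) (reflect_poly q')"
    have zpow: "z ^ degree q' * poly q' (inverse z) = poly (reflect_poly q') z"
      using z poly_reflect_poly_nz[OF z, of q'] by simp
    have "z ^ m = w * (1 - s * q0) * z ^ m"
      using \<open>1 - s * q0 \<noteq> 0\<close> by (simp add: w_def)
    also have "\<dots> = w * s * (z ^ degree q' * poly q' (inverse z))"
      unfolding e using z by (simp add: m field_simps)
    also have "\<dots> = poly r z" by (simp add: zpow r_def)
    finally have zm: "z ^ m = poly r z" .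
    have dr: "degree r < m"
      using degree_reflect_poly_le[of q'] degree_smult_le[of "w * s" "reflect_poly q'"] by (simp add: r_def m)
    have cr: "coeff r i \<in> R" for i
      using cq' w s by (auto simp: r_def coeff_reflect_poly intro!: D)
    define n where "n = degree p"
    define p' where "p' = p - monom (lead_coeff p) n + monom (lead_coeff p) (n - m) * r"
    have nm: "n = (n - m) + m" using le by (simp add: n_def m_def)
    have "poly p' z = poly p z"
    proof -
      have "z ^ n = z ^ (n - m) * poly r z" by (subst nm) (simp only: power_add zm)
      then show ?thesis by (simp add: p'_def poly_monom)
    qed
    moreover have "coeff p' i \<in> R" for i
      using p cr by (auto simp: p'_def coeff_mult intro!: D subring_set_sum[OF R])
    moreover have "degree p' < n"
    proof -
      have "n > 0" using m le by (simp add: n_def m_def)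
      have "coeff p' i = 0" if "i \<ge> n" for i
      proof -
        have "coeff (p - monom (lead_coeff p) n) i = 0"
          using that coeff_eq_0[of p i] by (cases "i = n") (auto simp: n_def)
        moreover have "degree (monom (lead_coeff p) (n - m) * r) < n"
          using degree_mult_le[of "monom (lead_coeff p) (n - m)" r] degree_monom_le[of "lead_coeff p" "n - m"] dr nm
          by linarith
        then have "coeff (monom (lead_coeff p) (n - m) * r) i = 0"
          using that by (intro coeff_eq_0) simp
        ultimately show ?thesis unfolding p'_def by simp
      qed
      then have "degree p' \<le> n - 1" using \<open>n > 0\<close> by (intro degree_le) auto
      with \<open>n > 0\<close> show ?thesis by simp
    qed
    ultimately show False
      using less.IH[of "degree p' + degree q" z p' q] z N q pz qz by (auto simp: n_def)
  qed
  show ?case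
  proof (cases "degree q \<le> degree p")
    case True
    then show ?thesis using step[of z p q] less.prems by blast
  next
    case False
    then show ?thesis using step[of "inverse z" q p] less.prems by (simp add: add.commute)
  qed
qed

text \<open>Chevalley's theorem by Zorn's lemma: a subring that is maximal among those in which s
  stays a nonunit is a valuation ring. Following one element instead of a prime ideal suffices,
  because s will be the inverse of a single element.\<close>

theorem valuation_ring_extension:
  fixes B :: "'e::field set"
  assumes "subring_set B" "s \<in> B" "\<forall>r\<in>B. s * r \<noteq> 1"
  obtains R where "valuation_ring R" "B \<subseteq> R" "\<forall>r\<in>R. s * r \<noteq> 1"
proof -
  define A where "A = {R. subring_set R \<and> B \<subseteq> R \<and> (\<forall>r\<in>R. s * r \<noteq> 1)}"
  have "\<Union>C \<in> A" if C: "C \<noteq> {}" "subset.chain A C" for C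
  proof -
    have sub: "subring_set R" "B \<subseteq> R" "\<forall>r\<in>R. s * r \<noteq> 1" if "R \<in> C" for R
      using C that unfolding subset.chain_def A_def by auto
    have "subring_set (\<Union>C)"
      unfolding subring_set_def
    proof (intro conjI ballI)
      show "1 \<in> \<Union>C" using C sub subring_setD(1) by blast
      fix x y assume "x \<in> \<Union>C" "y \<in> \<Union>C"
      then obtain U V where XY: "U \<in> C" "V \<in> C" "x \<in> U" "y \<in> V" by blast
      then have "U \<subseteq> V \<or> V \<subseteq> U" using C unfolding subset.chain_def by blast
      then obtain Z where Z: "Z \<in> C" "x \<in> Z" "y \<in> Z" using XY by blast
      then show "x - y \<in> \<Union>C" "x * y \<in> \<Union>C" using sub(1)[OF Z(1)] subring_setD(4,6) by blast+
    qed
    then show ?thesis using C sub unfolding A_def by blast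
  qed
  moreover have "A \<noteq> {}" using assms unfolding A_def by blast
  ultimately obtain R where R: "R \<in> A" and max: "\<forall>U\<in>A. R \<subseteq> U \<longrightarrow> U = R"
    using subset_Zorn_nonempty[of A] by blast
  have sub: "subring_set R" and BR: "B \<subseteq> R" and s1: "\<forall>r\<in>R. s * r \<noteq> 1"
    using R unfolding A_def by auto
  note D = subring_setD[OF sub]
  have s: "s \<in> R" using assms BR by blast
  have unit: "inverse (1 - s * r) \<in> R" if r: "r \<in> R" for r
  proof -
    \<comment> \<open>The localisation of R at the multiplicative set 1 + sR. In it s is still a
      nonunit, so by maximality it equals R, and the elements of 1 + sR are units.\<close>
    define L where "L = {a * inverse (1 - s * b) | a b. a \<in> R \<and> b \<in> R}"
    have nz: "1 - s * b \<noteq> 0" if "b \<in> R" for b using s1 that by auto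
    have mult: "(1 - s * b) * (1 - s * d) = 1 - s * (b + d - s * b * d)" for b d
      by (simp add: algebra_simps)
    have "subring_set L"
      unfolding subring_set_def
    proof (intro conjI ballI)
      have "1 = 1 * inverse (1 - s * 0)" by simp
      then show "1 \<in> L" unfolding L_def using D(1,2) by blast
      fix x y assume "x \<in> L" "y \<in> L"
      then obtain a b c d where ab: "x = a * inverse (1 - s * b)" "a \<in> R" "b \<in> R"
        and cd: "y = c * inverse (1 - s * d)" "c \<in> R" "d \<in> R" unfolding L_def by blast
      have bd: "b + d - s * b * d \<in> R" using ab cd s by (auto intro!: D)
      have "x * y = (a * c) * inverse (1 - s * (b + d - s * b * d))"
        unfolding ab cd mult[symmetric] by simp
      then show "x * y \<in> L" unfolding L_def using bd ab cd D(6) by blast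
      have "x - y = (a * (1 - s * d) - c * (1 - s * b)) * inverse (1 - s * (b + d - s * b * d))"
        unfolding ab cd mult[symmetric] using nz[OF ab(3)] nz[OF cd(3)] by (simp add: field_simps)
      moreover have "a * (1 - s * d) - c * (1 - s * b) \<in> R" using ab cd s by (auto intro!: D)
      ultimately show "x - y \<in> L" unfolding L_def using bd by blast
    qed
    moreover have RL: "R \<subseteq> L"
    proof
      fix x assume "x \<in> R"
      moreover have "x = x * inverse (1 - s * 0)" by simp
      ultimately show "x \<in> L" unfolding L_def using D(2) by blast
    qed
    moreover have "s * l \<noteq> 1" if "l \<in> L" for l
    proof
      assume e: "s * l = 1"
      from that obtain a b where ab: "l = a * inverse (1 - s * b)" "a \<in> R" "b \<in> R"
        unfolding L_def by blast
      from e have "s * a = 1 - s * b" using nz[OF ab(3)] unfolding ab by (simp add: field_simps)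
      then have "s * (a + b) = 1" by (simp add: algebra_simps)
      with s1 D(5)[OF ab(2,3)] show False by blast
    qed
    ultimately have "L = R" using max BR unfolding A_def by blast
    moreover have "1 * inverse (1 - s * r) \<in> L" unfolding L_def using r D(1) by blast
    ultimately show ?thesis by simp
  qed
  have ext: "\<exists>p. (\<forall>i. coeff p i \<in> R) \<and> s * poly p z = 1" if "z \<notin> R" for z
  proof (rule ccontr)
    assume no: "\<not> ?thesis"
    let ?S = "{poly p z | p. \<forall>i. coeff p i \<in> R}"
    have "?S \<in> A"
      unfolding A_def using subring_set_adjoin[OF sub, of z] BR no by blast
    with max subring_set_adjoin[OF sub, of z] that show False by blast
  qed
  have "z \<in> R \<or> inverse z \<in> R" for z
  proof (rule ccontr)
    assume no: "\<not> (z \<in> R \<or> inverse z \<in> R)"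
    then have "z \<noteq> 0" using D(2) by auto
    with no ext[of z] ext[of "inverse z"] no_simultaneous_extension[OF sub s s1 unit] show False by blast
  qed
  then have "valuation_ring R" using sub unfolding valuation_ring_def by blast
  then show thesis using that BR s1 by blast
qed

section \<open>The maximal ideal and the units of a valuation ring\<close>

locale valuation =
  fixes R :: "'e::field set"
  assumes valuation_ring: "valuation_ring R"
begin

lemma sub: "subring_set R" and total: "z \<in> R \<or> inverse z \<in> R"
  using valuation_ring by (auto simp: valuation_ring_def)

lemmas R_1 = subring_setD(1)[OF sub] and R_0 = subring_setD(2)[OF sub]
  and R_minus = subring_setD(3)[OF sub] and R_diff = subring_setD(4)[OF sub]
  and R_add = subring_setD(5)[OF sub] and R_mult = subring_setD(6)[OF sub]
  and R_power = subring_set_power[OF sub]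

definition \<mm> :: "'e set" where
  "\<mm> = {z \<in> R. z = 0 \<or> inverse z \<notin> R}"

lemma mm_subset: "z \<in> \<mm> \<Longrightarrow> z \<in> R" by (simp add: \<mm>_def)

lemma mm_0: "0 \<in> \<mm>" by (simp add: \<mm>_def R_0)

lemma not_mm_iff: "z \<in> R \<Longrightarrow> z \<notin> \<mm> \<longleftrightarrow> z \<noteq> 0 \<and> inverse z \<in> R" by (auto simp: \<mm>_def)

lemma one_not_mm: "1 \<notin> \<mm>" by (simp add: \<mm>_def R_1)

lemma mm_mult: assumes "z \<in> \<mm>" "r \<in> R" shows "z * r \<in> \<mm>"
proof (cases "z * r = 0")
  case False
  have eq: "r * inverse (z * r) = inverse z" using False by (simp add: field_simps)
  have "inverse z \<notin> R" using assms False by (auto simp: \<mm>_def)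
  then have "inverse (z * r) \<notin> R"
    using R_mult[OF assms(2), of "inverse (z * r)"] unfolding eq by blast
  then show ?thesis using assms R_mult by (auto simp: \<mm>_def)
qed (use mm_0 in auto)

lemma mm_mult': "z \<in> \<mm> \<Longrightarrow> r \<in> R \<Longrightarrow> r * z \<in> \<mm>" using mm_mult[of z r] by (simp add: mult.commute)

lemma mm_add: assumes "z \<in> \<mm>" "w \<in> \<mm>" shows "z + w \<in> \<mm>"
proof -
  have *: "z + w \<in> \<mm>" if "z \<in> \<mm>" "w \<in> \<mm>" "w \<noteq> 0" "z * inverse w \<in> R" for z w
  proof -
    have "w * (z * inverse w + 1) = z * (w * inverse w) + w" by (simp add: distrib_left)
    then have "z + w = w * (z * inverse w + 1)" using that(3) by simp
    then show ?thesis using mm_mult[OF that(2), of "z * inverse w + 1"] that R_add R_1 by simp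
  qed
  show ?thesis
  proof (cases "z = 0 \<or> w = 0")
    case False
    have "inverse (z * inverse w) = w * inverse z" using False by (simp add: field_simps)
    then have "z * inverse w \<in> R \<or> w * inverse z \<in> R" using total[of "z * inverse w"] by metis
    then show ?thesis
    proof
      assume "z * inverse w \<in> R"
      then show ?thesis using *[OF assms] False by blast
    next
      assume "w * inverse z \<in> R"
      then have "w + z \<in> \<mm>" using *[OF assms(2,1)] False by blast
      then show ?thesis by (simp only: add.commute)
    qed
  qed (use assms in auto)
qed

lemma mm_uminus: "z \<in> \<mm> \<Longrightarrow> - z \<in> \<mm>" using mm_mult[of z "-1"] R_minus[OF R_1] by simp

lemma mm_diff: "z \<in> \<mm> \<Longrightarrow> w \<in> \<mm> \<Longrightarrow> z - w \<in> \<mm>"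
  using mm_add[of z "- w"] mm_uminus[of w] by simp

lemma mm_sum: "(\<And>i. i \<in> A \<Longrightarrow> f i \<in> \<mm>) \<Longrightarrow> sum f A \<in> \<mm>"
  by (induction A rule: infinite_finite_induct) (auto intro: mm_0 mm_add)

lemma mm_prime: assumes "z \<in> R" "w \<in> R" "z * w \<in> \<mm>" shows "z \<in> \<mm> \<or> w \<in> \<mm>"
proof (rule ccontr)
  assume "\<not> ?thesis"
  then have "z \<noteq> 0" "w \<noteq> 0" "inverse z \<in> R" "inverse w \<in> R" using assms by (auto simp: not_mm_iff)
  then have "z * w \<notin> \<mm>" using R_mult by (auto simp: \<mm>_def)
  with assms show False by blast
qed

lemma integrally_closed: assumes "z ^ n \<in> R" "n > 0" shows "z \<in> R"
proof (rule ccontr)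
  assume z: "z \<notin> R"
  then have i: "inverse z \<in> \<mm>" using total[of z] by (auto simp: \<mm>_def)
  have "z \<noteq> 0" using z R_0 by auto
  obtain k where k: "n = Suc k" using assms by (cases n) auto
  have "inverse z ^ n * z ^ n \<in> \<mm>"
    using mm_mult[OF mm_mult[OF i R_power[OF mm_subset[OF i]], of k] assms(1)] by (simp add: k)
  then show False using \<open>z \<noteq> 0\<close> one_not_mm by (simp add: power_inverse)
qed

lemma mm_power: "z \<in> \<mm> \<Longrightarrow> n > 0 \<Longrightarrow> z ^ n \<in> \<mm>"
  using mm_mult[of z "z ^ (n - 1)"] R_power[OF mm_subset[of z]] by (cases n) auto

definition units :: "'e set" where
  "units = {z. z \<in> R \<and> inverse z \<in> R \<and> z \<noteq> 0}"

lemma units_mult: "z \<in> units \<Longrightarrow> w \<in> units \<Longrightarrow> z * w \<in> units"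
  using R_mult by (auto simp: units_def)

lemma units_inverse: "z \<in> units \<Longrightarrow> inverse z \<in> units"
  by (auto simp: units_def)

lemma units_1: "1 \<in> units" by (simp add: units_def R_1)

lemma units_power: "z \<in> units \<Longrightarrow> z ^ n \<in> units"
  by (induction n) (auto intro: units_1 units_mult)

lemma units_power_int: "z \<in> units \<Longrightarrow> z powi k \<in> units"
  by (auto simp: power_int_def intro: units_power units_inverse simp flip: power_inverse)

lemma units_powerD: assumes "z ^ n \<in> units" "n > 0" shows "z \<in> units"
proof -
  have "inverse z ^ n \<in> R" using assms by (simp add: units_def power_inverse)
  then show ?thesis using assms integrally_closed[of z n] integrally_closed[of "inverse z" n]
    by (auto simp: units_def)
qed

lemma units_power_intD: assumes "z powi k \<in> units" "k \<noteq> 0" shows "z \<in> units"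
proof -
  have *: "inverse z \<in> units \<longleftrightarrow> z \<in> units" by (auto simp: units_def)
  show ?thesis using assms units_powerD[of z "nat k"] units_powerD[of "inverse z" "nat (- k)"] *
    by (auto simp: power_int_def split: if_splits)
qed

lemma units_not_mm: "z \<in> units \<Longrightarrow> z \<notin> \<mm>" by (auto simp: units_def \<mm>_def)

lemma units_iff: "z \<in> units \<longleftrightarrow> z \<in> R \<and> z \<notin> \<mm>"
  using R_0 by (auto simp: units_def \<mm>_def)

text \<open>Turns membership in R into the sign of an exponent of t; the sizes of monomials at a
  place are read off from their weights in this way.\<close>

lemma mm_power_int_in_R:
  assumes "t \<in> \<mm>" "t \<noteq> 0" shows "t powi k \<in> R \<longleftrightarrow> k \<ge> 0"
proof
  assume k: "t powi k \<in> R"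
  show "k \<ge> 0"
  proof (rule ccontr)
    assume "\<not> k \<ge> 0"
    then have "t ^ nat (- k) \<in> \<mm>" and "inverse (t ^ nat (- k)) \<in> R"
      using k mm_power[OF assms(1), of "nat (- k)"] by (auto simp: power_int_def power_inverse)
    then show False using assms(2) by (auto simp: \<mm>_def)
  qed
qed (use R_power[OF mm_subset[OF assms(1)]] in \<open>auto simp: power_int_def\<close>)

end

section \<open>Monomial expansions\<close>

abbreviation xvar :: "'a::comm_semiring_1 poly poly" where "xvar \<equiv> monom_xy 1 1 0"
abbreviation yvar :: "'a::comm_semiring_1 poly poly" where "yvar \<equiv> monom_xy 1 0 1"

lemma coeff_xy_simps [simp]:
  "coeff_xy 0 i j = 0"
  "coeff_xy (monom_xy c k l) i j = (if k = i \<and> l = j then c else 0)"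
  by (auto simp: coeff_xy_def monom_xy_def)

lemma coeff_xy_add [simp]: "coeff_xy (p + q) i j = coeff_xy p i j + coeff_xy q i j"
  by (simp add: coeff_xy_def)

lemma coeff_xy_diff [simp]:
  "coeff_xy (p - q :: 'a::ab_group_add poly poly) i j = coeff_xy p i j - coeff_xy q i j"
  by (simp add: coeff_xy_def)

lemma coeff_xy_sum: "coeff_xy (\<Sum>k\<in>A. f k) i j = (\<Sum>k\<in>A. coeff_xy (f k) i j)"
  by (induction A rule: infinite_finite_induct) simp_all

lemma poly_xy_eqI: "(\<And>i j. coeff_xy p i j = coeff_xy q i j) \<Longrightarrow> p = q"
  unfolding coeff_xy_def by (intro poly_eqI) auto

lemma mem_supp_xy: "(i, j) \<in> supp_xy P \<longleftrightarrow> coeff_xy P i j \<noteq> 0"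
  by (simp add: supp_xy_def)

lemma finite_supp_xy: "finite (supp_xy P)"
proof (rule finite_subset)
  show "supp_xy P \<subseteq> (\<Union>j\<in>{..degree P}. {..degree (coeff P j)} \<times> {j})"
  proof
    fix p assume "p \<in> supp_xy P"
    then obtain i j where p: "p = (i, j)" and nz: "coeff (coeff P j) i \<noteq> 0"
      by (auto simp: supp_xy_def coeff_xy_def)
    have "i \<le> degree (coeff P j)" using nz by (rule le_degree)
    moreover have "j \<le> degree P" using nz by (intro le_degree) auto
    ultimately show "p \<in> (\<Union>j\<in>{..degree P}. {..degree (coeff P j)} \<times> {j})"
      unfolding p by auto
  qed
qed auto

lemma supp_xy_eq_empty_iff [simp]: "supp_xy P = {} \<longleftrightarrow> P = 0"
  by (auto simp: supp_xy_def intro: poly_xy_eqI)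

lemma monom_xy_mult: "monom_xy c i j * monom_xy d k l = monom_xy (c * d) (i + k) (j + l)"
  for c d :: "'a::comm_semiring_1"
  by (simp add: monom_xy_def mult_monom)

lemma monom_xy_power: "monom_xy c i j ^ n = monom_xy (c ^ n) (n * i) (n * j)"
  for c :: "'a::comm_semiring_1"
proof (induction n)
  case 0
  show ?case by (simp add: monom_xy_def monom_0 pCons_one)
qed (simp add: monom_xy_mult)

lemma const_xy_eq_monom: "const_xy c = monom_xy c 0 0"
  by (simp add: const_xy_def monom_xy_def monom_0)

lemma monom_xy_expand: "monom_xy c i j = const_xy c * xvar ^ i * yvar ^ j"
  for c :: "'a::comm_semiring_1"
  by (simp add: monom_xy_power monom_xy_mult const_xy_eq_monom)

text \<open>A substitution is given by the values \<open>T i j\<close> of all monomials, not by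
  those of the two variables. So the exponents may be shifted to avoid negative powers, and
  \<open>T\<close> may also be a table of derivatives, which is not multiplicative.\<close>

definition lin :: "('a::zero \<Rightarrow> 'b::comm_ring_1) \<Rightarrow> (nat \<Rightarrow> nat \<Rightarrow> 'b) \<Rightarrow> 'a poly poly \<Rightarrow> 'b" where
  "lin \<phi> T P = (\<Sum>(i, j)\<in>supp_xy P. \<phi> (coeff_xy P i j) * T i j)"

lemma poly_xy_as_sum: "P = (\<Sum>(i, j)\<in>supp_xy P. monom_xy (coeff_xy P i j) i j)"
proof (rule poly_xy_eqI)
  fix k l
  have "coeff_xy (\<Sum>(i, j)\<in>supp_xy P. monom_xy (coeff_xy P i j) i j) k l
      = (\<Sum>p\<in>supp_xy P. if p = (k, l) then coeff_xy P k l else 0)"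
    unfolding coeff_xy_sum by (intro sum.cong) (auto split: if_splits)
  also have "\<dots> = coeff_xy P k l"
    using mem_supp_xy[of k l P] by (simp add: sum.delta finite_supp_xy)
  finally show "coeff_xy P k l = coeff_xy (\<Sum>(i, j)\<in>supp_xy P. monom_xy (coeff_xy P i j) i j) k l" ..
qed

lemma poly_xy_induct [case_names monom add]:
  assumes "\<And>c i j. Q (monom_xy c i j)" and "\<And>p q. Q p \<Longrightarrow> Q q \<Longrightarrow> Q (p + q)"
  shows "Q P"
proof -
  have "Q 0" using assms(1)[of 0 0 0] by (simp add: monom_xy_def)
  then have "Q (\<Sum>(i, j)\<in>S. monom_xy (coeff_xy P i j) i j)" for S
    by (induction S rule: infinite_finite_induct) (auto intro: assms)
  from this[of "supp_xy P"] show ?thesis by (simp only: poly_xy_as_sum[symmetric])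
qed

lemma lin_cong: "(\<And>i j. (i, j) \<in> supp_xy P \<Longrightarrow> T i j = T' i j) \<Longrightarrow> lin \<phi> T P = lin \<phi> T' P"
  unfolding lin_def by (intro sum.cong) auto

context
  fixes \<phi> :: "'a::comm_ring_1 \<Rightarrow> 'b::comm_ring_1"
  assumes \<phi>: "ring_map \<phi>"
begin

interpretation ring_map \<phi> by (rule \<phi>)

lemma lin_superset:
  "finite S \<Longrightarrow> supp_xy P \<subseteq> S \<Longrightarrow> lin \<phi> T P = (\<Sum>(i, j)\<in>S. \<phi> (coeff_xy P i j) * T i j)"
  unfolding lin_def by (intro sum.mono_neutral_left) (auto simp: mem_supp_xy)

lemma lin_add: "lin \<phi> T (P + Q) = lin \<phi> T P + lin \<phi> T Q"
proof -
  let ?S = "supp_xy P \<union> supp_xy Q"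
  have fin: "finite ?S" by (simp add: finite_supp_xy)
  have "supp_xy (P + Q) \<subseteq> ?S" by (auto simp: mem_supp_xy)
  then show ?thesis
    using lin_superset[OF fin, of "P + Q" T] lin_superset[OF fin, of P T] lin_superset[OF fin, of Q T]
    by (simp add: case_prod_unfold distrib_right sum.distrib)
qed

lemma lin_monom: "lin \<phi> T (monom_xy c i j) = \<phi> c * T i j"
  by (subst lin_superset[of "{(i, j)}"]) (auto simp: mem_supp_xy split: if_splits)

lemma lin_times_left: "c * lin \<phi> T P = lin \<phi> (\<lambda>i j. c * T i j) P"
  unfolding lin_def by (auto simp: sum_distrib_left mult_ac intro: sum.cong)

lemma lin_diff_fun: "lin \<phi> T P - lin \<phi> T' P = lin \<phi> (\<lambda>i j. T i j - T' i j) P"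
  unfolding lin_def by (auto simp: sum_subtractf[symmetric] right_diff_distrib intro: sum.cong)

lemma lin_times_lin: "lin \<phi> T P * lin \<phi> T' Q = lin \<phi> (\<lambda>i j. lin \<phi> (\<lambda>k l. T i j * T' k l) Q) P"
  unfolding lin_times_left[symmetric] by (simp add: lin_def sum_distrib_right case_prod_unfold mult.assoc)

lemma ring_map_lin:
  assumes T0: "T 0 0 = 1" and T: "\<And>i j k l. T (i + k) (j + l) = T i j * T k l"
  shows "ring_map (lin \<phi> T)"
proof
  show "lin \<phi> T (P + Q) = lin \<phi> T P + lin \<phi> T Q" for P Q by (rule lin_add)
  show "lin \<phi> T (P * Q) = lin \<phi> T P * lin \<phi> T Q" for P Q
  proof (induction P rule: poly_xy_induct)
    case (monom c i j)
    show ?case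
    proof (induction Q rule: poly_xy_induct)
      case (monom d k l)
      show ?case by (simp add: monom_xy_mult lin_monom T mult_ac)
    qed (simp add: distrib_left lin_add)
  qed (simp add: distrib_right lin_add)
  show "lin \<phi> T 1 = 1"
    using lin_monom[of T 1 0 0] by (simp add: monom_xy_def T0 monom_0 pCons_one)
qed

end

lemma ring_map_expand:
  assumes "ring_map h"
  shows "h P = lin (\<lambda>c. h (const_xy c)) (\<lambda>i j. h xvar ^ i * h yvar ^ j) P"
proof -
  interpret ring_map h by fact
  have m: "h (monom_xy c i j) = h (const_xy c) * (h xvar ^ i * h yvar ^ j)" for c i j
    by (subst monom_xy_expand) (simp only: map_mult map_power mult.assoc)
  have "h P = h (\<Sum>(i, j)\<in>supp_xy P. monom_xy (coeff_xy P i j) i j)"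
    by (rule arg_cong[OF poly_xy_as_sum])
  also have "\<dots> = lin (\<lambda>c. h (const_xy c)) (\<lambda>i j. h xvar ^ i * h yvar ^ j) P"
    unfolding lin_def map_sum by (intro sum.cong refl) (unfold case_prod_unfold, rule m)
  finally show ?thesis .
qed

lemma ring_map_lin_commute:
  assumes "ring_map h"
  shows "h (lin \<phi> T P) = lin (\<lambda>c. h (\<phi> c)) (\<lambda>i j. h (T i j)) P"
proof -
  interpret ring_map h by fact
  show ?thesis by (simp add: lin_def map_sum case_prod_unfold)
qed

lemma ring_map_xy_eqI:
  assumes "ring_map h" "ring_map h'" "\<And>c. h (const_xy c) = h' (const_xy c)" "h xvar = h' xvar" "h yvar = h' yvar"
  shows "h P = h' P"
proof -
  have "lin (\<lambda>c. h (const_xy c)) (\<lambda>i j. h xvar ^ i * h yvar ^ j) P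
      = lin (\<lambda>c. h' (const_xy c)) (\<lambda>i j. h' xvar ^ i * h' yvar ^ j) P"
    by (simp only: assms(3-5))
  then show ?thesis
    by (rule trans[OF ring_map_expand[OF assms(1)] trans[OF _ ring_map_expand[OF assms(2), symmetric]]])
qed

section \<open>The Jacobian in monomial coordinates\<close>

definition derivation :: "('b::comm_ring_1 \<Rightarrow> 'b) \<Rightarrow> bool" where
  "derivation D \<longleftrightarrow> (\<forall>x y. D (x + y) = D x + D y) \<and> (\<forall>x y. D (x * y) = D x * y + x * D y)"

lemma derivation_add: "derivation D \<Longrightarrow> D (x + y) = D x + D y"
  and derivation_mult: "derivation D \<Longrightarrow> D (x * y) = D x * y + x * D y"
  by (simp_all add: derivation_def)

lemma derivation_0: "derivation D \<Longrightarrow> D 0 = 0"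
  using derivation_add[of D 0 0] by simp

lemma derivation_1: "derivation D \<Longrightarrow> D 1 = 0"
  using derivation_mult[of D 1 1] by simp

lemma derivation_sum: "derivation D \<Longrightarrow> D (\<Sum>i\<in>A. f i) = (\<Sum>i\<in>A. D (f i))"
  by (induction A rule: infinite_finite_induct) (simp_all add: derivation_0 derivation_add)

lemma derivation_power: "derivation D \<Longrightarrow> D (x ^ n) = of_nat n * x ^ (n - 1) * D x"
proof (induction n)
  case (Suc n)
  have e: "x * (of_nat n * x ^ (n - 1)) = of_nat n * x ^ n"
    by (cases n) (simp_all add: mult.left_commute)
  have "D (x ^ Suc n) = D x * x ^ n + x * (of_nat n * x ^ (n - 1) * D x)"
    using Suc by (simp only: power_Suc derivation_mult)
  also have "x * (of_nat n * x ^ (n - 1) * D x) = of_nat n * x ^ n * D x"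
    by (simp only: mult.assoc[symmetric] e[symmetric])
  finally show ?case by (simp add: algebra_simps)
qed (simp add: derivation_1)

lemma derivation_diff: "derivation D \<Longrightarrow> D (x - y) = D x - D y"
  using derivation_add[of D "x - y" y] by simp

lemma coeff_deriv_x [simp]: "coeff (deriv_x p) n = pderiv (coeff p n)"
  by (simp add: deriv_x_def coeff_map_poly)

lemma derivation_deriv_x: "derivation (deriv_x :: 'a::idom poly poly \<Rightarrow> _)"
proof -
  have add: "deriv_x (p + q) = deriv_x p + deriv_x q" for p q :: "'a poly poly"
    by (rule poly_eqI) (simp add: pderiv_add)
  have *: "pderiv (\<Sum>i\<in>A. f i) = (\<Sum>i\<in>A. pderiv (f i))" for A :: "nat set" and f :: "nat \<Rightarrow> 'a poly"
    by (induction A rule: infinite_finite_induct) (simp_all add: pderiv_add)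
  have "deriv_x (p * q) = deriv_x p * q + p * deriv_x q" for p q :: "'a poly poly"
  proof (rule poly_eqI)
    fix n
    show "coeff (deriv_x (p * q)) n = coeff (deriv_x p * q + p * deriv_x q) n"
      unfolding coeff_add coeff_mult coeff_deriv_x * pderiv_mult sum.distrib[symmetric]
      by (intro sum.cong refl) (simp add: add.commute mult.commute)
  qed
  with add show ?thesis unfolding derivation_def by blast
qed

lemma derivation_deriv_y: "derivation (deriv_y :: 'a::idom poly poly \<Rightarrow> _)"
  unfolding derivation_def deriv_y_def pderiv_add pderiv_mult by (simp add: algebra_simps)

lemma deriv_x_monom: "deriv_x (monom_xy c i j) = monom_xy (of_nat i * c) (i - 1) j"
  by (simp add: deriv_x_def monom_xy_def map_poly_monom pderiv_monom)

lemma deriv_y_monom: "deriv_y (monom_xy c i j) = monom_xy (of_nat j * c) i (j - 1)"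
  by (simp add: deriv_y_def monom_xy_def pderiv_monom) (simp add: of_nat_poly smult_monom)

lemma jacobian_add_left: "jacobian_xy (p + q) g = jacobian_xy p g + jacobian_xy q g"
  and jacobian_add_right: "jacobian_xy g (p + q) = jacobian_xy g p + jacobian_xy g q"
  by (simp_all add: jacobian_xy_def derivation_add[OF derivation_deriv_x] derivation_add[OF derivation_deriv_y] algebra_simps)

text \<open>The factor \<open>xvar * yvar\<close> turns both partial derivatives into Euler
  operators, for which monomials are eigenvectors; what remains is the determinant of the exponent
  vectors. It also absorbs the truncated exponents \<open>i - 1\<close> and
  \<open>j - 1\<close>.\<close>

lemma jacobian_monom:
  "xvar * yvar * jacobian_xy (monom_xy c i j) (monom_xy d k l)
    = monom_xy (c * d * of_int (int i * int l - int j * int k)) (i + k) (j + l)"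
proof -
  have x: "xvar * deriv_x (monom_xy c i j) = monom_xy (of_nat i * c) i j" for c :: 'a and i j
    by (cases i) (simp_all add: deriv_x_monom monom_xy_mult, simp add: monom_xy_def)
  have y: "yvar * deriv_y (monom_xy c i j) = monom_xy (of_nat j * c) i j" for c :: 'a and i j
    by (cases j) (simp_all add: deriv_y_monom monom_xy_mult, simp add: monom_xy_def)
  have "xvar * yvar * jacobian_xy (monom_xy c i j) (monom_xy d k l)
    = (xvar * deriv_x (monom_xy c i j)) * (yvar * deriv_y (monom_xy d k l))
      - (xvar * deriv_x (monom_xy d k l)) * (yvar * deriv_y (monom_xy c i j))"
    unfolding jacobian_xy_def by (simp add: algebra_simps)
  also have "\<dots> = monom_xy (of_nat i * c * (of_nat l * d)) (i + k) (j + l)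
      - monom_xy (of_nat k * d * (of_nat j * c)) (i + k) (j + l)"
    unfolding x y monom_xy_mult by (simp add: add.commute)
  also have "\<dots> = monom_xy (c * d * of_int (int i * int l - int j * int k)) (i + k) (j + l)"
    by (rule poly_xy_eqI) (simp add: algebra_simps)
  finally show ?thesis .
qed

lemma lin_jacobian:
  fixes F G :: "'a::idom poly poly"
  assumes \<phi>: "ring_map \<phi>"
  shows "lin \<phi> Z (xvar * yvar * jacobian_xy F G)
    = lin \<phi> (\<lambda>i j. lin \<phi> (\<lambda>k l. of_int (int i * int l - int j * int k) * Z (i + k) (j + l)) G) F"
proof (induction F rule: poly_xy_induct)
  case (monom c i j)
  interpret ring_map \<phi> by fact
  show ?case
  proof (induction G rule: poly_xy_induct)
    case (monom d k l)
    show ?case unfolding jacobian_monom lin_monom[OF \<phi>] by (simp add: mult_ac)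
  next
    case (add p q)
    then show ?case
      unfolding jacobian_add_right distrib_left[of "xvar * yvar"] lin_add[OF \<phi>] lin_monom[OF \<phi>] by (simp only: distrib_left)
  qed
qed (simp only: jacobian_add_left distrib_left lin_add[OF \<phi>])

text \<open>The chain rule for \<open>x = t\<^sup>-\<^sup>u \<eta>\<^sup>a\<close>, \<open>y = t\<^sup>-\<^sup>v \<eta>\<^sup>a'\<close>. Negative powers of \<open>t\<close> are avoided by the factors \<open>t\<^sup>M\<close>
  and \<open>t\<^sup>M'\<close> in \<open>A\<close> and \<open>B\<close>, which account for the terms with \<open>of_int M\<close> and \<open>of_int M'\<close>.\<close>

lemma jacobian_substitution:
  fixes F G :: "'a::idom poly poly" and \<phi> :: "'a \<Rightarrow> 'b::comm_ring_1" and u v M M' :: int and a a' :: nat and t \<eta> :: 'b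
  assumes \<phi>: "ring_map \<phi>" and D1: "derivation D1" and D2: "derivation D2"
    and D1\<phi>: "\<And>c. D1 (\<phi> c) = 0" and D2\<phi>: "\<And>c. D2 (\<phi> c) = 0"
    and t: "D1 t = 1" "D2 t = 0"
    and aa: "a + a' = 1"
    and wF: "\<And>i j. (i, j) \<in> supp_xy F \<Longrightarrow> u * int i + v * int j \<le> M"
    and wG: "\<And>i j. (i, j) \<in> supp_xy G \<Longrightarrow> u * int i + v * int j \<le> M'"
    and J: "jacobian_xy F G = const_xy c"
  defines "A \<equiv> lin \<phi> (\<lambda>i j. t ^ nat (M - u * int i - v * int j) * \<eta> ^ (a * i + a' * j)) F"
    and "B \<equiv> lin \<phi> (\<lambda>i j. t ^ nat (M' - u * int i - v * int j) * \<eta> ^ (a * i + a' * j)) G"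
  shows "(t * D1 A - of_int M * A) * D2 B - D2 A * (t * D1 B - of_int M' * B)
    = - of_int (u * int a' - v * int a) * \<phi> c * t ^ nat (M + M' - u - v) * D2 \<eta>"
proof -
  interpret ring_map \<phi> by fact
  define S where "S N i j = t ^ nat (N - u * int i - v * int j) * \<eta> ^ (a * i + a' * j)" for N i j
  \<comment> \<open>This is t^N times t \<open>D1\<close> applied to the monomial t^(-ui-vj)
    \<eta>^(ai+a'j): subtracting \<open>of_int N * S N i j\<close> removes the contribution of the
    clearing factor.\<close>
  define U where "U N i j = t * D1 (S N i j) - of_int N * S N i j" for N i j
  have D1lin: "D1 (lin \<phi> T P) = lin \<phi> (\<lambda>i j. D1 (T i j)) P" for T P
    by (simp add: lin_def derivation_sum[OF D1] case_prod_unfold derivation_mult[OF D1] D1\<phi>)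
  have D2lin: "D2 (lin \<phi> T P) = lin \<phi> (\<lambda>i j. D2 (T i j)) P" for T P
    by (simp add: lin_def derivation_sum[OF D2] case_prod_unfold derivation_mult[OF D2] D2\<phi>)
  have U: "t * D1 (lin \<phi> (S N) P) - of_int N * lin \<phi> (S N) P = lin \<phi> (U N) P" for N P
    unfolding D1lin lin_times_left[OF \<phi>] lin_diff_fun[OF \<phi>] U_def ..
  \<comment> \<open>At I = J = 1, the exponent of xy, the condition a + a' = 1 makes the power of
    \<eta> trivial, so a constant Jacobian leaves only a power of t times
    \<open>D2 \<eta>\<close>.\<close>
  define Z where "Z I J = t ^ nat (M + M' - u * int I - v * int J) * \<eta> ^ (a * I + a' * J - 1) * D2 \<eta>" for I J
  have Ueq: "U N i j = - of_int (u * int i + v * int j) * S N i j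
      + of_nat (a * i + a' * j) * t ^ nat (N - u * int i - v * int j) * \<eta> ^ (a * i + a' * j - 1) * (t * D1 \<eta>)"
    if "u * int i + v * int j \<le> N" for N i j
  proof -
    define p where "p = nat (N - u * int i - v * int j)"
    define al where "al = a * i + a' * j"
    have tp: "t * (of_nat p * t ^ (p - 1)) = of_nat p * t ^ p" by (cases p) (simp_all add: mult_ac)
    have "int p = N - (u * int i + v * int j)" using that by (simp add: p_def)
    then have "of_nat p = (of_int (N - (u * int i + v * int j)) :: 'b)"
      using of_int_of_nat_eq[of p, where 'a = 'b] by simp
    then have pN: "of_nat p - of_int N = (- of_int (u * int i + v * int j) :: 'b)" by simp
    have "U N i j = (t * (of_nat p * t ^ (p - 1))) * \<eta> ^ al
        + of_nat al * t ^ p * \<eta> ^ (al - 1) * (t * D1 \<eta>) - of_int N * (t ^ p * \<eta> ^ al)"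
      unfolding U_def S_def p_def[symmetric] al_def[symmetric]
      by (simp add: derivation_mult[OF D1] derivation_power[OF D1] t algebra_simps)
    also have "\<dots> = (of_nat p - of_int N) * (t ^ p * \<eta> ^ al) + of_nat al * t ^ p * \<eta> ^ (al - 1) * (t * D1 \<eta>)"
      unfolding tp by (simp add: algebra_simps)
    finally show ?thesis unfolding S_def p_def[symmetric] al_def[symmetric] pN .
  qed
  have V: "D2 (S N i j) = of_nat (a * i + a' * j) * t ^ nat (N - u * int i - v * int j) * \<eta> ^ (a * i + a' * j - 1) * D2 \<eta>" for N i j
    unfolding S_def by (simp add: derivation_mult[OF D2] derivation_power[OF D2] t mult_ac)
  have key: "U M i j * D2 (S M' k l) - D2 (S M i j) * U M' k l
      = - of_int (u * int a' - v * int a) * (of_int (int i * int l - int j * int k) * Z (i + k) (j + l))"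
    if "(i, j) \<in> supp_xy F" "(k, l) \<in> supp_xy G" for i j k l
  proof -
    define p where "p = nat (M - u * int i - v * int j)"
    define q where "q = nat (M' - u * int k - v * int l)"
    define al where "al = a * i + a' * j"
    define be where "be = a * k + a' * l"
    define x where "x = u * int i + v * int j"
    define y where "y = u * int k + v * int l"
    have wx: "x \<le> M" "y \<le> M'" using wF[OF that(1)] wG[OF that(2)] by (simp_all add: x_def y_def)
    have pq: "nat (M + M' - u * int (i + k) - v * int (j + l)) = p + q"
      using wx unfolding p_def q_def x_def y_def by (simp add: algebra_simps nat_add_distrib[symmetric])
    have ab: "a * (i + k) + a' * (j + l) = al + be" unfolding al_def be_def by (simp add: algebra_simps)
    have e1: "of_nat be * (\<eta> ^ al * \<eta> ^ (be - 1)) = of_nat be * \<eta> ^ (al + be - 1)"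
      by (cases be) (simp_all add: power_add)
    have e2: "of_nat al * (\<eta> ^ (al - 1) * \<eta> ^ be) = of_nat al * \<eta> ^ (al + be - 1)"
      by (cases al) (simp_all add: power_add)
    \<comment> \<open>Multiplicativity of determinants: the matrix with columns (x, al) and (y, be)
      is the one with rows (u, v) and (a, a') times the one with columns (i, j) and (k, l).\<close>
    have int: "- x * int be + y * int al = - (u * int a' - v * int a) * (int i * int l - int j * int k)"
    proof -
      have "- x * int be + y * int al = - (u * int a' - v * int a) * (int i * int l - int j * int k)"
        unfolding x_def y_def al_def be_def by (simp add: algebra_simps)
      then show ?thesis .
    qed
    have "U M i j * D2 (S M' k l) - D2 (S M i j) * U M' k l
       = t ^ (p + q) * D2 \<eta> * (- of_int x * (of_nat be * (\<eta> ^ al * \<eta> ^ (be - 1)))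
          + of_int y * (of_nat al * (\<eta> ^ (al - 1) * \<eta> ^ be)))"
      using wx unfolding V Ueq[OF wx(1)[unfolded x_def]] Ueq[OF wx(2)[unfolded y_def]]
      unfolding S_def p_def[symmetric] q_def[symmetric] al_def[symmetric] be_def[symmetric] x_def[symmetric] y_def[symmetric]
      by (simp add: power_add algebra_simps)
    also have "\<dots> = t ^ (p + q) * D2 \<eta> * \<eta> ^ (al + be - 1) * of_int (- x * int be + y * int al)"
      unfolding e1 e2 by (simp add: algebra_simps)
    finally show ?thesis unfolding int Z_def pq ab by (simp add: mult_ac)
  qed
  have "(t * D1 A - of_int M * A) * D2 B - D2 A * (t * D1 B - of_int M' * B)
     = lin \<phi> (U M) F * lin \<phi> (\<lambda>i j. D2 (S M' i j)) G - lin \<phi> (\<lambda>i j. D2 (S M i j)) F * lin \<phi> (U M') G"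
    unfolding A_def B_def S_def[symmetric] U D2lin ..
  also have "\<dots> = lin \<phi> (\<lambda>i j. lin \<phi> (\<lambda>k l. U M i j * D2 (S M' k l) - D2 (S M i j) * U M' k l) G) F"
    unfolding lin_times_lin[OF \<phi>] lin_diff_fun[OF \<phi>] ..
  also have "\<dots> = lin \<phi> (\<lambda>i j. lin \<phi> (\<lambda>k l. - of_int (u * int a' - v * int a) * (of_int (int i * int l - int j * int k) * Z (i + k) (j + l))) G) F"
    by (intro lin_cong key)
  also have "\<dots> = - of_int (u * int a' - v * int a) * lin \<phi> Z (xvar * yvar * jacobian_xy F G)"
    unfolding lin_times_left[OF \<phi>, symmetric] lin_jacobian[OF \<phi>] ..
  also have "xvar * yvar * jacobian_xy F G = monom_xy c 1 1"
    unfolding J const_xy_eq_monom monom_xy_mult by simp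
  finally show ?thesis unfolding lin_monom[OF \<phi>] Z_def using aa by (simp add: mult_ac)
qed

section \<open>Leading terms\<close>

definition red :: "'a::comm_ring_1 poly poly \<Rightarrow> 'a poly" where
  "red P = map_poly (\<lambda>p. poly p 0) P"

lemma coeff_red [simp]: "coeff (red P) k = poly (coeff P k) 0"
  by (simp add: red_def coeff_map_poly)

lemma ring_map_red: "ring_map (red :: 'a::comm_ring_1 poly poly \<Rightarrow> _)"
  unfolding red_def by (intro ring_map_map_poly ring_map_poly)

lemma red_deriv_y: "red (deriv_y P) = pderiv (red P)"
  unfolding red_def deriv_y_def by (intro map_poly_pderiv ring_map_poly)

lemma xvar_power_eq: "xvar ^ N = [:monom 1 N:]"
  by (simp add: monom_xy_power) (simp add: monom_xy_def monom_0)

lemma coeff_xvar_power_mult: "coeff (xvar ^ N * P) k = monom 1 N * coeff P k"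
  for P :: "'a::comm_ring_1 poly poly"
  unfolding xvar_power_eq by simp

lemma factor_coeffs:
  fixes P :: "'a::idom poly poly"
  assumes "\<And>k. coeff P k = monom 1 N * p k"
  shows "\<exists>P1. P = xvar ^ N * P1 \<and> (\<forall>k. coeff P1 k = p k)"
proof -
  have "[:monom 1 N:] dvd P" unfolding const_poly_dvd_iff assms by simp
  then obtain P1 where P1: "P = [:monom 1 N:] * P1" by blast
  have "monom 1 N * coeff P1 k = monom 1 N * p k" for k
    unfolding assms[symmetric] P1 by simp
  then have "coeff P1 k = p k" for k by (simp add: monom_eq_0_iff)
  with P1 show ?thesis unfolding xvar_power_eq by blast
qed

lemma coeff_red_factor:
  fixes P1 :: "'a::comm_ring_1 poly poly"
  shows "coeff (red P1) k = coeff (coeff (xvar ^ N * P1) k) N"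
  unfolding coeff_xvar_power_mult coeff_monom_mult by (simp add: poly_0_coeff_0)

lemma leading_factor:
  fixes P :: "'a::idom poly poly"
  assumes "P \<noteq> 0"
  shows "\<exists>N P1. P = xvar ^ N * P1 \<and> red P1 \<noteq> 0"
proof -
  define N where "N = (LEAST n. \<exists>k. coeff (coeff P k) n \<noteq> 0)"
  have ex: "\<exists>n k. coeff (coeff P k) n \<noteq> 0"
    using assms by (metis coeff_0 poly_eqI)
  have N: "\<exists>k. coeff (coeff P k) N \<noteq> 0"
    unfolding N_def using ex by (rule LeastI_ex)
  have less: "coeff (coeff P k) n = 0" if "n < N" for n k
    using not_less_Least[of n "\<lambda>n. \<exists>k. coeff (coeff P k) n \<noteq> 0"] that unfolding N_def by blast
  have "\<forall>k. \<exists>p. coeff P k = monom 1 N * p"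
    using less monom_1_dvd_iff'[of N] unfolding dvd_def by blast
  then obtain p where "\<And>k. coeff P k = monom 1 N * p k" by metis
  from factor_coeffs[of P N p, OF this] obtain P1 where P1: "P = xvar ^ N * P1" by blast
  from N obtain k where k: "coeff (coeff P k) N \<noteq> 0" by blast
  have "coeff (red P1) k \<noteq> 0" using k unfolding P1 coeff_red_factor[of P1 k N] .
  then have "red P1 \<noteq> 0" by (metis coeff_0)
  with P1 show ?thesis by blast
qed

lemma red_xvar: "red xvar = 0"
  by (rule poly_eqI) (simp add: monom_xy_def coeff_pCons monom_0 poly_monom split: nat.splits)

text \<open>The coefficient of \<open>xvar ^ (N + N')\<close> in the bracket identity. The leading
  terms of A and B sit at the weights \<open>M - int N\<close> and \<open>M' - int N'\<close>, on
  which the operators x d/dx - M and x d/dx - M' act as scalars; the right side reaches this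
  coefficient only for \<open>E = N + N'\<close>.\<close>

lemma leading_bracket:
  fixes A B :: "'a::field_char_0 poly poly"
  assumes A: "A = xvar ^ N * A1" and B: "B = xvar ^ N' * B1"
    and eq: "(xvar * deriv_x A - of_int M * A) * deriv_y B - deriv_y A * (xvar * deriv_x B - of_int M' * B)
      = monom_xy c E 0"
    and c: "c = 0 \<or> N + N' \<le> E"
  shows "of_int (int N - M) * (red A1 * pderiv (red B1)) - of_int (int N' - M') * (pderiv (red A1) * red B1)
    = [:if E = N + N' then c else 0:]"
proof -
  note Dx = derivation_deriv_x[where 'a = 'a] and Dy = derivation_deriv_y[where 'a = 'a]
  have dx: "deriv_x xvar = (1 :: 'a poly poly)" and dy: "deriv_y xvar = (0 :: 'a poly poly)"
    by (simp_all add: deriv_x_monom deriv_y_monom) (simp_all add: monom_xy_def monom_0 pCons_one)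
  have x: "xvar * deriv_x (xvar ^ n * P) - of_int m * (xvar ^ n * P)
      = xvar ^ n * (of_int (int n - m) * P + xvar * deriv_x P)" for n m and P :: "'a poly poly"
  proof -
    have "xvar * (of_nat n * xvar ^ (n - 1)) = of_nat n * (xvar ^ n :: 'a poly poly)"
      by (cases n) (simp_all add: mult.left_commute)
    moreover have "deriv_x (xvar ^ n * P) = of_nat n * xvar ^ (n - 1) * P + xvar ^ n * deriv_x P"
      unfolding derivation_mult[OF Dx] derivation_power[OF Dx] dx by simp
    ultimately have "xvar * deriv_x (xvar ^ n * P) = of_nat n * xvar ^ n * P + xvar ^ n * (xvar * deriv_x P)"
      by (simp only: distrib_left mult.assoc[symmetric]) (simp only: mult_ac)
    then show ?thesis by (simp only: of_int_diff of_int_of_nat_eq) (simp only: algebra_simps)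
  qed
  have y: "deriv_y (xvar ^ n * P) = xvar ^ n * deriv_y P" for n and P :: "'a poly poly"
    unfolding derivation_mult[OF Dy] derivation_power[OF Dy] dy by simp
  define W where "W = (of_int (int N - M) * A1 + xvar * deriv_x A1) * deriv_y B1
    - deriv_y A1 * (of_int (int N' - M') * B1 + xvar * deriv_x B1)"
  have W: "xvar ^ (N + N') * W = monom_xy c E 0"
    unfolding eq[symmetric] A B x y W_def power_add by (simp only: algebra_simps)
  interpret r: ring_map "red :: 'a poly poly \<Rightarrow> _" by (rule ring_map_red)
  have redW: "red W = of_int (int N - M) * (red A1 * pderiv (red B1)) - of_int (int N' - M') * (pderiv (red A1) * red B1)"
    unfolding W_def r.map_diff r.map_mult r.map_add r.map_of_int red_xvar red_deriv_y by (simp add: mult_ac)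
  have "red W = [:if E = N + N' then c else 0:]"
  proof (rule poly_eqI)
    fix k
    have "coeff (red W) k = coeff (coeff (monom_xy c E 0) k) (N + N')"
      unfolding W[symmetric] by (rule coeff_red_factor)
    also have "\<dots> = coeff [:if E = N + N' then c else 0:] k"
      by (auto simp: monom_xy_def coeff_pCons split: nat.splits)
    finally show "coeff (red W) k = coeff [:if E = N + N' then c else 0:] k" .
  qed
  then show ?thesis unfolding redW .
qed

section \<open>Critical points by Hensel lifting\<close>

text \<open>Newton iteration from a simple root of the reduction. A root modulo an arbitrary power
  of the inner variable is all that is needed, so \<xi> stays a polynomial.\<close>

lemma hensel_root:
  fixes H :: "'a::field poly poly"
  assumes r: "poly (red H) r = 0" and r': "poly (pderiv (red H)) r \<noteq> 0"
  shows "\<exists>\<xi>. poly \<xi> 0 = r \<and> monom 1 (Suc n) dvd poly H \<xi>"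
proof (induction n)
  have pr: "poly (poly H \<xi>) 0 = poly (red H) (poly \<xi> 0)" for H :: "'a poly poly" and \<xi>
    unfolding red_def by (rule map_poly_poly[OF ring_map_poly])
  {
    case 0
    have "coeff (poly H [:r:]) 0 = 0" using pr[of H "[:r:]"] r by (simp add: poly_0_coeff_0)
    then have "monom 1 (Suc 0) dvd poly H [:r:]" by (simp add: monom_1_dvd_iff')
    then show ?case by (intro exI[of _ "[:r:]"]) simp
  next
    case (Suc n)
    then obtain \<xi> s where \<xi>: "poly \<xi> 0 = r" and s: "poly H \<xi> = monom 1 (Suc n) * s"
      by (auto elim: dvdE)
    define s' where "s' = poly (pderiv H) \<xi>"
    have s'0: "poly s' 0 \<noteq> 0"
      using r' unfolding s'_def pr \<xi> red_deriv_y[unfolded deriv_y_def] .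
    \<comment> \<open>Makes the constant coefficient of s + e s' vanish; the Taylor remainder
      carries one more factor \<open>monom e (Suc n)\<close>.\<close>
    define e where "e = - poly s 0 / poly s' 0"
    obtain q where q: "poly H (\<xi> + monom e (Suc n))
        = poly H \<xi> + monom e (Suc n) * s' + (monom e (Suc n))\<^sup>2 * q"
      using taylor_first_order[of H \<xi> "monom e (Suc n)"] unfolding s'_def by blast
    have m: "monom e (Suc n) = monom 1 (Suc n) * [:e:]" by (simp add: smult_monom)
    have "poly H (\<xi> + monom e (Suc n)) = monom 1 (Suc n) * (s + [:e:] * s' + [:e:] * monom e (Suc n) * q)"
      unfolding q s power2_eq_square by (subst m, subst (2) m) (simp only: algebra_simps)
    moreover have "poly (s + [:e:] * s' + [:e:] * monom e (Suc n) * q) 0 = 0"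
      using s'0 by (simp add: e_def poly_monom)
    then have "monom 1 1 dvd s + [:e:] * s' + [:e:] * monom e (Suc n) * q"
      by (simp add: monom_1_dvd_iff' poly_0_coeff_0)
    ultimately have "monom 1 (Suc n) * monom 1 1 dvd poly H (\<xi> + monom e (Suc n))"
      by (metis mult_dvd_mono dvd_refl)
    then have "monom 1 (Suc (Suc n)) dvd poly H (\<xi> + monom e (Suc n))"
      by (simp add: mult_monom)
    moreover have "poly (\<xi> + monom e (Suc n)) 0 = r" using \<xi> by (simp add: poly_monom)
    ultimately show ?case by blast
  }
qed

lemma order_shift_coeffs:
  fixes f :: "'a::idom poly"
  assumes "f \<noteq> 0"
  shows "k < order r f \<Longrightarrow> coeff (pcompose f [:r, 1:]) k = 0"
    and "coeff (pcompose f [:r, 1:]) (order r f) \<noteq> 0"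
proof -
  obtain g where g: "f = [:- r, 1:] ^ order r f * g" "\<not> [:- r, 1:] dvd g"
    using order_decomp[OF assms] by blast
  interpret ring_map "\<lambda>p. pcompose p [:r, 1:]" by (rule ring_map_pcompose)
  have "pcompose [:- r, 1:] [:r, 1:] = [:0, 1:]" by (simp add: pcompose_pCons)
  then have "pcompose f [:r, 1:] = [:0, 1:] ^ order r f * pcompose g [:r, 1:]"
    by (subst g(1)) (simp only: map_mult map_power)
  then have e: "pcompose f [:r, 1:] = monom 1 (order r f) * pcompose g [:r, 1:]"
    by (simp add: monom_altdef)
  show "k < order r f \<Longrightarrow> coeff (pcompose f [:r, 1:]) k = 0"
    unfolding e coeff_monom_mult by simp
  have "coeff (pcompose g [:r, 1:]) 0 = poly g r"
    unfolding poly_0_coeff_0[symmetric] poly_pcompose by simp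
  with g(2) show "coeff (pcompose f [:r, 1:]) (order r f) \<noteq> 0"
    by (subst e) (simp add: coeff_monom_mult poly_eq_0_iff_dvd)
qed

text \<open>\<open>star u v a a' M P\<close> is \<open>t\<^sup>M P(t\<^sup>-\<^sup>u \<eta>\<^sup>a, t\<^sup>-\<^sup>v \<eta>\<^sup>a')\<close> with \<open>t\<close> the inner and \<open>\<eta>\<close> the outer variable, provided that no
  weight in the support of \<open>P\<close> exceeds \<open>M\<close>; \<open>rescale q \<kappa>\<close> substitutes \<open>t\<^sup>q\<close> for \<open>t\<close> and \<open>t\<^sup>\<kappa> \<zeta>\<close> for the outer
  variable, where \<open>q = 2\<close> makes room for edges of half-integral slope.\<close>

definition star :: "int \<Rightarrow> int \<Rightarrow> nat \<Rightarrow> nat \<Rightarrow> int \<Rightarrow> 'a::comm_ring_1 poly poly \<Rightarrow> 'a poly poly" where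
  "star u v a a' M P = lin const_xy (\<lambda>i j. monom_xy 1 (nat (M - u * int i - v * int j)) (a * i + a' * j)) P"

definition rescale :: "nat \<Rightarrow> nat \<Rightarrow> 'a::comm_ring_1 poly poly \<Rightarrow> 'a poly poly" where
  "rescale q \<kappa> Q = pcompose (map_poly (\<lambda>p. pcompose p (monom 1 q)) Q) [:0, monom 1 \<kappa>:]"

lemma ring_map_rescale: "ring_map (rescale q \<kappa>)"
  unfolding rescale_def by (intro ring_map_comp[OF ring_map_pcompose] ring_map_map_poly ring_map_pcompose)

lemma coeff_rescale: "coeff (rescale q \<kappa> Q) k = monom 1 (\<kappa> * k) * pcompose (coeff Q k) (monom 1 q)"
  unfolding rescale_def by (simp add: coeff_pcompose_linear coeff_map_poly monom_power)

text \<open>The chain rule for \<eta> = \<xi>(t^q) + t^\<kappa> \<zeta>: replacing t by t^q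
  multiplies all weights by q, and the derivative of \<eta> by \<zeta> is t^\<kappa>, whence the
  exponent on the right.\<close>

lemma rescale_bracket:
  fixes F G :: "'a::idom poly poly" and u v M M' :: int and q \<kappa> :: nat and \<xi> :: "'a poly"
  assumes aa: "a + a' = 1"
    and wF: "\<And>i j. (i, j) \<in> supp_xy F \<Longrightarrow> u * int i + v * int j \<le> M"
    and wG: "\<And>i j. (i, j) \<in> supp_xy G \<Longrightarrow> u * int i + v * int j \<le> M'"
    and J: "jacobian_xy F G = const_xy c"
  defines "A \<equiv> rescale q \<kappa> (pcompose (star u v a a' M F) [:\<xi>, 1:])"
    and "B \<equiv> rescale q \<kappa> (pcompose (star u v a a' M' G) [:\<xi>, 1:])"
  shows "(xvar * deriv_x A - of_int (int q * M) * A) * deriv_y B - deriv_y A * (xvar * deriv_x B - of_int (int q * M') * B)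
    = monom_xy (- of_int (int q * (u * int a' - v * int a)) * c) (nat (int q * (M + M' - u - v)) + \<kappa>) 0"
proof -
  let ?h = "\<lambda>P. rescale q \<kappa> (pcompose P [:\<xi>, 1:])"
  interpret h: ring_map ?h
    by (intro ring_map_comp[OF ring_map_rescale] ring_map_pcompose)
  define \<eta> where "\<eta> = [:pcompose \<xi> (monom 1 q), monom 1 \<kappa>:]"
  have hc: "?h (const_xy c) = const_xy c" for c
    by (simp add: const_xy_def rescale_def map_poly_pCons)
  have hx: "?h xvar = xvar ^ q"
    unfolding xvar_power_eq by (simp add: monom_xy_def monom_0 rescale_def map_poly_pCons)
      (simp add: pcompose_pCons monom_Suc monom_0)
  have hy: "?h yvar = \<eta>"
    unfolding \<eta>_def by (rule poly_eqI)
      (auto simp: coeff_rescale monom_xy_def monom_Suc monom_0 pcompose_pCons coeff_pCons pCons_one pcompose_1 split: nat.splits)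
  have hs: "?h (star u v a a' N P) = lin const_xy
      (\<lambda>i j. xvar ^ nat (int q * N - (int q * u) * int i - (int q * v) * int j) * \<eta> ^ (a * i + a' * j)) P" for N P
  proof -
    have "?h (monom_xy 1 e f) = xvar ^ (q * e) * \<eta> ^ f" for e f
    proof -
      have "monom_xy 1 e f = (xvar :: 'a poly poly) ^ e * yvar ^ f"
        by (simp add: monom_xy_power monom_xy_mult)
      then show ?thesis by (simp only: h.map_mult h.map_power hx hy power_mult)
    qed
    moreover have "q * nat (N - u * int i - v * int j) = nat (int q * N - (int q * u) * int i - (int q * v) * int j)" for i j
    proof -
      have "nat (int q * N - (int q * u) * int i - (int q * v) * int j) = nat (int q * (N - u * int i - v * int j))"
        by (simp add: algebra_simps)
      then show ?thesis by (simp add: nat_mult_distrib)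
    qed
    ultimately show ?thesis unfolding star_def ring_map_lin_commute[OF h.ring_map_axioms] hc by simp
  qed
  have \<eta>': "deriv_y \<eta> = xvar ^ \<kappa>"
    unfolding \<eta>_def deriv_y_def xvar_power_eq by (simp add: pderiv_pCons)
  have "(xvar * deriv_x A - of_int (int q * M) * A) * deriv_y B - deriv_y A * (xvar * deriv_x B - of_int (int q * M') * B)
    = - of_int ((int q * u) * int a' - (int q * v) * int a) * const_xy c
      * xvar ^ nat (int q * M + int q * M' - int q * u - int q * v) * deriv_y \<eta>"
    unfolding A_def B_def hs
  proof (rule jacobian_substitution[OF ring_map_const_xy derivation_deriv_x derivation_deriv_y _ _ _ _ aa _ _ J])
    show "deriv_x (const_xy c) = 0" "deriv_y (const_xy c) = 0" for c :: 'a
      by (simp_all add: const_xy_eq_monom deriv_x_monom deriv_y_monom) (simp_all add: monom_xy_def)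
    show "deriv_x xvar = (1 :: 'a poly poly)" "deriv_y xvar = (0 :: 'a poly poly)"
      by (simp_all add: deriv_x_monom deriv_y_monom) (simp_all add: monom_xy_def monom_0 pCons_one)
    show "(int q * u) * int i + (int q * v) * int j \<le> int q * M" if "(i, j) \<in> supp_xy F" for i j
      using mult_left_mono[OF wF[OF that], of "int q"] by (simp add: algebra_simps)
    show "(int q * u) * int i + (int q * v) * int j \<le> int q * M'" if "(i, j) \<in> supp_xy G" for i j
      using mult_left_mono[OF wG[OF that], of "int q"] by (simp add: algebra_simps)
  qed
  also have "int q * M + int q * M' - int q * u - int q * v = int q * (M + M' - u - v)"
    by (simp add: algebra_simps)
  also have "(int q * u) * int a' - (int q * v) * int a = int q * (u * int a' - v * int a)"
    by (simp add: algebra_simps)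
  also have "- of_int (int q * (u * int a' - v * int a)) = (const_xy (- of_int (int q * (u * int a' - v * int a))) :: 'a poly poly)"
    by (simp only: ring_map.map_of_int[OF ring_map_const_xy] ring_map.map_uminus[OF ring_map_const_xy])
  finally show ?thesis
    unfolding \<eta>' const_xy_eq_monom monom_xy_power monom_xy_mult by simp
qed

text \<open>An edge of the Newton polygon in t and the outer variable: by
  \<open>q * m = 2 * \<kappa>\<close> the constant and the quadratic term both acquire the factor
  t^(2\<kappa>), whereas the linear term has order at least \<open>\<kappa> + q * n\<close>, which
  is larger, and all others at least 3\<kappa>.\<close>

lemma rescale_leading_quadratic:
  fixes Q :: "'a::idom poly poly"
  assumes Q0: "coeff Q 0 = monom 1 m * \<alpha>" and Q1: "coeff Q 1 = monom 1 n * \<beta>"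
    and m: "q * m = 2 * \<kappa>" and "\<kappa> \<ge> 1" "q \<ge> 1" and n: "q * n > \<kappa>"
  shows "\<exists>F1. rescale q \<kappa> Q = xvar ^ (2 * \<kappa>) * F1 \<and> red F1 = [:poly \<alpha> 0, 0, poly (coeff Q 2) 0:]"
proof -
  let ?c = "\<lambda>p :: 'a poly. pcompose p (monom 1 q)"
  interpret c: ring_map ?c by (rule ring_map_pcompose)
  have cm: "?c (monom 1 e) = monom 1 (q * e)" for e
  proof -
    have "?c (monom 1 e) = ?c ([:0, 1:] ^ e)" by (simp add: monom_altdef)
    also have "\<dots> = monom 1 q ^ e" by (simp only: c.map_power) (simp add: pcompose_pCons)
    finally show ?thesis by (simp add: monom_power)
  qed
  define p where "p k = (if k = 0 then ?c \<alpha> else if k = 1 then monom 1 (q * n - \<kappa>) * ?c \<beta>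
      else monom 1 (\<kappa> * (k - 2)) * ?c (coeff Q k))" for k
  have "coeff (rescale q \<kappa> Q) k = monom 1 (2 * \<kappa>) * p k" for k
  proof -
    consider "k = 0" | "k = 1" | "k \<ge> 2" by linarith
    then show ?thesis
    proof cases
      case 1
      then show ?thesis by (simp add: coeff_rescale Q0 cm m p_def)
    next
      case 2
      have "2 * \<kappa> + (q * n - \<kappa>) = \<kappa> + q * n" using n by simp
      then have "monom 1 (2 * \<kappa>) * (monom 1 (q * n - \<kappa>) * ?c \<beta>) = monom 1 \<kappa> * (monom 1 (q * n) * ?c \<beta>)"
        by (simp only: mult.assoc[symmetric] mult_monom mult_1_left)
      then show ?thesis using 2 Q1 by (auto simp: coeff_rescale cm p_def)
    next
      case 3
      have "2 * \<kappa> + \<kappa> * (k - 2) = \<kappa> * k" using 3 by (simp add: algebra_simps flip: add_mult_distrib2)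
      then have "monom 1 (2 * \<kappa>) * (monom 1 (\<kappa> * (k - 2)) * ?c (coeff Q k)) = monom 1 (\<kappa> * k) * ?c (coeff Q k)"
        by (simp only: mult.assoc[symmetric] mult_monom mult_1_left)
      then show ?thesis using 3 by (auto simp: coeff_rescale p_def)
    qed
  qed
  from factor_coeffs[of "rescale q \<kappa> Q" "2 * \<kappa>" p, OF this] obtain F1
    where F1: "rescale q \<kappa> Q = xvar ^ (2 * \<kappa>) * F1" "\<And>k. coeff F1 k = p k" by blast
  have p0: "poly (?c \<gamma>) 0 = poly \<gamma> 0" for \<gamma>
    using \<open>q \<ge> 1\<close> by (simp add: poly_pcompose poly_monom zero_power)
  have "red F1 = [:poly \<alpha> 0, 0, poly (coeff Q 2) 0:]"
  proof (rule poly_eqI)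
    fix k :: nat
    consider "k = 0" | "k = 1" | "k = 2" | "k \<ge> 3" by linarith
    then show "coeff (red F1) k = coeff [:poly \<alpha> 0, 0, poly (coeff Q 2) 0:] k"
    proof cases
      case 3
      then show ?thesis by (simp add: F1 p_def p0 coeff_pCons numeral_2_eq_2 monom_0)
    next
      case 4
      then have "\<kappa> * (k - 2) > 0" using \<open>\<kappa> \<ge> 1\<close> by simp
      moreover have "coeff [:poly \<alpha> 0, 0, poly (coeff Q 2) 0:] k = 0"
        using 4 by (intro coeff_eq_0) (simp add: le_less_trans[OF degree_pCons_le])
      ultimately show ?thesis using 4 by (simp add: F1 p_def poly_monom)
    qed (use n in \<open>simp_all add: F1 p_def p0 poly_monom\<close>)
  qed
  with F1(1) show ?thesis by blast
qed

text \<open>The coefficient of degree k in the outer variable is divisible by t^(\<kappa> k), and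
  that of degree b has order exactly \<kappa> b. The first fact bounds the degree of the leading
  term, the second bounds its order l.\<close>

lemma rescale_leading_bounds:
  fixes Q :: "'a::idom poly poly"
  assumes Qb: "poly (coeff Q b) 0 \<noteq> 0" and "q \<ge> 1"
  shows "\<exists>l G1. rescale q \<kappa> Q = xvar ^ l * G1 \<and> red G1 \<noteq> 0 \<and> l \<le> \<kappa> * b \<and> \<kappa> * degree (red G1) \<le> l"
proof -
  have b: "coeff (coeff (rescale q \<kappa> Q) b) (\<kappa> * b) \<noteq> 0"
    using assms by (simp add: coeff_rescale coeff_monom_mult poly_pcompose poly_monom zero_power flip: poly_0_coeff_0)
  then have "rescale q \<kappa> Q \<noteq> 0" by (metis coeff_0)
  from leading_factor[OF this] obtain l G1 where G1: "rescale q \<kappa> Q = xvar ^ l * G1" and nz: "red G1 \<noteq> 0"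
    by blast
  have "l \<le> \<kappa> * b"
    using b unfolding G1 coeff_xvar_power_mult coeff_monom_mult by (auto split: if_splits)
  moreover have "coeff (red G1) (degree (red G1)) \<noteq> 0" using nz by (rule leading_coeff_neq_0)
  then have "\<kappa> * degree (red G1) \<le> l"
    unfolding coeff_red_factor[of G1 _ l] G1[symmetric] coeff_rescale coeff_monom_mult by (auto split: if_splits)
  ultimately show ?thesis using G1 nz by blast
qed

section \<open>Local analysis at a double root of the leading form\<close>

lemma order_eq_1I:
  fixes p :: "'a::field_char_0 poly"
  assumes "poly p r = 0" "poly (pderiv p) r \<noteq> 0"
  shows "order r p = 1"
proof -
  have "p \<noteq> 0" using assms(2) by auto
  then show ?thesis using order_pderiv[of p r] order_0I[OF assms(2)] assms(1) by simp
qed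

lemma quadratic_simple_root:
  fixes \<alpha> \<gamma> :: "'a::{alg_closed_field, field_char_0}"
  assumes "\<alpha> \<noteq> 0" "\<gamma> \<noteq> 0"
  shows "\<exists>r. order r [:\<alpha>, 0, \<gamma>:] = 1"
proof -
  have "degree [:\<alpha>, 0, \<gamma>:] > 0" using assms by simp
  then obtain r where r: "poly [:\<alpha>, 0, \<gamma>:] r = 0" using alg_closed_imp_poly_has_root by blast
  then have "r \<noteq> 0" using assms by auto
  then have "poly (pderiv [:\<alpha>, 0, \<gamma>:]) r \<noteq> 0" using assms by (simp add: pderiv_pCons)
  with r show ?thesis using order_eq_1I by blast
qed

text \<open>In the coordinate \<zeta> with \<eta> = \<xi>(t) + t^d \<zeta> no negative power of t is
  left: F and G, being t^(-2d) \<open>Fs\<close> and t^(-bd) \<open>Gs\<close>, become polynomials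
  in t and \<zeta>, and the coefficient of \<zeta>^2 in F does not vanish at t = 0. So at a place
  where F is finite, first \<zeta> and then G is finite.\<close>

theorem local_expansion:
  fixes F G :: "'a::{alg_closed_field, field_char_0} poly poly" and u v :: int and a a' b d :: nat
  assumes aa: "a + a' = 1" and b: "odd b" "b > 1" and d: "d \<ge> 1" and uv: "u + v \<le> int d + 1"
    and wF: "\<And>i j. (i, j) \<in> supp_xy F \<Longrightarrow> u * int i + v * int j \<le> 2 * int d"
    and wG: "\<And>i j. (i, j) \<in> supp_xy G \<Longrightarrow> u * int i + v * int j \<le> int b * int d"
    and J: "jacobian_xy F G = const_xy c"
    and Fs: "Fs = star u v a a' (2 * int d) F" and Gs: "Gs = star u v a a' (int b * int d) G"
    and f0: "red Fs \<noteq> 0" "order r (red Fs) = 2"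
    and g0: "(red Gs)\<^sup>2 = smult e (red Fs ^ b)" "e \<noteq> 0"
  obtains \<xi> Q G4 where "poly \<xi> 0 = r" "Q = pcompose Fs [:\<xi>, 1:]" "monom 1 (2 * d) dvd coeff Q 0"
    "monom 1 (2 * d) dvd coeff Q 1" "poly (coeff Q 2) 0 \<noteq> 0"
    "rescale 1 d (pcompose Gs [:\<xi>, 1:]) = xvar ^ (b * d) * G4"
proof -
  have ord_g0: "order r (red Gs) = b"
  proof -
    have "red Gs \<noteq> 0" using f0 g0 by auto
    then have "2 * order r (red Gs) = order r ((red Gs)\<^sup>2)" by (simp add: order_power)
    also have "\<dots> = b * 2" unfolding g0(1) using g0(2) f0 by (simp add: order_smult order_power)
    finally show ?thesis by simp
  qed
  have r0: "poly (red Fs) r = 0" using f0 order_root by fastforce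
  have "order r (pderiv (red Fs)) = 1" using order_pderiv[OF f0(1) r0] f0(2) by simp
  then have r1: "poly (pderiv (red Fs)) r = 0" using order_0I by fastforce
  have "pderiv (red Fs) \<noteq> 0" using r0 f0(1)
    by (metis degree_0_id pderiv_eq_0_iff poly_pCons poly_0 mult_zero_right add_0_right pCons_0_0)
  then have "order r (pderiv (pderiv (red Fs))) = 0"
    using order_pderiv[of "pderiv (red Fs)" r] r1 \<open>order r (pderiv (red Fs)) = 1\<close> by simp
  moreover have "pderiv (pderiv (red Fs)) \<noteq> 0"
  proof
    assume "pderiv (pderiv (red Fs)) = 0"
    then have "degree (pderiv (red Fs)) = 0" by (simp add: pderiv_eq_0_iff)
    then obtain e where "pderiv (red Fs) = [:e:]" by (rule degree_eq_zeroE)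
    with r1 \<open>pderiv (red Fs) \<noteq> 0\<close> show False by simp
  qed
  ultimately have r2: "poly (pderiv (pderiv (red Fs))) r \<noteq> 0" using order_root by metis
  have red': "red (pderiv Fs) = pderiv (red Fs)" using red_deriv_y[of Fs] by (simp add: deriv_y_def)
  \<comment> \<open>An exactly double root is a simple root of the derivative, so it lifts. The
    precision keeps the linear coefficient of Q off every edge considered below.\<close>
  obtain \<xi> where \<xi>: "poly \<xi> 0 = r" and crit: "monom 1 (Suc (2 * d)) dvd poly (pderiv Fs) \<xi>"
    using hensel_root[of "pderiv Fs" r "2 * d"] r1 r2 unfolding red' by blast
  define Q where "Q = pcompose Fs [:\<xi>, 1:]"
  define QG where "QG = pcompose Gs [:\<xi>, 1:]"
  have redshift: "red (pcompose P [:\<xi>, 1:]) = pcompose (red P) [:r, 1:]" for P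
    unfolding red_def map_poly_pcompose[OF ring_map_poly] by (simp add: map_poly_pCons \<xi>)
  have Qk: "poly (coeff Q k) 0 = coeff (pcompose (red Fs) [:r, 1:]) k" for k
    unfolding redshift[symmetric] Q_def by simp
  have Q0: "poly (coeff Q 0) 0 = 0" unfolding Qk using r0 by (simp add: poly_pcompose flip: poly_0_coeff_0)
  have Q2: "poly (coeff Q 2) 0 \<noteq> 0" unfolding Qk using order_shift_coeffs(2)[OF f0(1), of r] f0(2) by simp
  have QGb: "poly (coeff QG b) 0 \<noteq> 0"
  proof -
    have "red Gs \<noteq> 0" using f0 g0 by auto
    then have "coeff (pcompose (red Gs) [:r, 1:]) b \<noteq> 0" using order_shift_coeffs(2)[of "red Gs" r] ord_g0 by simp
    then show ?thesis unfolding redshift[symmetric] QG_def by simp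
  qed
  have "coeff Q 1 = coeff (pderiv Q) 0" by (simp add: coeff_pderiv)
  also have "pderiv Q = pcompose (pderiv Fs) [:\<xi>, 1:]"
    unfolding Q_def pderiv_pcompose by (simp add: pderiv_pCons)
  also have "coeff \<dots> 0 = poly (pderiv Fs) \<xi>"
    unfolding poly_0_coeff_0[symmetric] poly_pcompose by simp
  finally have Q1: "monom 1 (2 * d) dvd coeff Q 1"
    using crit dvd_trans[of "monom 1 (2 * d)" "monom 1 (Suc (2 * d))"] by (simp add: monom_1_dvd_iff')
  then obtain \<beta> where \<beta>: "coeff Q 1 = monom 1 (2 * d) * \<beta>" by blast

  have bracket: "(xvar * deriv_x A - of_int (int q * (2 * int d)) * A) * deriv_y B
      - deriv_y A * (xvar * deriv_x B - of_int (int q * (int b * int d)) * B)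
    = monom_xy (- of_int (int q * (u * int a' - v * int a)) * c)
        (nat (int q * (2 * int d + int b * int d - u - v)) + \<kappa>) 0"
    if "A = rescale q \<kappa> Q" "B = rescale q \<kappa> QG" for q \<kappa> A B
    unfolding that Q_def QG_def Fs Gs by (rule rescale_bracket[OF aa wF wG J])

  \<comment> \<open>Otherwise the next edge of \<open>F\<close> has two simple roots, whereas \<open>G\<close> has degree \<open>b\<close> there.\<close>
  have div: "monom 1 (2 * d) dvd coeff Q 0"
  proof (rule ccontr)
    assume ndvd: "\<not> monom 1 (2 * d) dvd coeff Q 0"
    then have "coeff Q 0 \<noteq> 0" by auto
    define h where "h = order 0 (coeff Q 0)"
    have "h < 2 * d" using ndvd monom_1_dvd_iff[OF \<open>coeff Q 0 \<noteq> 0\<close>] by (simp add: h_def)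
    have "h \<ge> 1" using Q0 \<open>coeff Q 0 \<noteq> 0\<close> unfolding h_def by (metis order_root less_one not_le)
    obtain \<alpha> where \<alpha>: "coeff Q 0 = monom 1 h * \<alpha>" "poly \<alpha> 0 \<noteq> 0"
    proof -
      obtain \<alpha> where "coeff Q 0 = [:- 0, 1:] ^ h * \<alpha>" "\<not> [:- 0, 1:] dvd \<alpha>"
        using order_decomp[OF \<open>coeff Q 0 \<noteq> 0\<close>, of 0] unfolding h_def by blast
      then show thesis using that[of \<alpha>] poly_eq_0_iff_dvd[of \<alpha> 0] by (simp add: monom_altdef)
    qed
    \<comment> \<open>With q = 2 and \<kappa> = h the constant term, of order h in t, meets the
      quadratic term at order 2h without halving h.\<close>
    obtain F1 where F1: "rescale 2 h Q = xvar ^ (2 * h) * F1" "red F1 = [:poly \<alpha> 0, 0, poly (coeff Q 2) 0:]"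
      using rescale_leading_quadratic[OF \<alpha>(1) \<beta>, of 2 h] \<open>h \<ge> 1\<close> \<open>h < 2 * d\<close> by auto
    obtain l G1 where G1: "rescale 2 h QG = xvar ^ l * G1" "red G1 \<noteq> 0" "l \<le> h * b" "h * degree (red G1) \<le> l"
      using rescale_leading_bounds[OF QGb, of 2 h] by auto
    define E where "E = nat (int 2 * (2 * int d + int b * int d - u - v)) + h"
    \<comment> \<open>The Jacobian stays beyond the leading order: h \<le> 2d - 1, l \<le> hb and u
      + v \<le> d + 1 leave a gap of at least b - 1.\<close>
    have E: "E > 2 * h + l"
    proof -
      have "int h * (1 + int b) \<le> (2 * int d - 1) * (1 + int b)"
        using \<open>h < 2 * d\<close> by (intro mult_right_mono) auto
      then have "int h + int h * int b \<le> 2 * int d + 2 * (int b * int d) - 1 - int b"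
        by (simp add: algebra_simps)
      moreover have "int l \<le> int h * int b" using G1(3) by (metis of_nat_le_iff of_nat_mult)
      moreover have "int b \<ge> 2" using b by simp
      ultimately have "2 * int h + int l < int 2 * (2 * int d + int b * int d - u - v) + int h"
        using uv by (simp add: algebra_simps)
      then show ?thesis unfolding E_def by linarith
    qed
    have eq: "of_int (int (2 * h) - int 2 * (2 * int d)) * (red F1 * pderiv (red G1))
        - of_int (int l - int 2 * (int b * int d)) * (pderiv (red F1) * red G1) = 0"
      using leading_bracket[OF F1(1) G1(1) bracket[OF refl refl]] E unfolding E_def by fastforce
    have "h * b < 2 * d * b" using \<open>h < 2 * d\<close> b by simp
    moreover have "2 * d * b = 2 * (b * d)" by simp
    ultimately have lb: "l < 2 * (b * d)" using G1(3) by linarith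
    \<comment> \<open>m and k are the weights of the leading terms of F and G on the new edge,
      doubled because q = 2; both are positive.\<close>
    define m where "m = 4 * d - 2 * h"
    define k where "k = 2 * (b * d) - l"
    have mk: "int (2 * h) - int 2 * (2 * int d) = - int m" "int l - int 2 * (int b * int d) = - int k"
      using \<open>h < 2 * d\<close> lb unfolding m_def k_def by (simp_all add: of_nat_diff)
    have eq': "smult (of_nat m) (pderiv (red G1) * red F1) = smult (of_nat k) (red G1 * pderiv (red F1))"
      using eq unfolding mk by (simp add: of_int_poly of_nat_poly mult_ac)
    have F1nz: "red F1 \<noteq> 0" and degF1: "degree (red F1) = 2" using Q2 by (simp_all add: F1(2))
    have "(of_nat m :: 'a) * of_nat (degree (red G1)) = of_nat k * of_nat (degree (red F1))"
      by (rule pderiv_eq_degree[OF eq' G1(2) F1nz])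
    then have "m * degree (red G1) = k * 2"
      unfolding degF1 by (metis of_nat_eq_iff of_nat_mult)
    then have deg: "int m * int (degree (red G1)) = 2 * int k" by (metis mult.commute of_nat_mult of_nat_numeral)
    have m_int: "int m = 2 * (2 * int d - int h)" and k_int: "int k = 2 * (int b * int d) - int l"
      using mk by simp_all
    \<comment> \<open>The degree identity squeezes n: l \<le> hb gives n \<ge> b, and hn \<le> l
      gives n \<le> b. Hence k : m = b : 2.\<close>
    define n where "n = int (degree (red G1))"
    have deg': "(2 * int d - int h) * n = 2 * (int b * int d) - int l"
      using deg unfolding m_int k_int n_def by (auto simp: algebra_simps)
    have l1: "int l \<le> int h * int b" and l2: "int h * n \<le> int l"
      using G1(3,4) unfolding n_def by (metis of_nat_le_iff of_nat_mult)+
    have "(2 * int d - int h) * n \<ge> (2 * int d - int h) * int b"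
      using deg' l1 by (simp add: algebra_simps)
    then have "n \<ge> int b" using \<open>h < 2 * d\<close> by (simp add: mult_le_cancel_left)
    moreover have "2 * int d * n \<le> 2 * int d * int b"
      using deg' l2 by (simp add: algebra_simps)
    then have "n \<le> int b" using d by (simp add: mult_le_cancel_left)
    ultimately have n: "n = int b" by simp
    have k: "2 * k = m * b" using deg unfolding n_def[symmetric] n by (metis of_nat_eq_iff of_nat_mult of_nat_numeral)
    have "m > 0" using \<open>h < 2 * d\<close> by (simp add: m_def)
    have "smult (of_nat m) (smult (of_nat 2) (red F1 * pderiv (red G1)))
        = smult 2 (smult (of_nat m) (pderiv (red G1) * red F1))"
      by (simp add: mult_ac)
    also have "\<dots> = smult (of_nat (2 * k)) (red G1 * pderiv (red F1))" unfolding eq' by simp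
    also have "\<dots> = smult (of_nat m) (smult (of_nat b) (red G1 * pderiv (red F1)))" unfolding k by simp
    finally have "smult (of_nat 2) (red F1 * pderiv (red G1)) = smult (of_nat b) (red G1 * pderiv (red F1))"
      using \<open>m > 0\<close> by (metis smult_cancel of_nat_eq_0_iff less_not_refl)
    then obtain e' where e': "e' \<noteq> 0" "red G1 ^ 2 = smult e' (red F1 ^ b)"
      using log_derivative_eq[of 2 "red F1" "red G1" b] F1nz G1(2) by blast
    \<comment> \<open>The nonzero constant term makes the quadratic polynomial separable; a simple
      root of it would have odd multiplicity b in the square of \<open>red G1\<close>.\<close>
    obtain s where s: "order s (red F1) = 1" unfolding F1(2) using quadratic_simple_root[OF \<alpha>(2) Q2] by blast
    have "2 * order s (red G1) = order s (red G1 ^ 2)" using G1(2) by (simp add: order_power)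
    also have "\<dots> = b" unfolding e'(2) using e'(1) F1nz s by (simp add: order_smult order_power)
    finally show False using b(1) by (metis dvd_triv_left)
  qed
  then obtain \<alpha> where \<alpha>: "coeff Q 0 = monom 1 (2 * d) * \<alpha>" by blast
  obtain F1 where F1: "rescale 1 d Q = xvar ^ (2 * d) * F1" "red F1 = [:poly \<alpha> 0, 0, poly (coeff Q 2) 0:]"
    using rescale_leading_quadratic[OF \<alpha> \<beta>, of 1 d] d by auto
  obtain l G1 where G1: "rescale 1 d QG = xvar ^ l * G1" "red G1 \<noteq> 0"
    using rescale_leading_bounds[OF QGb, of 1 d] by auto
  \<comment> \<open>At weight \<open>0\<close> the Jacobian condition makes \<open>pderiv (red F1) * red G1\<close> constant.\<close>
  have "l \<ge> b * d"
  proof (rule ccontr)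
    assume "\<not> l \<ge> b * d"
    then have l: "int l + 1 \<le> int b * int d" by (metis not_less of_nat_Suc of_nat_le_iff of_nat_mult Suc_leI add.commute)
    \<comment> \<open>The Jacobian term may now have the order of the leading terms, so the right
      side is a constant e that need not vanish. As F has weight 0 here, only the term with
      \<open>pderiv (red F1)\<close> remains, and that derivative has degree 1.\<close>
    have "int d + int l \<le> 2 * int d + int b * int d - u - v" using l uv by linarith
    then have E: "2 * d + l \<le> nat (int 1 * (2 * int d + int b * int d - u - v)) + d"
      by (simp only: of_nat_1 mult_1_left)
    from leading_bracket[OF F1(1) G1(1) bracket[OF refl refl]] E obtain e where
      "of_int (int (2 * d) - int 1 * (2 * int d)) * (red F1 * pderiv (red G1))
        - of_int (int l - int 1 * (int b * int d)) * (pderiv (red F1) * red G1) = [:e:]" by blast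
    then have e: "of_int (int b * int d - int l) * (pderiv (red F1) * red G1) = [:e:]"
      by (simp add: algebra_simps)
    have "pderiv (red F1) * red G1 = [:0, 2 * poly (coeff Q 2) 0:] * red G1"
      unfolding F1(2) by (simp add: pderiv_pCons)
    moreover have "degree ([:0, 2 * poly (coeff Q 2) 0:] * red G1) = 1 + degree (red G1)"
      using Q2 G1(2) by (subst degree_mult_eq) auto
    ultimately have dg: "degree (pderiv (red F1) * red G1) = 1 + degree (red G1)" by simp
    have "of_int (int b * int d - int l) = [:of_int (int b * int d - int l) :: 'a:]" by (simp only: of_int_poly)
    moreover have "(of_int (int b * int d - int l) :: 'a) \<noteq> 0" using l by (subst of_int_eq_0_iff) linarith
    ultimately have "degree (of_int (int b * int d - int l) * (pderiv (red F1) * red G1)) = 1 + degree (red G1)"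
      using dg by (simp del: of_int_diff)
    then show False unfolding e by simp
  qed
  then have "xvar ^ l * G1 = xvar ^ (b * d) * (xvar ^ (l - b * d) * G1)"
    by (simp only: mult.assoc[symmetric] power_add[symmetric]) simp
  then have "rescale 1 d (pcompose Gs [:\<xi>, 1:]) = xvar ^ (b * d) * (xvar ^ (l - b * d) * G1)"
    using G1(1) unfolding QG_def by simp
  with \<xi> Q_def div Q1 Q2 show thesis by (rule that)
qed

section \<open>Quasi-homogeneous polynomials\<close>

definition homog_wt :: "int \<Rightarrow> int \<Rightarrow> int \<Rightarrow> 'a::zero poly poly \<Rightarrow> bool" where
  "homog_wt u v W P \<longleftrightarrow> (\<forall>i j. (i, j) \<in> supp_xy P \<longrightarrow> u * int i + v * int j = W)"

lemma homog_wt_add: "homog_wt u v W P \<Longrightarrow> homog_wt u v W Q \<Longrightarrow> homog_wt u v W (P + Q)"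
  unfolding homog_wt_def mem_supp_xy coeff_xy_add by (metis add_0_left)

lemma homog_wt_monom: "u * int i + v * int j = W \<Longrightarrow> homog_wt u v W (monom_xy c i j)"
  by (auto simp: homog_wt_def mem_supp_xy split: if_splits)

lemma supp_mult:
  fixes P Q :: "'a::comm_semiring_1 poly poly"
  assumes "(i, j) \<in> supp_xy (P * Q)"
  obtains k l m n where "(k, l) \<in> supp_xy P" "(m, n) \<in> supp_xy Q" "i = k + m" "j = l + n"
proof (rule ccontr)
  assume "\<not> thesis"
  then have no: "\<not> ((k, l) \<in> supp_xy P \<and> (m, n) \<in> supp_xy Q \<and> i = k + m \<and> j = l + n)" for k l m n
    using that by blast
  have "P * Q = (\<Sum>p\<in>supp_xy P. \<Sum>q\<in>supp_xy Q. monom_xy (coeff_xy P (fst p) (snd p)) (fst p) (snd p)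
      * monom_xy (coeff_xy Q (fst q) (snd q)) (fst q) (snd q))"
    using arg_cong2[OF poly_xy_as_sum[of P] poly_xy_as_sum[of Q], of "(*)"]
    unfolding case_prod_unfold sum_product .
  then have "coeff_xy (P * Q) i j = coeff_xy (\<Sum>p\<in>supp_xy P. \<Sum>q\<in>supp_xy Q. monom_xy (coeff_xy P (fst p) (snd p)) (fst p) (snd p)
      * monom_xy (coeff_xy Q (fst q) (snd q)) (fst q) (snd q)) i j" by (rule arg_cong)
  also have "\<dots> = 0"
    unfolding coeff_xy_sum monom_xy_mult
  proof (intro sum.neutral ballI)
    fix p q assume "p \<in> supp_xy P" "q \<in> supp_xy Q"
    then have "\<not> (i = fst p + fst q \<and> j = snd p + snd q)" using no[of "fst p" "snd p" "fst q" "snd q"] by simp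
    then show "coeff_xy (monom_xy (coeff_xy P (fst p) (snd p) * coeff_xy Q (fst q) (snd q)) (fst p + fst q) (snd p + snd q)) i j = 0"
      by auto
  qed
  finally show False using assms by (simp add: mem_supp_xy)
qed

lemma homog_wt_mult:
  fixes P Q :: "'a::comm_semiring_1 poly poly"
  assumes "homog_wt u v W P" "homog_wt u v W' Q"
  shows "homog_wt u v (W + W') (P * Q)"
  unfolding homog_wt_def
proof (intro allI impI)
  fix i j assume "(i, j) \<in> supp_xy (P * Q)"
  then obtain k l m n where "(k, l) \<in> supp_xy P" "(m, n) \<in> supp_xy Q" "i = k + m" "j = l + n"
    by (rule supp_mult)
  moreover from this have "u * int k + v * int l = W" "u * int m + v * int n = W'"
    using assms unfolding homog_wt_def by blast+
  ultimately show "u * int i + v * int j = W + W'" by (simp add: distrib_left)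
qed

lemma homog_wt_power:
  fixes P :: "'a::comm_semiring_1 poly poly"
  assumes "homog_wt u v W P"
  shows "homog_wt u v (int n * W) (P ^ n)"
proof (induction n)
  case 0
  have "homog_wt u v 0 (monom_xy (1::'a) 0 0)" by (rule homog_wt_monom) simp
  then show ?case by (simp add: monom_xy_def monom_0 pCons_one)
next
  case (Suc n)
  then show ?case using homog_wt_mult[OF assms Suc] by (simp add: algebra_simps)
qed

definition dehom :: "nat \<Rightarrow> nat \<Rightarrow> 'a::comm_ring_1 poly poly \<Rightarrow> 'a poly" where
  "dehom a a' P = lin (\<lambda>c. [:c:]) (\<lambda>i j. monom 1 (a * i + a' * j)) P"

lemma ring_map_dehom: "ring_map (dehom a a' :: 'a::comm_ring_1 poly poly \<Rightarrow> _)"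
  unfolding dehom_def
  by (rule ring_map_lin[OF ring_map_const]) (simp_all add: monom_0 pCons_one mult_monom algebra_simps)

lemma dehom_monom: "dehom a a' (monom_xy c i j) = monom c (a * i + a' * j)"
  unfolding dehom_def lin_monom[OF ring_map_const] by (simp add: smult_monom)

text \<open>On a line of constant weight the exponent \<open>a * i + a' * j\<close> determines (i,
  j), because the determinant is nonzero. So no terms merge, and identities between
  quasi-homogeneous polynomials may be checked in one variable.\<close>

lemma dehom_homog_eq_0:
  fixes P :: "'a::comm_ring_1 poly poly"
  assumes P: "homog_wt u v W P" and inj: "u * int a' - v * int a \<noteq> 0" and 0: "dehom a a' P = 0"
  shows "P = 0"
proof (rule poly_xy_eqI)
  fix i j
  show "coeff_xy P i j = coeff_xy 0 i j"
  proof (cases "(i, j) \<in> supp_xy P")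
    case True
    have "coeff (dehom a a' P) (a * i + a' * j)
        = (\<Sum>p\<in>supp_xy P. if p = (i, j) then coeff_xy P i j else 0)"
      unfolding dehom_def lin_def coeff_sum
    proof (intro sum.cong refl)
      fix p assume p: "p \<in> supp_xy P"
      obtain k l where kl: "p = (k, l)" by (cases p)
      have w: "u * int i + v * int j = u * int k + v * int l"
        using P p True unfolding homog_wt_def kl by auto
      have "a * k + a' * l = a * i + a' * j \<longleftrightarrow> k = i \<and> l = j"
      proof
        assume e: "a * k + a' * l = a * i + a' * j"
        then have e': "int a * int k + int a' * int l = int a * int i + int a' * int j"
          by (metis of_nat_add of_nat_mult)
        define x where "x = int k - int i"
        define y where "y = int l - int j"
        have 1: "u * x + v * y = 0" using w by (simp add: x_def y_def algebra_simps)
        have 2: "int a * x + int a' * y = 0" using e' by (simp add: x_def y_def algebra_simps)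
        have "(u * int a' - v * int a) * x = int a' * (u * x + v * y) - v * (int a * x + int a' * y)"
          by (simp add: algebra_simps)
        then have "x = 0" using 1 2 inj by simp
        have "(u * int a' - v * int a) * y = u * (int a * x + int a' * y) - int a * (u * x + v * y)"
          by (simp add: algebra_simps)
        then have "y = 0" using 1 2 inj by simp
        with \<open>x = 0\<close> show "k = i \<and> l = j" by (simp add: x_def y_def)
      qed auto
      then show "coeff (case p of (i, j) \<Rightarrow> [:coeff_xy P i j:] * monom 1 (a * i + a' * j)) (a * i + a' * j)
        = (if p = (i, j) then coeff_xy P i j else 0)"
        unfolding kl by (auto simp: smult_monom)
    qed
    also have "\<dots> = coeff_xy P i j" using True by (simp add: finite_supp_xy)
    finally show ?thesis using 0 by simp
  qed (simp add: mem_supp_xy)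
qed

lemma coeff_homogeneous_component:
  "coeff_xy (homogeneous_component w D P) i j = (if weight w (i, j) = D then coeff_xy P i j else 0)"
proof -
  have fin: "finite {m \<in> supp_xy P. weight w m = D}" by (simp add: finite_supp_xy)
  have "coeff_xy (homogeneous_component w D P) i j
      = (\<Sum>p\<in>{m \<in> supp_xy P. weight w m = D}. if p = (i, j) then coeff_xy P i j else 0)"
    unfolding homogeneous_component_def coeff_xy_sum by (intro sum.cong) (auto split: if_splits)
  also have "\<dots> = (if weight w (i, j) = D then coeff_xy P i j else 0)"
    using fin by (auto simp: mem_supp_xy)
  finally show ?thesis .
qed

lemma homog_wt_component: "homog_wt u v D (homogeneous_component (u, v) D P)"
  by (auto simp: homog_wt_def mem_supp_xy coeff_homogeneous_component split: if_splits)

lemma red_star: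
  fixes P :: "'a::comm_ring_1 poly poly"
  assumes "\<And>i j. (i, j) \<in> supp_xy P \<Longrightarrow> u * int i + v * int j \<le> M"
  shows "red (star u v a a' M P) = dehom a a' (homogeneous_component (u, v) M P)"
proof -
  have rm: "red (monom_xy 1 e f) = (if e = 0 then monom 1 f else 0 :: 'a poly)" for e f
    by (rule poly_eqI) (auto simp: monom_xy_def poly_monom zero_power monom_0 split: if_splits)
  have rc: "red (const_xy c) = [:c:]" for c :: 'a
    by (rule poly_eqI) (simp add: const_xy_def coeff_pCons split: nat.splits)
  let ?S = "supp_xy P"
  have sub: "supp_xy (homogeneous_component (u, v) M P) \<subseteq> ?S"
    by (auto simp: mem_supp_xy coeff_homogeneous_component split: if_splits)
  show ?thesis
    unfolding star_def ring_map_lin_commute[OF ring_map_red] rc rm dehom_def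
      lin_superset[OF ring_map_const finite_supp_xy sub]
    unfolding lin_def
    using assms by (intro sum.cong refl) (fastforce simp: coeff_homogeneous_component)
qed

section \<open>Binary forms in two monomials\<close>

definition homog_form :: "nat \<Rightarrow> 'a::comm_ring_1 poly \<Rightarrow> 'a poly poly \<Rightarrow> 'a poly poly \<Rightarrow> 'a poly poly" where
  "homog_form n \<phi> x y = (\<Sum>k\<le>n. const_xy (coeff \<phi> k) * x ^ k * y ^ (n - k))"

lemma homog_form_linear_factor:
  assumes "degree \<psi> \<le> n"
  shows "homog_form (Suc n) ([:- \<theta>, 1:] * \<psi>) x y = (x - const_xy \<theta> * y) * homog_form n \<psi> x y"
proof -
  interpret c: ring_map "const_xy :: 'a \<Rightarrow> _" by (rule ring_map_const_xy)
  have "homog_form (Suc n) ([:- \<theta>, 1:] * \<psi>) x y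
     = (\<Sum>k\<le>Suc n. const_xy (- \<theta> * coeff \<psi> k) * x ^ k * y ^ (Suc n - k)
        + const_xy (case k of 0 \<Rightarrow> 0 | Suc m \<Rightarrow> coeff \<psi> m) * x ^ k * y ^ (Suc n - k))"
  proof -
    have "coeff ([:- \<theta>, 1:] * \<psi>) k = - \<theta> * coeff \<psi> k + (case k of 0 \<Rightarrow> 0 | Suc m \<Rightarrow> coeff \<psi> m)" for k
      by (simp add: coeff_pCons split: nat.splits)
    then show ?thesis unfolding homog_form_def by (simp only: c.map_add distrib_right)
  qed
  also have "\<dots> = (\<Sum>k\<le>Suc n. const_xy (- \<theta> * coeff \<psi> k) * x ^ k * y ^ (Suc n - k))
      + (\<Sum>k\<le>Suc n. const_xy (case k of 0 \<Rightarrow> 0 | Suc m \<Rightarrow> coeff \<psi> m) * x ^ k * y ^ (Suc n - k))"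
    by (rule sum.distrib)
  also have "(\<Sum>k\<le>Suc n. const_xy (- \<theta> * coeff \<psi> k) * x ^ k * y ^ (Suc n - k))
      = - const_xy \<theta> * y * homog_form n \<psi> x y"
  proof -
    have "coeff \<psi> (Suc n) = 0" using assms by (intro coeff_eq_0) simp
    then have "(\<Sum>k\<le>Suc n. const_xy (- \<theta> * coeff \<psi> k) * x ^ k * y ^ (Suc n - k))
      = (\<Sum>k\<le>n. const_xy (- \<theta> * coeff \<psi> k) * x ^ k * y ^ (Suc n - k))"
      by simp
    also have "\<dots> = (\<Sum>k\<le>n. - const_xy \<theta> * y * (const_xy (coeff \<psi> k) * x ^ k * y ^ (n - k)))"
      by (intro sum.cong refl) (simp add: Suc_diff_le mult_ac)
    finally show ?thesis unfolding homog_form_def sum_distrib_left .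
  qed
  also have "(\<Sum>k\<le>Suc n. const_xy (case k of 0 \<Rightarrow> 0 | Suc m \<Rightarrow> coeff \<psi> m) * x ^ k * y ^ (Suc n - k))
      = x * homog_form n \<psi> x y"
    unfolding sum.atMost_Suc_shift homog_form_def sum_distrib_left by (simp add: mult_ac)
  finally show ?thesis by (simp add: algebra_simps)
qed

text \<open>Linear factors homogenise one at a time. With x and y the two monomials of an edge, a
  multiple root becomes a power of a binomial dividing the leading form, to which genericity can be
  applied.\<close>

lemma homog_form_power_dvd:
  fixes \<phi> :: "'a::idom poly"
  assumes "[:- \<theta>, 1:] ^ m dvd \<phi>" "\<phi> \<noteq> 0"
  shows "(x - const_xy \<theta> * y) ^ m dvd homog_form (degree \<phi>) \<phi> x y"
  using assms
proof (induction m arbitrary: \<phi>)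
  case (Suc m)
  from Suc.prems(1) obtain \<psi> where "\<phi> = [:- \<theta>, 1:] ^ Suc m * \<psi>" by (rule dvdE)
  then have \<psi>: "\<phi> = [:- \<theta>, 1:] * ([:- \<theta>, 1:] ^ m * \<psi>)" by (simp only: power_Suc mult.assoc)
  define \<psi>' where "\<psi>' = [:- \<theta>, 1:] ^ m * \<psi>"
  have \<phi>: "\<phi> = [:- \<theta>, 1:] * \<psi>'" unfolding \<psi> \<psi>'_def ..
  have nz: "\<psi>' \<noteq> 0" using Suc.prems(2) \<phi> by auto
  have deg: "degree \<phi> = Suc (degree \<psi>')" unfolding \<phi> using nz by (subst degree_mult_eq) auto
  have "(x - const_xy \<theta> * y) ^ m dvd homog_form (degree \<psi>') \<psi>' x y"
    using Suc.IH[of \<psi>'] nz unfolding \<psi>'_def by simp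
  then show ?case unfolding deg unfolding \<phi> homog_form_linear_factor[OF order_refl] power_Suc
    by (rule mult_dvd_mono[OF dvd_refl])
qed simp

lemma coprime_proportional:
  fixes D1 D2 x y :: int
  assumes "r * D1 + s * D2 = 1" "x * D2 = y * D1"
  shows "x = (r * x + s * y) * D1" "y = (r * x + s * y) * D2"
proof -
  have "(r * x + s * y) * D1 = r * x * D1 + s * (y * D1)" by (simp add: algebra_simps)
  also have "\<dots> = x * (r * D1 + s * D2)" unfolding assms(2)[symmetric] by (simp add: algebra_simps)
  finally show "x = (r * x + s * y) * D1" using assms(1) by simp
  have "(r * x + s * y) * D2 = r * (x * D2) + s * y * D2" by (simp add: algebra_simps)
  also have "\<dots> = y * (r * D1 + s * D2)" unfolding assms(2) by (simp add: algebra_simps)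
  finally show "y = (r * x + s * y) * D2" using assms(1) by simp
qed

text \<open>On a line with primitive direction vector \<open>(D1, D2)\<close> a quasi-homogeneous polynomial is, up to a
  monomial factor, a binary form in the two coprime monomials given by the positive and the negative
  part of \<open>(D1, D2)\<close>.\<close>

lemma homogeneous_as_form:
  fixes P :: "'a::idom poly poly" and u v W D1 D2 :: int
  assumes "P \<noteq> 0" and hom: "homog_wt u v W P" and D: "u * D1 + v * D2 = 0" "coprime D1 D2"
    and uv: "u \<noteq> 0 \<or> v \<noteq> 0"
  obtains \<phi> C1 C2 where "coeff \<phi> 0 \<noteq> 0"
    "P = monom_xy 1 C1 C2 * homog_form (degree \<phi>) \<phi> (monom_xy 1 (nat D1) (nat D2)) (monom_xy 1 (nat (- D1)) (nat (- D2)))"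
    "u * int (C1 + degree \<phi> * nat (- D1)) + v * int (C2 + degree \<phi> * nat (- D2)) = W"
    "card (supp_xy P) > 1 \<Longrightarrow> degree \<phi> > 0"
proof -
  obtain r s where rs: "r * D1 + s * D2 = 1"
    using bezout_int[of D1 D2] D(2) by auto
  \<comment> \<open>By Bezout this functional is 1 on (D1, D2), so it numbers the lattice points of
    the line consecutively.\<close>
  define idx where "idx p = r * int (fst p) + s * int (snd p)" for p :: "nat \<times> nat"
  let ?S = "supp_xy P"
  have S: "finite ?S" "?S \<noteq> {}" using assms by (auto simp: finite_supp_xy)
  obtain p0 where p0: "p0 \<in> ?S" and min: "\<And>p. p \<in> ?S \<Longrightarrow> idx p0 \<le> idx p"
    using arg_min_if_finite[OF S, of idx] by (meson not_le)
  define f1 where "f1 = int (fst p0)"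
  define f2 where "f2 = int (snd p0)"
  define k where "k p = nat (idx p - idx p0)" for p
  have pt: "int (fst p) = f1 + int (k p) * D1" "int (snd p) = f2 + int (k p) * D2" if p: "p \<in> ?S" for p
  proof -
    define x where "x = int (fst p) - f1"
    define y where "y = int (snd p) - f2"
    have "u * int (fst p) + v * int (snd p) = W" "u * f1 + v * f2 = W"
      using hom p p0 unfolding homog_wt_def f1_def f2_def by (metis prod.collapse)+
    then have e: "u * x + v * y = 0" unfolding x_def y_def by (simp add: algebra_simps)
    have "u * (x * D2 - y * D1) = D2 * (u * x + v * y) - y * (u * D1 + v * D2)"
      "v * (x * D2 - y * D1) = x * (u * D1 + v * D2) - D1 * (u * x + v * y)"
      by (simp_all add: algebra_simps)
    then have "x * D2 = y * D1" using e D uv by auto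
    note c = coprime_proportional[OF rs this]
    have "int (k p) = idx p - idx p0" using min[OF p] by (simp add: k_def)
    also have "\<dots> = r * x + s * y" unfolding idx_def x_def y_def f1_def f2_def by (simp add: algebra_simps)
    finally have "x = int (k p) * D1" "y = int (k p) * D2" using c by simp_all
    then show "int (fst p) = f1 + int (k p) * D1" "int (snd p) = f2 + int (k p) * D2"
      unfolding x_def y_def by linarith+
  qed
  have inj: "inj_on k ?S" by (intro inj_onI) (metis pt of_nat_eq_iff prod_eqI)
  define n where "n = Max (k ` ?S)"
  have n: "k p \<le> n" if "p \<in> ?S" for p using that S by (simp add: n_def)
  have "n \<in> k ` ?S" unfolding n_def using S by (intro Max_in) auto
  then obtain pn where pn: "pn \<in> ?S" "k pn = n" by auto
  define \<phi> where "\<phi> = (\<Sum>p\<in>?S. monom (coeff_xy P (fst p) (snd p)) (k p))"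
  have cphi: "coeff \<phi> (k p) = coeff_xy P (fst p) (snd p)" if "p \<in> ?S" for p
  proof -
    have "coeff \<phi> (k p) = (\<Sum>q\<in>?S. if q = p then coeff_xy P (fst p) (snd p) else 0)"
      unfolding \<phi>_def coeff_sum using inj that by (intro sum.cong) (auto simp: inj_on_eq_iff)
    then show ?thesis using S that by simp
  qed
  have cphi0: "coeff \<phi> m = 0" if "m \<notin> k ` ?S" for m
    unfolding \<phi>_def coeff_sum using that by (intro sum.neutral) auto
  have supp: "coeff_xy P (fst p) (snd p) \<noteq> 0" if "p \<in> ?S" for p
    using that mem_supp_xy[of "fst p" "snd p" P] by simp
  have deg: "degree \<phi> = n"
  proof (rule antisym)
    show "degree \<phi> \<le> n" by (rule degree_le) (metis cphi0 imageE n not_le)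
    show "n \<le> degree \<phi>" using cphi[OF pn(1)] supp[OF pn(1)] pn(2) by (intro le_degree) simp
  qed
  have k0: "k p0 = 0" by (simp add: k_def)
  have phi0: "coeff \<phi> 0 \<noteq> 0" using cphi[OF p0] supp[OF p0] k0 by simp
  have pnn: "f1 + int n * D1 \<ge> 0" "f2 + int n * D2 \<ge> 0" using pt[OF pn(1)] pn(2) by (metis of_nat_0_le_iff)+
  \<comment> \<open>At the starting point the binary form contributes n times the negative part of
    D1. Subtracting it leaves a natural number, namely the smaller first exponent of the two end
    points of the support.\<close>
  define C1 where "C1 = nat (f1 - int n * int (nat (- D1)))"
  define C2 where "C2 = nat (f2 - int n * int (nat (- D2)))"
  have C: "int C1 = f1 - int n * int (nat (- D1))" "int C2 = f2 - int n * int (nat (- D2))"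
    unfolding C1_def C2_def using pnn by (cases "D1 \<ge> 0"; cases "D2 \<ge> 0"; simp add: f1_def f2_def)+
  have exps: "C1 + (k p * nat D1 + (n - k p) * nat (- D1)) = fst p"
    "C2 + (k p * nat D2 + (n - k p) * nat (- D2)) = snd p" if "p \<in> ?S" for p
  proof -
    have *: "int m + (int j * int (nat E) + (int N - int j) * int (nat (- E))) = f + int j * E"
      if "int m = f - int N * int (nat (- E))" for m j N f E
      using that by (cases "E \<ge> 0") (simp_all add: algebra_simps)
    have nk: "int (n - k p) = int n - int (k p)" using n[OF that] by (simp add: of_nat_diff)
    show "C1 + (k p * nat D1 + (n - k p) * nat (- D1)) = fst p"
      using *[OF C(1), of "k p"] pt(1)[OF that] nk by (simp flip: of_nat_eq_iff[where 'a = int])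
    show "C2 + (k p * nat D2 + (n - k p) * nat (- D2)) = snd p"
      using *[OF C(2), of "k p"] pt(2)[OF that] nk by (simp flip: of_nat_eq_iff[where 'a = int])
  qed
  let ?x = "monom_xy 1 (nat D1) (nat D2) :: 'a poly poly" and ?y = "monom_xy 1 (nat (- D1)) (nat (- D2)) :: 'a poly poly"
  have "monom_xy 1 C1 C2 * homog_form n \<phi> ?x ?y
      = (\<Sum>m\<le>n. monom_xy (coeff \<phi> m) (C1 + (m * nat D1 + (n - m) * nat (- D1))) (C2 + (m * nat D2 + (n - m) * nat (- D2))))"
    unfolding homog_form_def sum_distrib_left const_xy_eq_monom monom_xy_power monom_xy_mult by simp
  also have "\<dots> = (\<Sum>m\<in>k ` ?S. monom_xy (coeff \<phi> m) (C1 + (m * nat D1 + (n - m) * nat (- D1))) (C2 + (m * nat D2 + (n - m) * nat (- D2))))"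
    using n S by (intro sum.mono_neutral_right) (auto simp: cphi0 monom_xy_def)
  also have "\<dots> = (\<Sum>p\<in>?S. monom_xy (coeff_xy P (fst p) (snd p)) (fst p) (snd p))"
    unfolding sum.reindex[OF inj] o_def by (intro sum.cong refl) (simp add: exps cphi)
  also have "\<dots> = P" using poly_xy_as_sum[of P] by (simp add: case_prod_unfold)
  finally have P: "P = monom_xy 1 C1 C2 * homog_form (degree \<phi>) \<phi> ?x ?y" unfolding deg ..
  have W: "u * int (C1 + degree \<phi> * nat (- D1)) + v * int (C2 + degree \<phi> * nat (- D2)) = W"
  proof -
    have "int (C1 + n * nat (- D1)) = f1" "int (C2 + n * nat (- D2)) = f2" using C by simp_all
    moreover have "u * f1 + v * f2 = W"
      using hom p0 unfolding homog_wt_def f1_def f2_def by (metis prod.collapse)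
    ultimately show ?thesis unfolding deg by simp
  qed
  have "degree \<phi> > 0" if "card ?S > 1"
  proof (rule ccontr)
    assume "\<not> degree \<phi> > 0"
    then have "k p = 0" if "p \<in> ?S" for p using n[OF that] deg by simp
    then have "k ` ?S \<subseteq> {0}" by auto
    then have "card (k ` ?S) \<le> 1" using card_mono[of "{0::nat}"] by simp
    with that card_image[OF inj] show False by simp
  qed
  with phi0 P W show thesis by (rule that)
qed

lemma dehom_form:
  fixes \<phi> :: "'a::comm_ring_1 poly"
  assumes "a * A1 + a' * A2 = n" "a * B1 + a' * B2 = 0"
  shows "dehom a a' (monom_xy 1 C1 C2 * homog_form (degree \<phi>) \<phi> (monom_xy 1 A1 A2) (monom_xy 1 B1 B2))
    = monom 1 (a * C1 + a' * C2) * pcompose \<phi> (monom 1 n)"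
proof -
  interpret dh: ring_map "dehom a a' :: 'a poly poly \<Rightarrow> _" by (rule ring_map_dehom)
  have c: "dehom a a' (const_xy c) = [:c:]" for c :: 'a
    unfolding const_xy_eq_monom dehom_monom by (simp add: monom_0)
  have "dehom a a' (homog_form (degree \<phi>) \<phi> (monom_xy 1 A1 A2) (monom_xy 1 B1 B2))
    = (\<Sum>k\<le>degree \<phi>. [:coeff \<phi> k:] * monom 1 n ^ k)"
    unfolding homog_form_def dh.map_sum dh.map_mult dh.map_power c dehom_monom assms
    by (simp add: monom_0 pCons_one)
  also have "\<dots> = pcompose \<phi> (monom 1 n)"
    unfolding pcompose_altdef poly_altdef
    by (simp add: coeff_map_poly degree_map_poly)
  finally show ?thesis unfolding dh.map_mult dehom_monom by simp
qed

text \<open>In characteristic 0 a nonzero r is a simple root of X^n - r^n, so substituting X^n does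
  not ramify there and multiplicities carry over.\<close>

lemma order_pcompose_monom:
  fixes \<phi> :: "'a::field_char_0 poly"
  assumes "\<phi> \<noteq> 0" "n > 0" "r \<noteq> 0"
  shows "order r (monom 1 m * pcompose \<phi> (monom 1 n)) = order (r ^ n) \<phi>"
proof -
  let ?c = "\<lambda>p :: 'a poly. pcompose p (monom 1 n)"
  interpret c: ring_map ?c by (rule ring_map_pcompose)
  define \<theta> where "\<theta> = r ^ n"
  define k where "k = order \<theta> \<phi>"
  obtain \<psi> where \<psi>: "\<phi> = [:- \<theta>, 1:] ^ k * \<psi>" "\<not> [:- \<theta>, 1:] dvd \<psi>"
    using order_decomp[OF assms(1)] unfolding k_def by blast
  define l where "l = ?c [:- \<theta>, 1:]"
  have l: "l = monom 1 n - [:\<theta>:]" unfolding l_def by (simp add: pcompose_pCons)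
  have "order r l = 1"
  proof (rule order_eq_1I)
    show "poly l r = 0" unfolding l by (simp add: poly_monom \<theta>_def)
    show "poly (pderiv l) r \<noteq> 0" unfolding l using assms by (simp add: pderiv_diff pderiv_monom poly_monom pderiv_pCons)
  qed
  moreover have lnz: "l \<noteq> 0" using \<open>order r l = 1\<close> calculation assms unfolding l
    by (metis coeff_0 coeff_diff coeff_monom coeff_pCons_Suc coeff_pCons_0 gr0_implies_Suc coeff_0 diff_zero zero_neq_one)
  moreover have p\<psi>: "poly (?c \<psi>) r \<noteq> 0"
    using \<psi>(2) by (simp add: poly_pcompose poly_monom \<theta>_def[symmetric] poly_eq_0_iff_dvd)
  then have "?c \<psi> \<noteq> 0" by auto
  moreover have "poly (monom 1 m) r \<noteq> 0" using assms by (simp add: poly_monom)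
  then have "order r (monom 1 m) = 0" by (rule order_0I)
  moreover have "monom 1 m \<noteq> (0 :: 'a poly)" by simp
  moreover have "order r (?c \<psi>) = 0" using p\<psi> by (rule order_0I)
  moreover have "?c \<phi> = l ^ k * ?c \<psi>" unfolding l_def using arg_cong[OF \<psi>(1), of ?c] by (simp only: c.map_mult c.map_power)
  ultimately show ?thesis unfolding k_def[symmetric] \<theta>_def[symmetric]
    by (simp add: order_mult order_power)
qed

section \<open>Polynomials with two lattice points\<close>

text \<open>The exponents differ by the primitive vector (D1, D2). At a lattice point of the segment
  with parameter z both z D1 and z D2 are integers, hence by Bezout so is z, which leaves the end
  points.\<close>

lemma two_point_binomial:
  fixes \<theta> :: "'a::idom" and D1 D2 :: int
  assumes D: "coprime D1 D2" and "\<theta> \<noteq> 0"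
  shows "monom_xy 1 (nat D1) (nat D2) - const_xy \<theta> * monom_xy 1 (nat (- D1)) (nat (- D2)) \<in> two_point_polys"
proof -
  define A where "A = (nat D1, nat D2)"
  define B where "B = (nat (- D1), nat (- D2))"
  define t where "t = monom_xy 1 (nat D1) (nat D2) - const_xy \<theta> * monom_xy 1 (nat (- D1)) (nat (- D2))"
  let ?r = "\<lambda>(i, j). (real i, real j)"
  have nz: "D1 \<noteq> 0 \<or> D2 \<noteq> 0" using D by auto
  then have AB: "A \<noteq> B" unfolding A_def B_def by auto
  have supp: "supp_xy t = {A, B}"
    using AB \<open>\<theta> \<noteq> 0\<close> unfolding t_def const_xy_eq_monom monom_xy_mult A_def B_def
    by (auto simp: mem_supp_xy split: if_splits)
  have DA: "real (fst A) - real (fst B) = of_int D1" "real (snd A) - real (snd B) = of_int D2"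
    unfolding A_def B_def by (cases "D1 \<ge> 0"; cases "D2 \<ge> 0"; simp)+
  have np: "newton_polygon t = closed_segment (?r A) (?r B)"
    unfolding newton_polygon_def supp segment_convex_hull by simp
  obtain r s where rs: "r * D1 + s * D2 = 1"
    using bezout_int[of D1 D2] D by auto
  have "newton_polygon t \<inter> \<int> \<times> \<int> = {?r A, ?r B}"
  proof (intro equalityI subsetI)
    fix p assume p: "p \<in> newton_polygon t \<inter> \<int> \<times> \<int>"
    then have "p \<in> closed_segment (?r A) (?r B)" unfolding np by blast
    then obtain z where z: "0 \<le> z" "z \<le> 1" "p = (1 - z) *\<^sub>R ?r A + z *\<^sub>R ?r B"
      unfolding in_segment by blast
    have f: "fst p = real (fst A) - z * of_int D1" and g: "snd p = real (snd A) - z * of_int D2"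
      unfolding DA[symmetric] z(3) by (simp_all add: case_prod_unfold algebra_simps)
    have "fst p \<in> \<int>" "snd p \<in> \<int>" using p by auto
    then have "real (fst A) - fst p \<in> \<int>" "real (snd A) - snd p \<in> \<int>" by (simp_all add: Ints_diff)
    then have "z * of_int D1 \<in> \<int>" "z * of_int D2 \<in> \<int>" unfolding f g by (simp_all only: diff_diff_eq2 add_diff_cancel_left')
    then have "of_int r * (z * of_int D1) + of_int s * (z * of_int D2) \<in> (\<int> :: real set)"
      by (intro Ints_add Ints_mult[OF Ints_of_int])
    also have "of_int r * (z * of_int D1) + of_int s * (z * of_int D2) = z * real_of_int (r * D1 + s * D2)"
      by (simp add: algebra_simps)
    finally have "z \<in> \<int>" unfolding rs by simp
    then have "z = 0 \<or> z = 1" using z(1,2) by (auto elim!: Ints_cases)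
    then show "p \<in> {?r A, ?r B}" using z(3) by auto
  next
    fix p assume "p \<in> {?r A, ?r B}"
    then show "p \<in> newton_polygon t \<inter> \<int> \<times> \<int>" unfolding np by (auto simp: case_prod_unfold)
  qed
  moreover have "?r A \<noteq> ?r B" using AB by (auto simp: case_prod_unfold prod_eq_iff)
  ultimately show ?thesis unfolding two_point_polys_def t_def[symmetric] by simp
qed

section \<open>Leading forms of a pair with generic boundaries\<close>

text \<open>Meaningful for \<open>P \<noteq> 0\<close> only, like \<open>leading_form\<close>.\<close>

definition max_weight :: "int \<Rightarrow> int \<Rightarrow> 'a::zero poly poly \<Rightarrow> int" where
  "max_weight u v P = Max (weight (u, v) ` supp_xy P)"

lemma max_weight_ge: "(i, j) \<in> supp_xy P \<Longrightarrow> u * int i + v * int j \<le> max_weight u v P"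
  unfolding max_weight_def using finite_supp_xy[of P] by (intro Max_ge) force+

lemma max_weight_attained:
  assumes "P \<noteq> 0"
  obtains i j where "(i, j) \<in> supp_xy P" "u * int i + v * int j = max_weight u v P"
proof -
  have "max_weight u v P \<in> weight (u, v) ` supp_xy P"
    unfolding max_weight_def using assms finite_supp_xy[of P] by (intro Max_in) auto
  then obtain p where p: "p \<in> supp_xy P" "max_weight u v P = weight (u, v) p" by blast
  obtain i j where "p = (i, j)" by (cases p)
  with p show thesis using that[of i j] by simp
qed

lemma leading_form_eq: "leading_form (u, v) P = homogeneous_component (u, v) (max_weight u v P) P"
  by (simp add: leading_form_def max_weight_def)

lemma homog_wt_leading_form: "homog_wt u v (max_weight u v P) (leading_form (u, v) P)"
  unfolding leading_form_eq by (rule homog_wt_component)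

lemma leading_form_nonzero:
  assumes "P \<noteq> 0"
  shows "leading_form (u, v) P \<noteq> 0"
proof -
  obtain i j where ij: "(i, j) \<in> supp_xy P" "u * int i + v * int j = max_weight u v P"
    using max_weight_attained[OF assms] .
  then have "coeff_xy (leading_form (u, v) P) i j \<noteq> 0"
    unfolding leading_form_eq coeff_homogeneous_component by (simp add: mem_supp_xy)
  then show ?thesis by auto
qed

text \<open>Defined as a reduction at t = 0, so that the bracket identity applies to it directly; it
  is at the same time the dehomogenised leading form.\<close>

definition initial_form :: "int \<Rightarrow> int \<Rightarrow> nat \<Rightarrow> nat \<Rightarrow> 'a::comm_ring_1 poly poly \<Rightarrow> 'a poly" where
  "initial_form u v a a' P = red (star u v a a' (max_weight u v P) P)"

lemma initial_form_eq: "initial_form u v a a' P = dehom a a' (leading_form (u, v) P)"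
  unfolding initial_form_def leading_form_eq by (intro red_star max_weight_ge)

lemma initial_form_nonzero:
  assumes "P \<noteq> 0" "u * int a' - v * int a \<noteq> 0"
  shows "initial_form u v a a' P \<noteq> 0"
  using dehom_homog_eq_0[OF homog_wt_leading_form assms(2)] leading_form_nonzero[OF assms(1)]
  unfolding initial_form_eq by blast

lemma rescale_1_0: "rescale 1 0 (pcompose P [:0, 1:]) = P"
proof -
  have m: "monom 1 1 = [:0, 1 :: 'a:]" by (simp add: monom_Suc monom_0)
  show ?thesis
    by (rule poly_eqI) (simp only: coeff_rescale pcompose_idR mult_0 monom_0 m, simp)
qed

text \<open>The bracket identity without shift and rescaling, read at t^0. The condition on c says
  that a nonzero constant Jacobian, of weight 0, lies below the weight of the Jacobian of the
  leading forms, which therefore vanishes.\<close>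

lemma initial_form_bracket:
  fixes F G :: "'a::field_char_0 poly poly"
  assumes "F \<noteq> 0" "G \<noteq> 0" and aa: "a + a' = 1" and J: "jacobian_xy F G = const_xy c"
    and c: "c = 0 \<or> u + v < max_weight u v F + max_weight u v G"
  shows "of_int (max_weight u v F) * (initial_form u v a a' F * pderiv (initial_form u v a a' G))
    = of_int (max_weight u v G) * (pderiv (initial_form u v a a' F) * initial_form u v a a' G)"
proof -
  let ?M = "max_weight u v F" and ?M' = "max_weight u v G"
  define A where "A = star u v a a' ?M F"
  define B where "B = star u v a a' ?M' G"
  note rescale_bracket[OF aa max_weight_ge[where u = u and v = v] max_weight_ge[where u = u and v = v] J, where q = 1 and \<kappa> = 0 and \<xi> = 0]
  then have br: "(xvar * deriv_x A - of_int ?M * A) * deriv_y B - deriv_y A * (xvar * deriv_x B - of_int ?M' * B)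
    = monom_xy (- of_int (u * int a' - v * int a) * c) (nat (?M + ?M' - u - v)) 0"
    unfolding rescale_1_0 A_def B_def by simp
  have "A = xvar ^ 0 * A" "B = xvar ^ 0 * B" by simp_all
  from leading_bracket[OF this br] c
  have "of_int (- ?M) * (red A * pderiv (red B)) - of_int (- ?M') * (pderiv (red A) * red B) = 0"
    by fastforce
  then show ?thesis unfolding initial_form_def A_def[symmetric] B_def[symmetric] by simp
qed

text \<open>Newton polygons enter through their support functions \<open>max_weight u v\<close> at
  all integer (u, v): similarity becomes proportionality, and the three given points become lower
  bounds.\<close>

locale generic_pair =
  fixes F G :: "'k::{alg_closed_field, field_char_0} poly poly" and b :: nat and c :: 'k
  assumes b: "odd b" "b \<ge> 3"
    and nonzero: "F \<noteq> 0" "G \<noteq> 0"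
    and jac: "jacobian_xy F G = const_xy c"
    and similar: "int b * max_weight u v F = 2 * max_weight u v G"
    and contains: "max_weight u v F \<ge> 0" "max_weight u v F \<ge> u" "max_weight u v F \<ge> v"
    and generic: "w \<in> directions \<Longrightarrow> R\<^sup>2 = leading_form w F \<Longrightarrow> t \<in> two_point_polys \<Longrightarrow> \<not> t\<^sup>2 dvd R"
begin

lemma even_max_weight: "even (max_weight u v F)"
  using similar[of u v] b(1) by (metis dvd_triv_left even_mult_iff even_of_nat_iff)

text \<open>In the direction (-L, 1) with L the degree in y, points off the y-axis have weight at
  most 0, but the maximum is positive because of (0, 1). So it is attained on the axis, and being
  even it is at least 2.\<close>

lemma axis_y: obtains j where "(0, j) \<in> supp_xy F" "j \<ge> 2"
proof -
  define L where "L = int (Max (snd ` supp_xy F))"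
  have L: "int j \<le> L" if "(i, j) \<in> supp_xy F" for i j
  proof -
    have "j \<le> Max (snd ` supp_xy F)" using that finite_supp_xy[of F] by (intro Max_ge) force+
    then show ?thesis by (simp add: L_def)
  qed
  obtain i j where ij: "(i, j) \<in> supp_xy F" "- L * int i + 1 * int j = max_weight (- L) 1 F"
    using max_weight_attained[OF nonzero(1)] .
  have "max_weight (- L) 1 F \<ge> 1" by (rule contains(3))
  have "i = 0"
  proof (rule ccontr)
    assume "i \<noteq> 0"
    moreover have "L \<ge> 0" by (simp add: L_def)
    ultimately have "L * int i \<ge> L" by (simp add: mult_le_cancel_left1)
    with ij L[OF ij(1)] \<open>max_weight (- L) 1 F \<ge> 1\<close> show False by simp
  qed
  with ij have "int j = max_weight (- L) 1 F" by simp
  then have "even j" "j \<ge> 1" using even_max_weight[of "- L" 1] \<open>max_weight (- L) 1 F \<ge> 1\<close> by presburger+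
  then have "j \<ge> 2" by presburger
  with ij \<open>i = 0\<close> show thesis using that by blast
qed

lemma axis_x: obtains i where "(i, 0) \<in> supp_xy F" "i \<ge> 2"
proof -
  define L where "L = int (Max (fst ` supp_xy F))"
  have L: "int i \<le> L" if "(i, j) \<in> supp_xy F" for i j
  proof -
    have "i \<le> Max (fst ` supp_xy F)" using that finite_supp_xy[of F] by (intro Max_ge) force+
    then show ?thesis by (simp add: L_def)
  qed
  obtain i j where ij: "(i, j) \<in> supp_xy F" "1 * int i + - L * int j = max_weight 1 (- L) F"
    using max_weight_attained[OF nonzero(1)] .
  have "max_weight 1 (- L) F \<ge> 1" by (rule contains(2))
  have "j = 0"
  proof (rule ccontr)
    assume "j \<noteq> 0"
    moreover have "L \<ge> 0" by (simp add: L_def)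
    ultimately have "L * int j \<ge> L" by (simp add: mult_le_cancel_left1)
    with ij L[OF ij(1)] \<open>max_weight 1 (- L) F \<ge> 1\<close> show False by simp
  qed
  with ij have "int i = max_weight 1 (- L) F" by simp
  then have "even i" "i \<ge> 1" using even_max_weight[of 1 "- L"] \<open>max_weight 1 (- L) F \<ge> 1\<close> by presburger+
  then have "i \<ge> 2" by presburger
  with ij \<open>j = 0\<close> show thesis using that by blast
qed

lemma max_weight_ge_twice: "max_weight u v F \<ge> 2 * u" "max_weight u v F \<ge> 2 * v"
proof -
  obtain i where i: "(i, 0) \<in> supp_xy F" "i \<ge> 2" by (rule axis_x)
  obtain j where j: "(0, j) \<in> supp_xy F" "j \<ge> 2" by (rule axis_y)
  show "max_weight u v F \<ge> 2 * u"
  proof (cases "u \<ge> 0")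
    case True
    then have "2 * u \<le> u * int i" using i(2) by (metis mult.commute mult_left_mono of_nat_le_iff of_nat_numeral)
    with max_weight_ge[OF i(1), of u v] show ?thesis by simp
  qed (use contains(1)[of u v] in linarith)
  show "max_weight u v F \<ge> 2 * v"
  proof (cases "v \<ge> 0")
    case True
    then have "2 * v \<le> v * int j" using j(2) by (metis mult.commute mult_left_mono of_nat_le_iff of_nat_numeral)
    with max_weight_ge[OF j(1), of u v] show ?thesis by simp
  qed (use contains(1)[of u v] in linarith)
qed

definition edge :: "int \<Rightarrow> int \<Rightarrow> bool" where
  "edge u v \<longleftrightarrow> (u, v) \<in> directions \<and> (\<exists>p\<in>supp_xy F. \<exists>q\<in>supp_xy F. p \<noteq> q
     \<and> weight (u, v) p = max_weight u v F \<and> weight (u, v) q = max_weight u v F)"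

text \<open>The bound on u + v is obtained in two rounds: a cruder one makes the Jacobian of the
  leading forms vanish, the resulting double root makes the edge at least two primitive steps long,
  and this sharpens the bound.\<close>

lemma edge_facts:
  assumes "edge u v"
  obtains a a' d :: nat and \<epsilon> where "a + a' = 1" "u * int a' - v * int a \<noteq> 0" "d \<ge> 1" "u \<noteq> 0 \<longleftrightarrow> a' = 1"
    "max_weight u v F = 2 * int d" "max_weight u v G = int b * int d" "u + v \<le> int d + 1"
    "initial_form u v a a' F \<noteq> 0" "\<epsilon> \<noteq> 0"
    "(initial_form u v a a' G)\<^sup>2 = smult \<epsilon> (initial_form u v a a' F ^ b)"
    "\<And>r. r \<noteq> 0 \<Longrightarrow> poly (initial_form u v a a' F) r = 0 \<Longrightarrow> order r (initial_form u v a a' F) = 2"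
    "\<exists>r. r \<noteq> 0 \<and> poly (initial_form u v a a' F) r = 0"
proof -
  have dir: "(u, v) \<in> directions" and uv: "u > 0 \<or> v > 0" "coprime u v"
    using assms by (auto simp: edge_def directions_def coprime_iff_gcd_eq_1)
  \<comment> \<open>The parameter \<eta> is put into y, and x becomes a pure power of t; for u = 0,
    where v = 1, it is put into x. This keeps the determinant nonzero.\<close>
  define a :: nat where "a = (if u = 0 then 1 else 0)"
  define a' :: nat where "a' = (if u = 0 then 0 else 1)"
  have aa: "a + a' = 1" by (simp add: a_def a'_def)
  have u0: "u = 0 \<Longrightarrow> v = 1" using uv by auto
  have \<delta>: "u * int a' - v * int a \<noteq> 0" using u0 by (simp add: a_def a'_def)
  define d where "d = nat (max_weight u v F div 2)"
  have M: "max_weight u v F = 2 * int d"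
    using contains(1)[of u v] even_max_weight[of u v] unfolding d_def by auto
  have M': "max_weight u v G = int b * int d" using similar[of u v] M by simp
  have d: "d \<ge> 1" using contains(2)[of u v] contains(3)[of v u] uv(1) M by linarith
  define f where "f = initial_form u v a a' F"
  define g where "g = initial_form u v a a' G"
  have fnz: "f \<noteq> 0" and gnz: "g \<noteq> 0" unfolding f_def g_def using initial_form_nonzero nonzero \<delta> by blast+
  \<comment> \<open>The primitive vector along the edge, oriented so that the exponent of \<eta>
    grows; it does so by \<open>n0\<close> per step.\<close>
  define D1 where "D1 = (if u = 0 then 1 else - v * sgn u)"
  define D2 where "D2 = (if u = 0 then 0 else u * sgn u)"
  have D: "u * D1 + v * D2 = 0" "coprime D1 D2"
    using uv u0 by (auto simp: D1_def D2_def sgn_if coprime_commute)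
  define n0 where "n0 = (if u = 0 then 1 else nat \<bar>u\<bar>)"
  have n0: "n0 > 0" "a * nat D1 + a' * nat D2 = n0" "a * nat (- D1) + a' * nat (- D2) = 0"
    by (auto simp: n0_def D1_def D2_def a_def a'_def sgn_if)
  define Fp where "Fp = leading_form (u, v) F"
  have Fp: "Fp \<noteq> 0" "homog_wt u v (2 * int d) Fp"
    using leading_form_nonzero[OF nonzero(1)] homog_wt_leading_form[of u v F] unfolding Fp_def M by auto
  have "u \<noteq> 0 \<or> v \<noteq> 0" using uv by auto
  from homogeneous_as_form[OF Fp D this] obtain \<phi> C1 C2 where \<phi>0: "coeff \<phi> 0 \<noteq> 0"
    and Fform: "Fp = monom_xy 1 C1 C2 * homog_form (degree \<phi>) \<phi> (monom_xy 1 (nat D1) (nat D2)) (monom_xy 1 (nat (- D1)) (nat (- D2)))"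
    and wC: "u * int (C1 + degree \<phi> * nat (- D1)) + v * int (C2 + degree \<phi> * nat (- D2)) = 2 * int d"
    and cardF: "card (supp_xy Fp) > 1 \<Longrightarrow> degree \<phi> > 0"
    by metis
  have "\<phi> \<noteq> 0" using \<phi>0 by auto
  have "card (supp_xy Fp) > 1"
  proof -
    obtain p q where pq: "p \<in> supp_xy F" "q \<in> supp_xy F" "p \<noteq> q"
      "weight (u, v) p = max_weight u v F" "weight (u, v) q = max_weight u v F"
      using assms unfolding edge_def by blast
    then have "{p, q} \<subseteq> supp_xy Fp"
      unfolding Fp_def leading_form_eq
      by (cases p, cases q) (simp add: mem_supp_xy coeff_homogeneous_component)
    then have "card {p, q} \<le> card (supp_xy Fp)" by (intro card_mono finite_supp_xy)
    then show ?thesis using pq(3) by simp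
  qed
  then have deg\<phi>: "degree \<phi> > 0" by (rule cardF)
  have f: "f = monom 1 (a * C1 + a' * C2) * pcompose \<phi> (monom 1 n0)"
    unfolding f_def initial_form_eq Fp_def[symmetric] Fform by (rule dehom_form[OF n0(2,3)])
  \<comment> \<open>The end of the edge with the larger exponent of x has at least
    \<open>degree \<phi>\<close> times v there, so its weight is at least
    \<open>int (degree \<phi>) * (u * v)\<close>.\<close>
  have deg_bound: "int (degree \<phi>) * (u * v) \<le> 2 * int d" if "u > 0" "v > 0"
  proof -
    have "u * int (degree \<phi> * nat (- D1)) \<le> 2 * int d"
    proof -
      have "nat (- D2) = 0" using that by (simp add: D2_def)
      then have "u * int (degree \<phi> * nat (- D1)) \<le> u * int (C1 + degree \<phi> * nat (- D1)) + v * int (C2 + degree \<phi> * nat (- D2))"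
        using that by (simp add: distrib_left)
      then show ?thesis unfolding wC .
    qed
    moreover have "int (nat (- D1)) = v" using that by (simp add: D1_def)
    ultimately show ?thesis by (simp add: algebra_simps)
  qed
  have uv1: "u + v \<le> u * v + 1" if "u > 0" "v > 0"
  proof -
    have "0 \<le> (u - 1) * (v - 1)" using that by simp
    then show ?thesis by (simp add: algebra_simps)
  qed
  \<comment> \<open>The cruder round: of the length of the edge only
    \<open>degree \<phi> > 0\<close> is known, and the weight of G makes up for this.\<close>
  have bound0: "u + v < max_weight u v F + max_weight u v G"
  proof -
    have "3 * int d \<le> int b * int d" using b(2) by (intro mult_right_mono) auto
    moreover have "u + v \<le> 2 * int d + 1"
    proof (cases "u > 0 \<and> v > 0")
      case True
      then have uv': "u > 0" "v > 0" by auto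
      have "1 * (u * v) \<le> int (degree \<phi>) * (u * v)" using deg\<phi> uv' by (intro mult_right_mono) auto
      then show ?thesis using deg_bound[OF uv'] uv1[OF uv'] by linarith
    qed (use max_weight_ge_twice(1)[of u v] max_weight_ge_twice(2)[of v u] M d in linarith)
    ultimately show ?thesis unfolding M M' using d by linarith
  qed
  have rel: "smult (of_nat 2) (f * pderiv g) = smult (of_nat b) (g * pderiv f)"
  proof -
    have "of_int (2 * int d) * (f * pderiv g) = of_int (int b * int d) * (pderiv f * g)"
      using initial_form_bracket[OF nonzero aa jac disjI2[OF bound0]] unfolding f_def g_def M M' .
    then have "smult (of_nat d) (smult (of_nat 2) (f * pderiv g)) = smult (of_nat d) (smult (of_nat b) (g * pderiv f))"
      by (simp add: of_nat_poly of_int_poly mult_ac)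
    then show ?thesis using d by (metis smult_cancel of_nat_eq_0_iff not_one_le_zero)
  qed
  then obtain \<epsilon> where \<epsilon>: "\<epsilon> \<noteq> 0" "g\<^sup>2 = smult \<epsilon> (f ^ b)" using log_derivative_eq[OF rel fnz gnz] by blast
  obtain R where R: "R\<^sup>2 = Fp"
  proof -
    \<comment> \<open>Normalises the leading form of G: multiplied by z, it has exactly
      \<open>Fp ^ b\<close> as its square, without the constant \<epsilon>.\<close>
    obtain z where z: "z\<^sup>2 = inverse \<epsilon>" using nth_root_exists[of 2 "inverse \<epsilon>"] by auto
    interpret dh: ring_map "dehom a a' :: 'k poly poly \<Rightarrow> _" by (rule ring_map_dehom)
    define y where "y = monom_xy z 0 0 * leading_form (u, v) G"
    have "dehom a a' y = smult z g"
      unfolding y_def dh.map_mult dehom_monom g_def initial_form_eq by (simp add: monom_0)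
    then have "dehom a a' (y\<^sup>2) = smult (z\<^sup>2) (g\<^sup>2)" by (simp add: power2_eq_square)
    also have "\<dots> = dehom a a' (Fp ^ b)"
      unfolding \<epsilon>(2) z using \<epsilon>(1) by (simp add: f_def initial_form_eq Fp_def)
    finally have "dehom a a' (Fp ^ b - y\<^sup>2) = 0" by simp
    moreover have "homog_wt u v (int b * (2 * int d)) (Fp ^ b - y\<^sup>2)"
    proof -
      have "homog_wt u v (0 + int b * int d) y"
        unfolding y_def M'[symmetric] by (intro homog_wt_mult homog_wt_monom homog_wt_leading_form) simp
      then have "homog_wt u v (0 + int 2 * (int b * int d)) (monom_xy (- 1) 0 0 * y\<^sup>2)"
        by (intro homog_wt_mult homog_wt_power homog_wt_monom) simp_all
      moreover have "monom_xy (- 1) 0 0 = (- 1 :: 'k poly poly)" by (simp add: monom_xy_def monom_0 one_pCons)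
      then have "monom_xy (- 1) 0 0 * y\<^sup>2 = - (y\<^sup>2)" by simp
      ultimately have "homog_wt u v (int b * (2 * int d)) (- (y\<^sup>2))" by (simp add: mult_ac)
      from homog_wt_add[OF homog_wt_power[OF Fp(2), of b] this] show ?thesis by simp
    qed
    ultimately have "Fp ^ b - y\<^sup>2 = 0" using dehom_homog_eq_0 \<delta> by blast
    then have "Fp ^ b = y\<^sup>2" by simp
    from odd_power_eq_square_imp_square[OF b(1) this] show thesis using that by blast
  qed
  have mult2: "order r f = 2" if r: "r \<noteq> 0" "poly f r = 0" for r
  proof (rule ccontr)
    assume "order r f \<noteq> 2"
    have "2 * order r g = order r (g\<^sup>2)" using gnz by (simp add: order_power)
    also have "\<dots> = b * order r f" unfolding \<epsilon>(2) using \<epsilon>(1) fnz by (simp add: order_smult order_power)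
    finally have "even (b * order r f)" by (metis dvd_triv_left)
    then have "even (order r f)" using b(1) by simp
    moreover have "order r f \<noteq> 0" using r(2) fnz order_root by blast
    \<comment> \<open>Even, nonzero and not 2. At multiplicity 4 even the square root R of the
      leading form contains the square of a binomial with two lattice points.\<close>
    ultimately have "order r f \<ge> 4" using \<open>order r f \<noteq> 2\<close> by presburger
    then have "order (r ^ n0) \<phi> \<ge> 4" unfolding f order_pcompose_monom[OF \<open>\<phi> \<noteq> 0\<close> n0(1) r(1)] .
    then have "[:- (r ^ n0), 1:] ^ 4 dvd \<phi>" by (rule dvd_trans[OF le_imp_power_dvd order_1])
    from homog_form_power_dvd[OF this \<open>\<phi> \<noteq> 0\<close>]
    have "(monom_xy 1 (nat D1) (nat D2) - const_xy (r ^ n0) * monom_xy 1 (nat (- D1)) (nat (- D2))) ^ 4 dvd Fp"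
      (is "?t ^ 4 dvd _") unfolding Fform by (rule dvd_mult)
    then have "(?t\<^sup>2)\<^sup>2 dvd R\<^sup>2" unfolding R by (simp flip: power_mult)
    then have "?t\<^sup>2 dvd R" by (rule square_dvd_square_imp_dvd)
    moreover have "?t \<in> two_point_polys" using r(1) D(2) by (intro two_point_binomial) auto
    ultimately show False using generic[OF dir R[unfolded Fp_def]] by blast
  qed
  have root: "\<exists>r. r \<noteq> 0 \<and> poly f r = 0"
  proof -
    obtain \<theta> where \<theta>: "poly \<phi> \<theta> = 0" using alg_closed_imp_poly_has_root[OF deg\<phi>] by blast
    then have "\<theta> \<noteq> 0" using \<phi>0 by (auto simp: poly_0_coeff_0)
    obtain r where "r ^ n0 = \<theta>" using nth_root_exists[OF n0(1)] by blast
    then have "r \<noteq> 0" "poly f r = 0" using \<theta> \<open>\<theta> \<noteq> 0\<close> n0(1) by (auto simp: f poly_pcompose poly_monom)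
    then show ?thesis by blast
  qed
  have "u + v \<le> int d + 1"
  proof (cases "u > 0 \<and> v > 0")
    case True
    obtain r where r: "r \<noteq> 0" "poly f r = 0" using root by blast
    have "order (r ^ n0) \<phi> = 2" using mult2[OF r] unfolding f order_pcompose_monom[OF \<open>\<phi> \<noteq> 0\<close> n0(1) r(1)] .
    then have "2 \<le> int (degree \<phi>)" using order_degree[OF \<open>\<phi> \<noteq> 0\<close>, of "r ^ n0"] by simp
    then have "2 * (u * v) \<le> int (degree \<phi>) * (u * v)" using True by (intro mult_right_mono) auto
    then show ?thesis using deg_bound uv1 True by linarith
  qed (use max_weight_ge_twice(1)[of u v] max_weight_ge_twice(2)[of v u] M d in linarith)
  moreover have "u \<noteq> 0 \<longleftrightarrow> a' = 1" by (simp add: a'_def)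
  ultimately show thesis
    using aa \<delta> d M M' fnz \<epsilon> mult2 root unfolding f_def g_def by (intro that[of a a' d \<epsilon>]) auto
qed

text \<open>Among the lines from the highest support point (0, J) on the y-axis to the points off
  the axis, the one of largest slope \<open>sl\<close> is a supporting line. Division by the gcd
  makes its normal (u, v) primitive, with v > 0.\<close>

lemma exists_edge: obtains u v where "edge u v"
proof -
  obtain i1 where i1: "(i1, 0) \<in> supp_xy F" "i1 \<ge> 2" by (rule axis_x)
  define S0 where "S0 = {j. (0, j) \<in> supp_xy F}"
  have "S0 = snd ` (supp_xy F \<inter> {0} \<times> UNIV)" by (force simp: S0_def)
  then have "finite S0" using finite_supp_xy[of F] by simp
  have "S0 \<noteq> {}" using axis_y by (metis S0_def empty_Collect_eq)
  define J where "J = Max S0"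
  have J: "(0, J) \<in> supp_xy F" using Max_in[OF \<open>finite S0\<close> \<open>S0 \<noteq> {}\<close>] by (simp add: J_def S0_def)
  have Jmax: "j \<le> J" if "(0, j) \<in> supp_xy F" for j using that \<open>finite S0\<close> by (simp add: J_def S0_def)
  define S1 where "S1 = {p \<in> supp_xy F. fst p > 0}"
  have S1: "finite S1" "S1 \<noteq> {}" using finite_supp_xy[of F] i1 unfolding S1_def by auto
  define sl where "sl p = (real (snd p) - real J) / real (fst p)" for p :: "nat \<times> nat"
  have "Max (sl ` S1) \<in> sl ` S1" using S1 by (intro Max_in) auto
  then obtain p where p: "p \<in> S1" "sl p = Max (sl ` S1)" by auto
  have slmax: "sl q \<le> sl p" if "q \<in> S1" for q using S1 that unfolding p(2) by simp
  obtain k l where kl: "p = (k, l)" by (cases p)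
  have k: "k > 0" and pF: "(k, l) \<in> supp_xy F" using p(1) by (auto simp: S1_def kl)
  define g where "g = gcd (int J - int l) (int k)"
  have "g > 0" using k by (simp add: g_def)
  define u where "u = (int J - int l) div g"
  define v where "v = int k div g"
  have ug: "int J - int l = u * g" and vg: "int k = v * g" by (simp_all add: u_def v_def g_def)
  have "v > 0" using k vg \<open>g > 0\<close> by (metis of_nat_0_less_iff zero_less_mult_pos2)
  have "coprime u v" unfolding u_def v_def g_def using k by (intro div_gcd_coprime) auto
  then have dir: "(u, v) \<in> directions" using \<open>v > 0\<close> by (simp add: directions_def coprime_iff_gcd_eq_1)
  have w0: "u * int k + v * int l = v * int J"
  proof -
    have "g * (u * int k + v * int l) = (u * g) * int k + (v * g) * int l" by (simp add: algebra_simps)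
    also have "\<dots> = g * (v * int J)" unfolding ug[symmetric] unfolding vg[symmetric] using vg by (simp add: algebra_simps)
    finally show ?thesis using \<open>g > 0\<close> by simp
  qed
  have le: "u * int i + v * int j \<le> v * int J" if ij: "(i, j) \<in> supp_xy F" for i j
  proof (cases "i = 0")
    case True
    then show ?thesis using Jmax ij \<open>v > 0\<close> by simp
  next
    case False
    then have "(i, j) \<in> S1" using ij by (simp add: S1_def)
    from slmax[OF this] have "(real j - real J) * real k \<le> (real l - real J) * real i"
      using False k by (simp add: sl_def kl field_simps)
    then have "real_of_int ((int j - int J) * int k) \<le> real_of_int ((int l - int J) * int i)" by simp
    then have "(int j - int J) * int k \<le> (int l - int J) * int i" by (simp only: of_int_le_iff)
    moreover have "(int l - int J) * int i = - (g * (u * int i))" using ug by (simp add: algebra_simps)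
    moreover have "(int j - int J) * int k = g * (v * int j - v * int J)" unfolding vg by (simp add: algebra_simps)
    ultimately have "g * (u * int i + v * int j - v * int J) \<le> 0" by (simp add: algebra_simps)
    then show ?thesis using \<open>g > 0\<close> by (simp add: mult_le_0_iff)
  qed
  have "max_weight u v F = v * int J"
  proof (rule antisym)
    obtain i j where "(i, j) \<in> supp_xy F" "u * int i + v * int j = max_weight u v F"
      using max_weight_attained[OF nonzero(1)] .
    then show "max_weight u v F \<le> v * int J" using le by metis
    show "v * int J \<le> max_weight u v F" using max_weight_ge[OF J, of u v] by simp
  qed
  then have "edge u v"
    unfolding edge_def using dir J pF w0 k by (intro conjI bexI[of _ "(0, J)"] bexI[of _ "(k, l)"]) auto
  then show thesis by (rule that)
qed

end

section \<open>Boundedness at all places\<close>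

definition eval_xy :: "('a::comm_ring_1 \<Rightarrow> 'b::comm_ring_1) \<Rightarrow> 'b \<Rightarrow> 'b \<Rightarrow> 'a poly poly \<Rightarrow> 'b" where
  "eval_xy \<phi> x y P = poly (map_poly (\<lambda>p. poly (map_poly \<phi> p) x) P) y"

locale coefficient_map = ring_map \<phi> for \<phi> :: "'a::comm_ring_1 \<Rightarrow> 'b::comm_ring_1"
begin

abbreviation eval1 :: "'b \<Rightarrow> 'a poly \<Rightarrow> 'b" where "eval1 x p \<equiv> poly (map_poly \<phi> p) x"

lemma ring_map_eval1: "ring_map (eval1 x)"
  by (rule ring_map_comp[OF ring_map_poly ring_map_map_poly[OF ring_map_axioms]])

lemma ring_map_eval_xy: "ring_map (eval_xy \<phi> x y)"
  unfolding eval_xy_def by (rule ring_map_comp[OF ring_map_poly ring_map_map_poly[OF ring_map_eval1]])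

lemma eval1_pCons: "eval1 x (pCons c p) = \<phi> c + x * eval1 x p"
  by (simp add: map_poly_pCons)

lemma eval_xy_pCons: "eval_xy \<phi> x y (pCons p P) = eval1 x p + y * eval_xy \<phi> x y P"
  unfolding eval_xy_def by (simp add: map_poly_pCons)

lemma eval_xy_0: "eval_xy \<phi> x y 0 = 0"
  by (simp add: eval_xy_def)

lemma eval_xy_const: "eval_xy \<phi> x y (const_xy c) = \<phi> c"
  by (simp add: const_xy_def eval_xy_pCons eval_xy_0 eval1_pCons)

lemma eval_xy_xvar: "eval_xy \<phi> x y xvar = x"
  unfolding monom_xy_def by (simp add: monom_0 monom_Suc eval_xy_pCons eval_xy_0 eval1_pCons)

lemma eval_xy_yvar: "eval_xy \<phi> x y yvar = y"
  unfolding monom_xy_def by (simp add: monom_0 monom_Suc eval_xy_pCons eval_xy_0 eval1_pCons)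

lemma eval_xy_monom: "eval_xy \<phi> x y (monom_xy c i j) = \<phi> c * x ^ i * y ^ j"
proof -
  interpret e: ring_map "eval_xy \<phi> x y" by (rule ring_map_eval_xy)
  show ?thesis by (subst monom_xy_expand) (simp only: e.map_mult e.map_power eval_xy_const eval_xy_xvar eval_xy_yvar)
qed

lemma eval_xy_lin: "eval_xy \<phi> x y P = lin \<phi> (\<lambda>i j. x ^ i * y ^ j) P"
  using ring_map_expand[OF ring_map_eval_xy, of x y P] unfolding eval_xy_const eval_xy_xvar eval_xy_yvar .

lemma pcompose_yvar: "pcompose yvar q = q"
  by (simp add: monom_xy_def monom_Suc monom_0 pcompose_pCons pCons_one pcompose_1)

lemma eval_xy_shift:
  "eval_xy \<phi> x y (pcompose P [:\<xi>, 1:]) = eval_xy \<phi> x (y + eval1 x \<xi>) P"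
proof (rule ring_map_xy_eqI[of "\<lambda>P. eval_xy \<phi> x y (pcompose P [:\<xi>, 1:])"])
  show "ring_map (\<lambda>P. eval_xy \<phi> x y (pcompose P [:\<xi>, 1:]))"
    by (rule ring_map_comp[OF ring_map_eval_xy ring_map_pcompose])
  show "ring_map (eval_xy \<phi> x (y + eval1 x \<xi>))" by (rule ring_map_eval_xy)
  show "eval_xy \<phi> x y (pcompose (const_xy c) [:\<xi>, 1:]) = eval_xy \<phi> x (y + eval1 x \<xi>) (const_xy c)" for c
    unfolding eval_xy_const by (simp add: const_xy_def eval_xy_pCons eval_xy_0 eval1_pCons)
  show "eval_xy \<phi> x y (pcompose xvar [:\<xi>, 1:]) = eval_xy \<phi> x (y + eval1 x \<xi>) xvar"
    unfolding eval_xy_xvar unfolding monom_xy_def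
    by (simp add: monom_0 monom_Suc eval_xy_pCons eval_xy_0 eval1_pCons)
  have "eval1 x 1 = 1" by (rule ring_map.map_1[OF ring_map_eval1])
  then show "eval_xy \<phi> x y (pcompose yvar [:\<xi>, 1:]) = eval_xy \<phi> x (y + eval1 x \<xi>) yvar"
    unfolding eval_xy_yvar pcompose_yvar eval_xy_pCons eval_xy_0 by simp
qed

lemma eval_xy_rescale: "eval_xy \<phi> x y (rescale 1 \<kappa> P) = eval_xy \<phi> x (x ^ \<kappa> * y) P"
proof (rule ring_map_xy_eqI[of "\<lambda>P. eval_xy \<phi> x y (rescale 1 \<kappa> P)"])
  have m1: "monom 1 1 = [:0, 1 :: 'a:]" by (simp add: monom_Suc monom_0)
  have r: "rescale 1 \<kappa> P = pcompose P [:0, monom 1 \<kappa>:]" for P :: "'a poly poly"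
  proof -
    have "map_poly (\<lambda>p. pcompose p (monom 1 1)) P = P"
      unfolding m1 pcompose_idR by (rule poly_eqI) (simp add: coeff_map_poly)
    then show ?thesis by (simp only: rescale_def)
  qed
  have mk: "eval1 x (monom 1 \<kappa>) = x ^ \<kappa>" by (simp add: map_poly_monom poly_monom)
  show "ring_map (\<lambda>P. eval_xy \<phi> x y (rescale 1 \<kappa> P))"
    by (rule ring_map_comp[OF ring_map_eval_xy ring_map_rescale])
  show "ring_map (eval_xy \<phi> x (x ^ \<kappa> * y))" by (rule ring_map_eval_xy)
  show "eval_xy \<phi> x y (rescale 1 \<kappa> (const_xy c)) = eval_xy \<phi> x (x ^ \<kappa> * y) (const_xy c)" for c
    unfolding eval_xy_const r by (simp add: const_xy_def eval_xy_pCons eval_xy_0 eval1_pCons)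
  show "eval_xy \<phi> x y (rescale 1 \<kappa> xvar) = eval_xy \<phi> x (x ^ \<kappa> * y) xvar"
    unfolding eval_xy_xvar r unfolding monom_xy_def
    by (simp add: monom_0 monom_Suc eval_xy_pCons eval_xy_0 eval1_pCons)
  show "eval_xy \<phi> x y (rescale 1 \<kappa> yvar) = eval_xy \<phi> x (x ^ \<kappa> * y) yvar"
    unfolding eval_xy_yvar r pcompose_yvar eval_xy_pCons eval_xy_0 mk by (simp add: mult.commute)
qed

end

section \<open>Evaluation of polynomials at a place over the constants\<close>

locale coefficient_valuation = valuation R + coefficient_map \<phi>
  for R :: "'e::field set" and \<phi> :: "'k::field \<Rightarrow> 'e" +
  assumes \<phi>_in: "\<phi> c \<in> R"
begin

lemma \<phi>_unit: assumes "c \<noteq> 0" shows "\<phi> c \<in> units"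
proof -
  have "\<phi> c * \<phi> (inverse c) = 1" using assms by (simp only: map_mult[symmetric]) simp
  then have "\<phi> c \<noteq> 0" "inverse (\<phi> c) = \<phi> (inverse c)" by (auto simp: inverse_unique)
  then show ?thesis using \<phi>_in by (simp add: units_def)
qed

lemma eval1_in: "x \<in> R \<Longrightarrow> eval1 x p \<in> R"
  by (induction p) (auto simp: R_0 map_poly_pCons intro: R_add R_mult \<phi>_in)

lemma eval_xy_in: "x \<in> R \<Longrightarrow> y \<in> R \<Longrightarrow> eval_xy \<phi> x y P \<in> R"
  by (induction P) (auto simp: R_0 eval_xy_0 eval_xy_pCons intro: R_add R_mult eval1_in)

lemma eval1_mm: assumes "x \<in> \<mm>" shows "eval1 x p - \<phi> (poly p 0) \<in> \<mm>"
proof (cases p)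
  case (pCons c q)
  then show ?thesis using mm_mult[OF assms eval1_in[OF mm_subset[OF assms]], of q]
    by (simp add: map_poly_pCons)
qed

lemma eval_xy_mm:
  assumes "x \<in> \<mm>" "y \<in> R"
  shows "eval_xy \<phi> x y P - eval1 y (red P) \<in> \<mm>"
proof (induction P)
  case 0
  then show ?case by (simp add: eval_xy_0 mm_0 red_def)
next
  case (pCons p P)
  have "red (pCons p P) = pCons (poly p 0) (red P)" by (simp add: red_def map_poly_pCons)
  then have "eval_xy \<phi> x y (pCons p P) - eval1 y (red (pCons p P))
      = (eval1 x p - \<phi> (poly p 0)) + y * (eval_xy \<phi> x y P - eval1 y (red P))"
    by (simp add: eval_xy_pCons map_poly_pCons algebra_simps)
  also have "\<dots> \<in> \<mm>" using assms pCons.IH by (intro mm_add mm_mult' eval1_mm)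
  finally show ?case .
qed

text \<open>The residue field may be larger than the constants. But a residue that satisfies a
  polynomial over them is itself a constant: split off linear factors and use that
  \<open>\<mm>\<close> is prime.\<close>

lemma residue_root:
  assumes "p \<noteq> 0" "z \<in> R" "eval1 z p \<in> \<mm>" and alg: "\<And>q :: 'k poly. degree q > 0 \<Longrightarrow> \<exists>r. poly q r = 0"
  shows "\<exists>r. poly p r = 0 \<and> z - \<phi> r \<in> \<mm>"
  using assms(1,3)
proof (induction "degree p" arbitrary: p)
  case 0
  then obtain c where "p = [:c:]" by (metis degree_eq_zeroE)
  with 0 \<phi>_unit[of c] units_not_mm show ?case by (auto simp: map_poly_pCons)
next
  case (Suc n)
  then obtain r where r: "poly p r = 0" using alg[of p] by auto
  then obtain q where q: "p = [:- r, 1:] * q" by (metis dvdE poly_eq_0_iff_dvd)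
  have "q \<noteq> 0" using Suc.prems q by auto
  have dq: "n = degree q" using Suc.hyps(2) \<open>q \<noteq> 0\<close> unfolding q by (subst (asm) degree_mult_eq) auto
  interpret e: ring_map "eval1 z" by (rule ring_map_eval1)
  have "eval1 z p = (z - \<phi> r) * eval1 z q"
    unfolding q e.map_mult by (simp add: map_poly_pCons)
  then have "z - \<phi> r \<in> \<mm> \<or> eval1 z q \<in> \<mm>"
    using Suc.prems(2) mm_prime[OF R_diff[OF assms(2) \<phi>_in] eval1_in[OF assms(2)], of r q] by simp
  then show ?case
  proof
    assume "eval1 z q \<in> \<mm>"
    from Suc.hyps(1)[OF dq \<open>q \<noteq> 0\<close> this] show ?thesis unfolding q by auto
  qed (use r in blast)
qed

end

context valuation
begin

text \<open>Sizes are compared by whether a quotient lies in R, so no value group has to be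
  constructed; totality of R provides finite maxima.\<close>

lemma max_monomial:
  assumes "finite S" "S \<noteq> {}" "\<And>p. p \<in> S \<Longrightarrow> m p \<noteq> 0"
  shows "\<exists>p\<in>S. \<forall>q\<in>S. m q * inverse (m p) \<in> R"
  using assms
proof (induction S rule: finite_ne_induct)
  case (singleton x)
  then show ?case by (simp add: R_1)
next
  case (insert x S)
  then obtain p where p: "p \<in> S" "\<forall>q\<in>S. m q * inverse (m p) \<in> R" by auto
  have nz: "m x \<noteq> 0" "m p \<noteq> 0" using insert.prems p by auto
  show ?case
  proof (cases "m x * inverse (m p) \<in> R")
    case True
    with p show ?thesis by auto
  next
    case False
    then have "inverse (m x * inverse (m p)) \<in> R" using total by blast
    then have px: "m p * inverse (m x) \<in> R" by (simp add: mult.commute)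
    have "m q * inverse (m x) \<in> R" if "q \<in> insert x S" for q
    proof (cases "q = x")
      case False
      then have "(m q * inverse (m p)) * (m p * inverse (m x)) \<in> R" using p px that R_mult by blast
      then show ?thesis using nz by (simp add: field_simps)
    qed (use nz R_1 in simp)
    then show ?thesis by blast
  qed
qed

text \<open>Two monomials of equal value determine the direction \<open>(u, v)\<close> in which the place approaches infinity.\<close>

lemma monomial_coordinates:
  fixes x y :: "'e" and \<alpha> \<beta> :: int
  assumes alg: "\<And>n (z :: 'e). n > 0 \<Longrightarrow> \<exists>w. w ^ n = z"
    and nz: "x \<noteq> 0" "y \<noteq> 0" and out: "\<not> (x \<in> R \<and> y \<in> R)"
    and rel: "x powi \<alpha> * y powi \<beta> \<in> units" "\<alpha> \<noteq> 0 \<or> \<beta> \<noteq> 0"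
  obtains u v :: int and a a' :: nat and t \<eta> where "(u, v) \<in> directions"
    "a = (if u = 0 then 1 else 0)" "a' = (if u = 0 then 0 else 1)"
    "t \<in> \<mm>" "t \<noteq> 0" "\<eta> \<in> units" "x = t powi (- u) * \<eta> ^ a" "y = t powi (- v) * \<eta> ^ a'"
proof -
  define g where "g = gcd \<alpha> \<beta>"
  have g: "g > 0" using rel(2) by (auto simp: g_def)
  define \<alpha>1 where "\<alpha>1 = \<alpha> div g"
  define \<beta>1 where "\<beta>1 = \<beta> div g"
  have ab: "\<alpha> = \<alpha>1 * g" "\<beta> = \<beta>1 * g" by (simp_all add: \<alpha>1_def \<beta>1_def g_def)
  have cop: "coprime \<alpha>1 \<beta>1" unfolding \<alpha>1_def \<beta>1_def g_def using rel(2) by (intro div_gcd_coprime) auto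
  have "(x powi \<alpha>1 * y powi \<beta>1) powi g \<in> units"
    using rel(1) by (simp add: ab power_int_mult_distrib power_int_mult)
  then have un: "x powi \<alpha>1 * y powi \<beta>1 \<in> units" using g units_power_intD by blast
  have dirI: "(u, v) \<in> directions"
    if t: "t \<in> \<mm>" "t \<noteq> 0" "\<eta> \<in> units" and xy: "x = t powi (- u) * \<eta> ^ a" "y = t powi (- v) * \<eta> ^ a'"
      and c: "coprime u v" for u v t \<eta> a a'
  proof -
    have "\<eta> ^ n \<in> R" for n using units_power[OF t(3)] by (simp add: units_def)
    then have "u \<le> 0 \<Longrightarrow> x \<in> R" "v \<le> 0 \<Longrightarrow> y \<in> R"
      unfolding xy using mm_power_int_in_R[OF t(1,2)] by (auto intro!: R_mult)
    then have "u > 0 \<or> v > 0" using out by force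
    then show ?thesis using c by (simp add: directions_def coprime_iff_gcd_eq_1)
  qed
  show thesis
  proof (cases "\<beta>1 = 0")
    case True
    then have "\<bar>\<alpha>1\<bar> = 1" using cop by simp
    then have "x \<in> units" using un True units_power_intD[of x \<alpha>1] by auto
    then have "y \<notin> R" using out by (simp add: units_def)
    then have t: "inverse y \<in> \<mm>" using total[of y] by (auto simp: \<mm>_def)
    show thesis
      by (rule that[of 0 1 1 0 "inverse y" x])
        (use t nz \<open>x \<in> units\<close> in \<open>auto simp: power_int_minus directions_def\<close>)
  next
    case False
    define n where "n = nat \<bar>\<beta>1\<bar>"
    have "n > 0" using False by (simp add: n_def)
    \<comment> \<open>A root of x or of its inverse, chosen so that x is exactly t to the power
      \<open>- \<beta>1\<close>. This extraction is why the ambient field is taken algebraically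
      closed.\<close>
    then obtain t where tn: "t ^ n = x powi (- sgn \<beta>1)" using alg by blast
    have "t \<noteq> 0" using tn nz \<open>n > 0\<close> by (metis power_int_not_zero zero_power)
    have x: "t powi (- \<beta>1) = x"
    proof -
      have "- \<beta>1 = int n * (- sgn \<beta>1)" by (simp add: n_def sgn_if)
      then have "t powi (- \<beta>1) = (t ^ n) powi (- sgn \<beta>1)" by (metis power_int_mult power_int_of_nat)
      also have "\<dots> = x powi (sgn \<beta>1 * sgn \<beta>1)" unfolding tn power_int_mult[symmetric] by simp
      also have "sgn \<beta>1 * sgn \<beta>1 = 1" using False by (simp add: sgn_if)
      finally show ?thesis by simp
    qed
    \<comment> \<open>The part of y that t does not account for. Its power with exponent
      \<open>\<beta>1\<close> is the given unit, so it is a unit itself.\<close>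
    define \<eta> where "\<eta> = y * t powi (- \<alpha>1)"
    have "\<eta> powi \<beta>1 = y powi \<beta>1 * (t powi (- \<beta>1)) powi \<alpha>1"
      unfolding \<eta>_def power_int_mult_distrib power_int_mult[symmetric] by (simp add: mult.commute)
    also have "\<dots> = x powi \<alpha>1 * y powi \<beta>1" unfolding x by (simp add: mult.commute)
    finally have "\<eta> \<in> units" using un False units_power_intD by metis
    have y: "y = t powi \<alpha>1 * \<eta>" unfolding \<eta>_def using \<open>t \<noteq> 0\<close> by (simp add: power_int_minus)
    have "t \<notin> units"
    proof
      assume "t \<in> units"
      then have "x \<in> units" "y \<in> units" using x y units_power_int \<open>\<eta> \<in> units\<close> units_mult by metis+
      with out show False by (simp add: units_def)
    qed
    then consider "t \<in> \<mm>" | "inverse t \<in> \<mm>" using total[of t] \<open>t \<noteq> 0\<close> by (auto simp: \<mm>_def units_def)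
    then show thesis
    proof cases
      case 1
      have xy: "x = t powi (- \<beta>1) * \<eta> ^ 0" "y = t powi (- (- \<alpha>1)) * \<eta> ^ 1" using x y by simp_all
      have "coprime \<beta>1 (- \<alpha>1)" using cop by (simp add: coprime_commute)
      from dirI[OF 1 \<open>t \<noteq> 0\<close> \<open>\<eta> \<in> units\<close> xy this] show thesis
        using 1 \<open>t \<noteq> 0\<close> \<open>\<eta> \<in> units\<close> xy False by (intro that[of \<beta>1 "- \<alpha>1" 0 1 t \<eta>]) auto
    next
      case 2
      have xy: "x = inverse t powi (- (- \<beta>1)) * \<eta> ^ 0" "y = inverse t powi (- \<alpha>1) * \<eta> ^ 1"
        using x y by (simp_all add: power_int_minus power_int_inverse)
      have "coprime (- \<beta>1) \<alpha>1" using cop by (simp add: coprime_commute)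
      from dirI[OF 2 _ \<open>\<eta> \<in> units\<close> xy this] show thesis
        using 2 \<open>t \<noteq> 0\<close> \<open>\<eta> \<in> units\<close> xy False by (intro that[of "- \<beta>1" \<alpha>1 0 1 "inverse t" \<eta>]) auto
    qed
  qed
qed

end

text \<open>R is an arbitrary valuation ring containing the constants, with any residue field and
  value group: only quotients of monomials and the residue of one unit are examined.\<close>

theorem (in generic_pair) bounded_at_places:
  fixes \<iota> :: "'k poly poly \<Rightarrow> 'e::alg_closed_field"
  assumes \<iota>: "ring_map \<iota>" and inj: "\<And>P. \<iota> P = 0 \<Longrightarrow> P = 0"
    and val: "valuation_ring R" and const: "\<And>c. \<iota> (const_xy c) \<in> R" and F: "\<iota> F \<in> R"
  shows "\<iota> G \<in> R"
proof -
  define \<phi> where "\<phi> c = \<iota> (const_xy c)" for c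
  define x where "x = \<iota> xvar"
  define y where "y = \<iota> yvar"
  have \<phi>: "ring_map \<phi>" unfolding \<phi>_def by (rule ring_map_comp[OF \<iota> ring_map_const_xy])
  interpret coefficient_valuation R \<phi>
    by (intro coefficient_valuation.intro valuation.intro coefficient_map.intro val \<phi> coefficient_valuation_axioms.intro)
      (use const in \<open>simp add: \<phi>_def\<close>)
  have \<iota>lin: "\<iota> P = lin \<phi> (\<lambda>i j. x ^ i * y ^ j) P" for P
    using ring_map_expand[OF \<iota>, of P] unfolding \<phi>_def x_def y_def .
  have nz: "x \<noteq> 0" "y \<noteq> 0"
    unfolding x_def y_def using inj[of xvar] inj[of yvar] by (auto simp: monom_xy_def)
  show ?thesis
  proof (cases "x \<in> R \<and> y \<in> R")
    case True
    then show ?thesis using eval_xy_in[of x y G] unfolding \<iota>lin eval_xy_lin by blast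
  next
    case out: False
    define m where "m p = x ^ fst p * y ^ snd p" for p :: "nat \<times> nat"
    have mnz: "m p \<noteq> 0" for p using nz by (simp add: m_def)
    have S: "finite (supp_xy F)" "supp_xy F \<noteq> {}" using finite_supp_xy nonzero by auto
    obtain p where p: "p \<in> supp_xy F" and pmax: "\<And>q. q \<in> supp_xy F \<Longrightarrow> m q * inverse (m p) \<in> R"
      using max_monomial[OF S, of m] mnz by blast
    define cf where "cf q = \<phi> (coeff_xy F (fst q) (snd q))" for q
    have \<iota>F: "\<iota> F = (\<Sum>q\<in>supp_xy F. cf q * m q)"
      unfolding \<iota>lin lin_def cf_def m_def by (simp add: case_prod_unfold)
    \<comment> \<open>The tropical argument: a single dominant monomial cannot be cancelled, so it
      would have to be finite along with F. Then all monomials of F, among them powers of x and of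
      y, would be finite.\<close>
    have "\<exists>q\<in>supp_xy F. q \<noteq> p \<and> m q * inverse (m p) \<in> units"
    proof (rule ccontr)
      assume no: "\<not> ?thesis"
      have small: "cf q * (m q * inverse (m p)) \<in> \<mm>" if "q \<in> supp_xy F - {p}" for q
      proof -
        have "m q * inverse (m p) \<in> \<mm>" using pmax[of q] no that unfolding units_iff by blast
        then show ?thesis using mm_mult' \<phi>_in unfolding cf_def by blast
      qed
      have "\<iota> F * inverse (m p) = (\<Sum>q\<in>supp_xy F. cf q * (m q * inverse (m p)))"
        unfolding \<iota>F sum_distrib_right by (simp add: mult.assoc)
      also have "\<dots> = cf p * (m p * inverse (m p)) + (\<Sum>q\<in>supp_xy F - {p}. cf q * (m q * inverse (m p)))"
        by (rule sum.remove[OF S(1) p])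
      finally have cfp: "cf p = \<iota> F * inverse (m p) - (\<Sum>q\<in>supp_xy F - {p}. cf q * (m q * inverse (m p)))"
        using mnz[of p] by simp
      have "coeff_xy F (fst p) (snd p) \<noteq> 0" using p mem_supp_xy[of "fst p" "snd p" F] by simp
      then have "cf p \<notin> \<mm>" unfolding cf_def using \<phi>_unit units_not_mm by blast
      have mp: "m p \<in> R"
      proof (rule ccontr)
        assume "m p \<notin> R"
        then have "inverse (m p) \<in> \<mm>" using total[of "m p"] by (auto simp: \<mm>_def)
        then have "cf p \<in> \<mm>" unfolding cfp by (intro mm_diff mm_mult'[OF _ F] mm_sum small)
        with \<open>cf p \<notin> \<mm>\<close> show False by blast
      qed
      have all: "m q \<in> R" if "q \<in> supp_xy F" for q
        using R_mult[OF pmax[OF that] mp] mnz[of p] by (simp add: mult.assoc)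
      obtain i where "(i, 0) \<in> supp_xy F" "i \<ge> 2" by (rule axis_x)
      then have "x ^ i \<in> R" "i > 0" using all[of "(i, 0)"] by (auto simp: m_def)
      moreover obtain j where "(0, j) \<in> supp_xy F" "j \<ge> 2" by (rule axis_y)
      then have "y ^ j \<in> R" "j > 0" using all[of "(0, j)"] by (auto simp: m_def)
      ultimately show False using out integrally_closed by blast
    qed
    then obtain q where q: "q \<in> supp_xy F" "q \<noteq> p" "m q * inverse (m p) \<in> units" by blast
    have "m q * inverse (m p) = x powi (int (fst q) - int (fst p)) * y powi (int (snd q) - int (snd p))"
      unfolding m_def using nz by (simp add: power_int_diff field_simps)
    with q(3) have rel: "x powi (int (fst q) - int (fst p)) * y powi (int (snd q) - int (snd p)) \<in> units" by simp
    have "int (fst q) - int (fst p) \<noteq> 0 \<or> int (snd q) - int (snd p) \<noteq> 0" using q(2) by (auto simp: prod_eq_iff)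
    from monomial_coordinates[OF nth_root_exists nz out rel this]
    obtain u v :: int and a a' :: nat and t \<eta> where dir: "(u, v) \<in> directions"
      and a: "a = (if u = 0 then 1 else 0)" "a' = (if u = 0 then 0 else 1)"
      and t: "t \<in> \<mm>" "t \<noteq> 0" and \<eta>: "\<eta> \<in> units" and x: "x = t powi (- u) * \<eta> ^ a" and y: "y = t powi (- v) * \<eta> ^ a'"
      by metis
    have "\<eta> \<noteq> 0" "\<eta> \<in> R" using \<eta> by (auto simp: units_def)
    have tR: "t \<in> R" using t mm_subset by blast
    have mono: "x ^ i * y ^ j = t powi (- (u * int i + v * int j)) * \<eta> ^ (a * i + a' * j)" for i j
    proof -
      have pp: "(t powi k) ^ n = t powi (k * int n)" for k n by (simp add: power_int_mult)
      have "x ^ i = t powi (- (u * int i)) * \<eta> ^ (a * i)" "y ^ j = t powi (- (v * int j)) * \<eta> ^ (a' * j)"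
        unfolding x y power_mult_distrib pp power_mult by simp_all
      then show ?thesis using t(2) by (simp add: power_add power_int_diff power_int_minus power_int_add field_simps)
    qed
    have unitpow: "\<eta> powi n \<in> units" for n using \<eta> by (rule units_power_int)
    define wt where "wt r = u * int (fst r) + v * int (snd r)" for r :: "nat \<times> nat"
    have ratio: "m r * inverse (m r') = t powi (wt r' - wt r) * (\<eta> ^ (a * fst r + a' * snd r) * inverse (\<eta> ^ (a * fst r' + a' * snd r')))" for r r'
      unfolding m_def mono wt_def[symmetric] using t(2) \<open>\<eta> \<noteq> 0\<close> by (simp add: power_int_diff power_int_minus field_simps)
    have ratioR: "m r * inverse (m r') \<in> R \<longleftrightarrow> wt r \<le> wt r'" for r r'
    proof -
      define e where "e = \<eta> ^ (a * fst r + a' * snd r) * inverse (\<eta> ^ (a * fst r' + a' * snd r'))"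
      have e: "e \<in> units" unfolding e_def using \<eta> by (intro units_mult units_inverse units_power)
      then have "e \<in> R" "inverse e \<in> R" "w * e * inverse e = w" for w by (auto simp: units_def)
      then have "t powi (wt r' - wt r) * e \<in> R \<longleftrightarrow> t powi (wt r' - wt r) \<in> R"
        using R_mult by metis
      then show ?thesis unfolding ratio e_def[symmetric] using mm_power_int_in_R[OF t] by simp
    qed
    have "max_weight u v F = wt p"
    proof (rule antisym)
      obtain i j where ij: "(i, j) \<in> supp_xy F" "u * int i + v * int j = max_weight u v F"
        using max_weight_attained[OF nonzero(1)] .
      show "max_weight u v F \<le> wt p" using pmax[OF ij(1)] ij(2) unfolding ratioR by (simp add: wt_def)
      show "wt p \<le> max_weight u v F" using p max_weight_ge[of "fst p" "snd p" F u v] by (simp add: wt_def)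
    qed
    moreover have "wt q = wt p"
    proof -
      have "inverse (m q * inverse (m p)) \<in> R" using q(3) by (simp add: units_def)
      then have "m p * inverse (m q) \<in> R" by (simp add: mult.commute)
      then show ?thesis using pmax[OF q(1)] unfolding ratioR by simp
    qed
    ultimately have edge: "edge u v"
      unfolding edge_def using dir p q by (intro conjI bexI[of _ p] bexI[of _ q]) (auto simp: wt_def case_prod_unfold weight.simps[of u v "fst p" "snd p", simplified] weight.simps[of u v "fst q" "snd q", simplified])
    obtain a0 a0' d \<epsilon> where aa: "a0 + a0' = 1" and "d \<ge> 1" and a0': "u \<noteq> 0 \<longleftrightarrow> a0' = 1"
      and M: "max_weight u v F = 2 * int d" "max_weight u v G = int b * int d" and uv: "u + v \<le> int d + 1"
      and f0: "initial_form u v a0 a0' F \<noteq> 0" and \<epsilon>: "\<epsilon> \<noteq> 0"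
      and g0: "(initial_form u v a0 a0' G)\<^sup>2 = smult \<epsilon> (initial_form u v a0 a0' F ^ b)"
      and ord: "\<And>r. r \<noteq> 0 \<Longrightarrow> poly (initial_form u v a0 a0' F) r = 0 \<Longrightarrow> order r (initial_form u v a0 a0' F) = 2"
      using edge_facts[OF edge] by metis
    have "a0' = a'" "a0 = a" using aa a0' a by (auto split: if_splits)
    define Fs where "Fs = star u v a a' (2 * int d) F"
    define Gs where "Gs = star u v a a' (int b * int d) G"
    have init: "initial_form u v a0 a0' F = red Fs" "initial_form u v a0 a0' G = red Gs"
      unfolding initial_form_def M \<open>a0' = a'\<close> \<open>a0 = a\<close> Fs_def Gs_def by simp_all
    have wF: "u * int i + v * int j \<le> 2 * int d" if "(i, j) \<in> supp_xy F" for i j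
      using max_weight_ge[OF that, of u v] M by simp
    have wG: "u * int i + v * int j \<le> int b * int d" if "(i, j) \<in> supp_xy G" for i j
      using max_weight_ge[OF that, of u v] M by simp
    have evstar: "eval_xy \<phi> t \<eta> (star u v a a' (int N) P) = t ^ N * \<iota> P"
      if "\<And>i j. (i, j) \<in> supp_xy P \<Longrightarrow> u * int i + v * int j \<le> int N" for N P
    proof -
      have "eval_xy \<phi> t \<eta> (star u v a a' (int N) P)
          = lin \<phi> (\<lambda>i j. t ^ nat (int N - u * int i - v * int j) * \<eta> ^ (a * i + a' * j)) P"
        unfolding star_def ring_map_lin_commute[OF ring_map_eval_xy] eval_xy_const eval_xy_monom by simp
      also have "\<dots> = lin \<phi> (\<lambda>i j. t ^ N * (x ^ i * y ^ j)) P"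
      proof (rule lin_cong)
        fix i j assume "(i, j) \<in> supp_xy P"
        then have w: "u * int i + v * int j \<le> int N" by (rule that)
        have "t ^ nat (int N - u * int i - v * int j) = t powi (int N - (u * int i + v * int j))"
          using w by (simp add: power_int_def algebra_simps)
        also have "\<dots> = t ^ N * t powi (- (u * int i + v * int j))"
          using t(2) by (simp add: power_int_diff power_int_minus power_int_add divide_inverse)
        finally show "t ^ nat (int N - u * int i - v * int j) * \<eta> ^ (a * i + a' * j) = t ^ N * (x ^ i * y ^ j)"
          unfolding mono by (simp add: mult.assoc)
      qed
      finally show ?thesis unfolding \<iota>lin lin_times_left[OF \<phi>] .
    qed
    have evF: "eval_xy \<phi> t \<eta> Fs = t ^ (2 * d) * \<iota> F" using evstar[of F "2 * d"] wF unfolding Fs_def by simp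
    have evG: "eval_xy \<phi> t \<eta> Gs = t ^ (b * d) * \<iota> G" using evstar[of G "b * d"] wG unfolding Gs_def by simp
    \<comment> \<open>Finiteness of F forces cancellation: the factor t^(2d) makes the value small,
      so the residue of \<eta> is a root of \<open>red Fs\<close>. It is nonzero since \<eta> is a
      unit, as the statement on multiplicities requires.\<close>
    have "eval_xy \<phi> t \<eta> Fs \<in> \<mm>" unfolding evF using t(1) \<open>d \<ge> 1\<close> F by (intro mm_mult mm_power) auto
    from mm_diff[OF this eval_xy_mm[OF t(1) \<open>\<eta> \<in> R\<close>, of Fs]] have "eval1 \<eta> (red Fs) \<in> \<mm>" by simp
    from residue_root[OF f0[unfolded init] \<open>\<eta> \<in> R\<close> this alg_closed_imp_poly_has_root]
    obtain r where r: "poly (red Fs) r = 0" "\<eta> - \<phi> r \<in> \<mm>" by blast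
    have "r \<noteq> 0" using r(2) units_not_mm[OF \<eta>] by auto
    obtain \<xi> Q G4 where \<xi>: "poly \<xi> 0 = r" and Q: "Q = pcompose Fs [:\<xi>, 1:]"
      and Q0: "monom 1 (2 * d) dvd coeff Q 0" and Q1: "monom 1 (2 * d) dvd coeff Q 1" and Q2: "poly (coeff Q 2) 0 \<noteq> 0"
      and G4: "rescale 1 d (pcompose Gs [:\<xi>, 1:]) = xvar ^ (b * d) * G4"
    proof (rule local_expansion[of a a' b d u v F G c Fs Gs r \<epsilon>])
      show "a + a' = 1" using aa \<open>a0' = a'\<close> \<open>a0 = a\<close> by simp
      show "order r (red Fs) = 2" using ord[of r] \<open>r \<noteq> 0\<close> r(1) unfolding init by blast
    qed (use b \<open>d \<ge> 1\<close> uv wF wG jac f0 g0 \<epsilon> in \<open>auto simp: init Fs_def Gs_def\<close>)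
    define z where "z = \<eta> - eval1 t \<xi>"
    have "(\<eta> - \<phi> r) - (eval1 t \<xi> - \<phi> (poly \<xi> 0)) \<in> \<mm>" by (rule mm_diff[OF r(2) eval1_mm[OF t(1)]])
    then have z: "z \<in> \<mm>" unfolding \<xi> z_def by simp
    then have zR: "z \<in> R" by (rule mm_subset)
    have zeta: "z + eval1 t \<xi> = \<eta>" by (simp add: z_def)
    have evQ: "eval_xy \<phi> t z Q = t ^ (2 * d) * \<iota> F" unfolding Q eval_xy_shift zeta evF ..
    interpret e: ring_map "eval1 t" by (rule ring_map_eval1)
    have et: "eval1 t (monom 1 n) = t ^ n" for n by (simp add: map_poly_monom poly_monom)
    obtain Q0' Q1' where Q0': "coeff Q 0 = monom 1 (2 * d) * Q0'" and Q1': "coeff Q 1 = monom 1 (2 * d) * Q1'"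
      using Q0 Q1 by (blast elim: dvdE)
    obtain Qr where Qr: "Q = pCons (coeff Q 0) (pCons (coeff Q 1) Qr)"
      by (metis One_nat_def coeff_pCons_0 coeff_pCons_Suc pCons_cases)
    have Qr0: "coeff Qr 0 = coeff Q 2"
      by (subst Qr) (simp add: numeral_2_eq_2)
    have evQr: "eval_xy \<phi> t z Qr \<in> units"
    proof -
      have "eval_xy \<phi> t z Qr \<in> R" using tR zR by (rule eval_xy_in)
      moreover have "eval_xy \<phi> t z Qr \<notin> \<mm>"
      proof
        assume "eval_xy \<phi> t z Qr \<in> \<mm>"
        then have "eval1 z (red Qr) \<in> \<mm>" using mm_diff[OF _ eval_xy_mm[OF t(1) zR, of Qr]] by fastforce
        then have "\<phi> (poly (red Qr) 0) \<in> \<mm>" using mm_diff[OF _ eval1_mm[OF z, of "red Qr"]] by fastforce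
        moreover have "poly (red Qr) 0 \<noteq> 0" using Q2 by (simp add: poly_0_coeff_0[of "red Qr"] Qr0)
        ultimately show False using \<phi>_unit units_not_mm by blast
      qed
      ultimately show ?thesis by (simp add: units_iff)
    qed
    \<comment> \<open>The local coordinate after shift and scaling. A priori it may be infinite; the
      equation for F, in which its square occurs with a unit factor, shows that it is not.\<close>
    define \<zeta> where "\<zeta> = z * inverse (t ^ d)"
    have z\<zeta>: "z = t ^ d * \<zeta>" unfolding \<zeta>_def using t(2) by simp
    have "t ^ (2 * d) * \<iota> F = eval1 t (coeff Q 0) + z * (eval1 t (coeff Q 1) + z * eval_xy \<phi> t z Qr)"
      unfolding evQ[symmetric] by (subst Qr) (simp only: eval_xy_pCons)
    also have "\<dots> = t ^ (2 * d) * (eval1 t Q0' + z * eval1 t Q1' + \<zeta>\<^sup>2 * eval_xy \<phi> t z Qr)"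
    proof -
      have "z * (z * w) = t ^ (2 * d) * (\<zeta>\<^sup>2 * w)" for w
      proof -
        have "t ^ (2 * d) = t ^ d * t ^ d" by (simp add: mult_2 power_add)
        then show ?thesis unfolding z\<zeta> power2_eq_square by (simp only: mult_ac)
      qed
      then show ?thesis unfolding Q0' Q1' e.map_mult et by (simp add: distrib_left mult_ac)
    qed
    finally have "\<iota> F = eval1 t Q0' + z * eval1 t Q1' + \<zeta>\<^sup>2 * eval_xy \<phi> t z Qr" using t(2) by simp
    then have "\<zeta>\<^sup>2 * eval_xy \<phi> t z Qr = \<iota> F - (eval1 t Q0' + z * eval1 t Q1')" by simp
    also have "\<dots> \<in> R" using F zR tR by (intro R_diff R_add R_mult eval1_in)
    finally have "\<zeta>\<^sup>2 * eval_xy \<phi> t z Qr * inverse (eval_xy \<phi> t z Qr) \<in> R"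
      by (rule R_mult) (use evQr in \<open>simp add: units_def\<close>)
    moreover have "eval_xy \<phi> t z Qr * inverse (eval_xy \<phi> t z Qr) = 1" using evQr by (simp add: units_def)
    ultimately have "\<zeta>\<^sup>2 \<in> R" unfolding mult.assoc by (simp only: mult_1_right)
    then have "\<zeta> \<in> R" by (rule integrally_closed) simp
    have "t ^ (b * d) * \<iota> G = eval_xy \<phi> t z (pcompose Gs [:\<xi>, 1:])" unfolding eval_xy_shift zeta evG ..
    also have "\<dots> = eval_xy \<phi> t \<zeta> (rescale 1 d (pcompose Gs [:\<xi>, 1:]))" unfolding eval_xy_rescale z\<zeta>[symmetric] ..
    also have "\<dots> = t ^ (b * d) * eval_xy \<phi> t \<zeta> G4"
    proof -
      interpret e2: ring_map "eval_xy \<phi> t \<zeta>" by (rule ring_map_eval_xy)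
      show ?thesis unfolding G4 e2.map_mult e2.map_power eval_xy_xvar ..
    qed
    finally have "\<iota> G = eval_xy \<phi> t \<zeta> G4" using t(2) by simp
    then show ?thesis using eval_xy_in[OF tR \<open>\<zeta> \<in> R\<close>] by simp
  qed
qed

section \<open>Integrality over \<open>K[F]\<close>\<close>

lemma coefficient_map_const_xy: "coefficient_map (const_xy :: 'a::comm_ring_1 \<Rightarrow> _)"
  by (intro coefficient_map.intro ring_map_const_xy)

lemma coefficient_map_comp: "ring_map h \<Longrightarrow> coefficient_map (\<lambda>c. h (const_xy c))"
  by (rule coefficient_map.intro[OF ring_map_comp[OF _ ring_map_const_xy]])

lemma ring_map_eval_xy_commute:
  assumes h: "ring_map h"
  shows "h (eval_xy const_xy A B P) = eval_xy (\<lambda>c. h (const_xy c)) (h A) (h B) P"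
proof (rule ring_map_xy_eqI[of "\<lambda>P. h (eval_xy const_xy A B P)"])
  interpret s: coefficient_map const_xy by (rule coefficient_map_const_xy)
  interpret t: coefficient_map "\<lambda>c. h (const_xy c)" by (rule coefficient_map_comp[OF h])
  show "ring_map (\<lambda>P. h (eval_xy const_xy A B P))" by (rule ring_map_comp[OF h s.ring_map_eval_xy])
  show "ring_map (eval_xy (\<lambda>c. h (const_xy c)) (h A) (h B))" by (rule t.ring_map_eval_xy)
  show "h (eval_xy const_xy A B (const_xy c)) = eval_xy (\<lambda>c. h (const_xy c)) (h A) (h B) (const_xy c)" for c
    unfolding s.eval_xy_const t.eval_xy_const ..
  show "h (eval_xy const_xy A B xvar) = eval_xy (\<lambda>c. h (const_xy c)) (h A) (h B) xvar"
    unfolding s.eval_xy_xvar t.eval_xy_xvar ..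
  show "h (eval_xy const_xy A B yvar) = eval_xy (\<lambda>c. h (const_xy c)) (h A) (h B) yvar"
    unfolding s.eval_xy_yvar t.eval_xy_yvar ..
qed

text \<open>Multiplying G = p(s) by G^N, with N the degree of p, clears the powers of s = 1/G and
  leaves G^(N+1) with coefficient 1.\<close>

lemma (in coefficient_map) monic_of_inverse:
  fixes s G :: 'b
  assumes sG: "s * G = 1" and p: "G = eval_xy \<phi> x s p"
  shows "\<exists>q. lead_coeff q = 1 \<and> eval_xy \<phi> x G q = 0"
proof -
  interpret e: ring_map "eval_xy \<phi> x G" by (rule ring_map_eval_xy)
  interpret e1: ring_map "eval1 x" by (rule ring_map_eval1)
  define N where "N = degree p"
  define q' where "q' = (\<Sum>k\<le>N. monom (coeff p k) (N - k))"
  have em: "eval_xy \<phi> x y (monom r k) = eval1 x r * y ^ k" for r k y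
    unfolding eval_xy_def by (simp add: map_poly_monom poly_monom)
  have ps: "eval_xy \<phi> x s p = (\<Sum>k\<le>N. eval1 x (coeff p k) * s ^ k)"
  proof -
    have "eval_xy \<phi> x s (\<Sum>k\<le>N. monom (coeff p k) k) = (\<Sum>k\<le>N. eval1 x (coeff p k) * s ^ k)"
      unfolding ring_map.map_sum[OF ring_map_eval_xy] em ..
    then show ?thesis unfolding N_def poly_as_sum_of_monoms .
  qed
  have "G ^ Suc N = G * G ^ N" by simp
  also have "\<dots> = (\<Sum>k\<le>N. eval1 x (coeff p k) * s ^ k) * G ^ N" using p ps by simp
  also have "\<dots> = (\<Sum>k\<le>N. eval1 x (coeff p k) * G ^ (N - k))"
    unfolding sum_distrib_right
  proof (intro sum.cong refl)
    fix k assume "k \<in> {..N}"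
    then have "G ^ N = G ^ k * G ^ (N - k)" by (simp flip: power_add)
    then have "s ^ k * G ^ N = (s * G) ^ k * G ^ (N - k)" by (simp add: power_mult_distrib mult_ac)
    then show "eval1 x (coeff p k) * s ^ k * G ^ N = eval1 x (coeff p k) * G ^ (N - k)"
      unfolding sG by (simp add: mult.assoc)
  qed
  also have "\<dots> = eval_xy \<phi> x G q'" unfolding q'_def e.map_sum em ..
  finally have "eval_xy \<phi> x G (monom 1 (Suc N) - q') = 0"
    unfolding e.map_diff em e1.map_1 by simp
  moreover have "lead_coeff (monom 1 (Suc N) - q') = 1"
  proof -
    have "degree q' \<le> N" unfolding q'_def
      by (intro degree_sum_le) (auto intro: order_trans[OF degree_monom_le])
    then have c: "coeff (monom 1 (Suc N) - q') (Suc N) = 1" by (simp add: coeff_eq_0)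
    have "degree (monom (1 :: 'a poly) (Suc N) - q') \<le> Suc N"
      using \<open>degree q' \<le> N\<close> by (intro degree_diff_le degree_monom_le) simp
    moreover have "Suc N \<le> degree (monom (1 :: 'a poly) (Suc N) - q')" using c by (intro le_degree) simp
    ultimately show ?thesis using c by simp
  qed
  ultimately show ?thesis by blast
qed

context generic_pair
begin

text \<open>If G is not integral, its inverse s is a nonunit of the ring generated by F, s and the
  constants, and stays one in some valuation ring. There F is finite but G is not, which boundedness
  at places excludes.\<close>

lemma integral_over_F:
  obtains q where "lead_coeff q = 1" "eval_xy const_xy F G q = 0"
proof (rule ccontr)
  assume "\<not> thesis"
  then have no: "\<not> (lead_coeff q = 1 \<and> eval_xy const_xy F G q = 0)" for q using that by blast
  define \<iota> :: "'k poly poly \<Rightarrow> 'k poly poly fract alg_closure" where "\<iota> P = to_ac (Fract P 1)" for P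
  have \<iota>: "ring_map \<iota>"
    by unfold_locales (simp_all add: \<iota>_def One_fract_def flip: to_ac_add to_ac_mult)
  interpret i: ring_map \<iota> by (rule \<iota>)
  have inj: "P = 0" if "\<iota> P = 0" for P
    using that by (simp add: \<iota>_def Zero_fract_def eq_fract)
  define \<phi> where "\<phi> c = \<iota> (const_xy c)" for c
  interpret coefficient_map \<phi> unfolding \<phi>_def by (rule coefficient_map_comp[OF \<iota>])
  define s where "s = inverse (\<iota> G)"
  have sG: "s * \<iota> G = 1" using inj[of G] nonzero unfolding s_def by (intro left_inverse) blast
  define B where "B = range (eval_xy \<phi> (\<iota> F) s)"
  interpret e: ring_map "eval_xy \<phi> (\<iota> F) s" by (rule ring_map_eval_xy)
  have "subring_set B"
    unfolding subring_set_def
  proof (intro conjI ballI)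
    show "1 \<in> B" unfolding B_def using rangeI[of "eval_xy \<phi> (\<iota> F) s" 1] by (simp only: e.map_1)
    fix x y assume "x \<in> B" "y \<in> B"
    then obtain p q where "x = eval_xy \<phi> (\<iota> F) s p" "y = eval_xy \<phi> (\<iota> F) s q" unfolding B_def by blast
    then have "x - y = eval_xy \<phi> (\<iota> F) s (p - q)" "x * y = eval_xy \<phi> (\<iota> F) s (p * q)" by simp_all
    then show "x - y \<in> B" "x * y \<in> B" unfolding B_def by blast+
  qed
  moreover have "s \<in> B" unfolding B_def using rangeI[of "eval_xy \<phi> (\<iota> F) s" yvar] by (simp only: eval_xy_yvar)
  moreover have "s * r \<noteq> 1" if "r \<in> B" for r
  proof
    assume sr: "s * r = 1"
    from that obtain p where p: "r = eval_xy \<phi> (\<iota> F) s p" unfolding B_def by blast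
    have "r = \<iota> G" using sr sG by (metis mult.commute mult.left_commute mult.right_neutral)
    then have "\<iota> G = eval_xy \<phi> (\<iota> F) s p" using p by simp
    from monic_of_inverse[OF sG this] obtain q
      where q: "lead_coeff q = 1" "eval_xy \<phi> (\<iota> F) (\<iota> G) q = 0" by blast
    then have "\<iota> (eval_xy const_xy F G q) = 0"
      unfolding ring_map_eval_xy_commute[OF \<iota>] \<phi>_def by blast
    with q no inj show False by blast
  qed
  ultimately obtain R where R: "valuation_ring R" "B \<subseteq> R" "\<forall>r\<in>R. s * r \<noteq> 1"
    using valuation_ring_extension[of B s] by blast
  have "\<iota> (const_xy c) \<in> R" for c
    using R(2) eval_xy_const[of "\<iota> F" s c] unfolding B_def \<phi>_def by (metis range_subsetD)
  moreover have "\<iota> F \<in> R" using R(2) eval_xy_xvar[of "\<iota> F" s] unfolding B_def by (metis range_subsetD)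
  ultimately have "\<iota> G \<in> R" using bounded_at_places[OF \<iota> inj R(1)] by blast
  with R(3) sG show False by blast
qed

end

section \<open>Polynomials with vanishing Jacobian\<close>

lemma derivation_jacobian: "derivation (jacobian_xy (F :: 'a::idom poly poly))"
  unfolding derivation_def jacobian_xy_def
    derivation_add[OF derivation_deriv_x] derivation_add[OF derivation_deriv_y]
    derivation_mult[OF derivation_deriv_x] derivation_mult[OF derivation_deriv_y]
  by (simp add: algebra_simps)

lemma jacobian_self [simp]: "jacobian_xy F F = 0"
  by (simp add: jacobian_xy_def)

lemma jacobian_const [simp]: "jacobian_xy F (const_xy c) = 0"
proof -
  have "deriv_x (const_xy c) = 0" "deriv_y (const_xy c) = 0"
    by (simp_all add: const_xy_eq_monom deriv_x_monom deriv_y_monom) (simp_all add: monom_xy_def)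
  then show ?thesis by (simp add: jacobian_xy_def)
qed

definition at_poly :: "'a::comm_ring_1 poly poly \<Rightarrow> 'a poly \<Rightarrow> 'a poly poly" where
  "at_poly F p = poly (map_poly const_xy p) F"

lemma ring_map_at_poly: "ring_map (at_poly F)"
  unfolding at_poly_def by (rule coefficient_map.ring_map_eval1[OF coefficient_map_const_xy])

lemma at_poly_pCons: "at_poly F (pCons c p) = const_xy c + F * at_poly F p"
  unfolding at_poly_def by (rule coefficient_map.eval1_pCons[OF coefficient_map_const_xy])

lemma at_poly_0 [simp]: "at_poly F 0 = 0"
  by (simp add: at_poly_def)

lemma at_poly_smult: "at_poly F (smult c p) = const_xy c * at_poly F p"
proof -
  interpret ring_map "at_poly F" by (rule ring_map_at_poly)
  have "at_poly F (smult c p) = at_poly F ([:c:] * p)" by simp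
  also have "\<dots> = const_xy c * at_poly F p" by (simp only: map_mult at_poly_pCons at_poly_0) simp
  finally show ?thesis .
qed

lemma derivation_at_poly:
  assumes D: "derivation D" and const: "\<And>c. D (const_xy c) = 0"
  shows "D (at_poly F p) = at_poly F (pderiv p) * D F"
proof (induction p)
  case (pCons c p)
  interpret ring_map "at_poly F" by (rule ring_map_at_poly)
  have "D (at_poly F (pCons c p)) = D F * at_poly F p + F * (at_poly F (pderiv p) * D F)"
    unfolding at_poly_pCons derivation_add[OF D] derivation_mult[OF D] const pCons.IH by simp
  also have "\<dots> = at_poly F (pderiv (pCons c p)) * D F"
    unfolding pderiv_pCons map_add at_poly_pCons ring_map.map_0[OF ring_map_const_xy] by (simp add: algebra_simps)
  finally show ?case .
qed (simp add: derivation_0[OF D])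

lemma jacobian_at_poly: "jacobian_xy F (at_poly F p) = 0"
  using derivation_at_poly[OF derivation_jacobian jacobian_const, of F F p] by simp

text \<open>The derivation \<open>jacobian_xy F\<close> kills polynomials in F and sends G to c.
  Were c nonzero, applying it to a monic relation and normalising would lower the degree, down to 1
  = 0.\<close>

lemma monic_relation_jacobian_eq_0:
  fixes F G :: "'a::field_char_0 poly poly"
  assumes J: "jacobian_xy F G = const_xy c"
    and q: "lead_coeff q = 1" "eval_xy const_xy F G q = 0"
  shows "c = 0"
proof (rule ccontr)
  assume "c \<noteq> 0"
  interpret coefficient_map const_xy by (rule coefficient_map_const_xy)
  interpret e: ring_map "eval_xy const_xy F G" by (rule ring_map_eval_xy)
  note D = derivation_jacobian[of F]
  have D0: "jacobian_xy F (eval1 F p) = 0" for p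
    using jacobian_at_poly unfolding at_poly_def .
  have De: "jacobian_xy F (eval_xy const_xy F G P) = eval_xy const_xy F G (pderiv P) * const_xy c" for P
  proof (induction P)
    case (pCons p P)
    have "jacobian_xy F (eval_xy const_xy F G (pCons p P))
      = const_xy c * eval_xy const_xy F G P + G * (eval_xy const_xy F G (pderiv P) * const_xy c)"
      unfolding eval_xy_pCons derivation_add[OF D] derivation_mult[OF D] D0 J pCons.IH by simp
    also have "\<dots> = eval_xy const_xy F G (pderiv (pCons p P)) * const_xy c"
      unfolding pderiv_pCons e.map_add eval_xy_pCons by (simp add: algebra_simps)
    finally show ?case .
  qed (simp add: eval_xy_0 derivation_0[OF D])
  have False if "degree q = n" "lead_coeff q = 1" "eval_xy const_xy F G q = 0" for n q
    using that
  proof (induction n arbitrary: q)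
    case 0
    then have "q = 1" by (metis degree_eq_zeroE lead_coeff_pCons(2) pCons_one)
    with 0 show False by (simp only: e.map_1) simp
  next
    case (Suc n)
    have "eval_xy const_xy F G (pderiv q) * const_xy c = 0"
      unfolding De[symmetric] Suc.prems(3) derivation_0[OF D] ..
    moreover have "const_xy c \<noteq> 0" using \<open>c \<noteq> 0\<close> by (simp add: const_xy_def)
    ultimately have z: "eval_xy const_xy F G (pderiv q) = 0" by simp
    define k :: 'a where "k = inverse (of_nat (Suc n))"
    define q' where "q' = smult [:k:] (pderiv q)"
    have k: "k \<noteq> 0" "of_nat (Suc n) * k = 1" by (simp_all add: k_def del: of_nat_Suc)
    have d: "degree q' = n" using k Suc.prems(1) by (simp add: q'_def degree_pderiv)
    have "lead_coeff q' = [:k:] * (of_nat (Suc n) * lead_coeff q)"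
      unfolding d unfolding q'_def using Suc.prems(1) by (simp add: coeff_pderiv del: of_nat_Suc)
    also have "\<dots> = 1" unfolding Suc.prems(2) using k by (simp add: of_nat_poly pCons_one mult.commute del: of_nat_Suc)
    finally have "lead_coeff q' = 1" .
    moreover have "eval_xy const_xy F G q' = 0"
    proof -
      have "q' = [:[:k:]:] * pderiv q" by (simp add: q'_def)
      then show ?thesis by (simp only: e.map_mult z mult_zero_right)
    qed
    ultimately show False using Suc.IH d by blast
  qed
  with q show False by blast
qed

section \<open>Weights of products\<close>

lemma max_weight_le: "P \<noteq> 0 \<Longrightarrow> (\<And>i j. (i, j) \<in> supp_xy P \<Longrightarrow> u * int i + v * int j \<le> W) \<Longrightarrow> max_weight u v P \<le> W"
  using max_weight_attained by metis

lemma max_weight_add_less: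
  assumes "P \<noteq> 0" and less: "\<And>i j. (i, j) \<in> supp_xy Q \<Longrightarrow> u * int i + v * int j < max_weight u v P"
  shows "P + Q \<noteq> 0" "max_weight u v (P + Q) = max_weight u v P"
proof -
  obtain i j where ij: "(i, j) \<in> supp_xy P" "u * int i + v * int j = max_weight u v P"
    using max_weight_attained[OF assms(1)] .
  have "(i, j) \<notin> supp_xy Q" using less[of i j] ij(2) by auto
  then have PQ: "(i, j) \<in> supp_xy (P + Q)" using ij(1) by (simp add: mem_supp_xy)
  then show nz: "P + Q \<noteq> 0" by (metis supp_xy_eq_empty_iff empty_iff)
  show "max_weight u v (P + Q) = max_weight u v P"
  proof (rule antisym)
    show "max_weight u v P \<le> max_weight u v (P + Q)" using max_weight_ge[OF PQ, of u v] ij(2) by simp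
    show "max_weight u v (P + Q) \<le> max_weight u v P"
    proof (rule max_weight_le[OF nz])
      fix k l assume "(k, l) \<in> supp_xy (P + Q)"
      then have "(k, l) \<in> supp_xy P \<or> (k, l) \<in> supp_xy Q" by (auto simp: mem_supp_xy)
      then show "u * int k + v * int l \<le> max_weight u v P" using less max_weight_ge by fastforce
    qed
  qed
qed

lemma max_weight_mult:
  fixes P Q :: "'a::idom poly poly"
  assumes "P \<noteq> 0" "Q \<noteq> 0"
  shows "max_weight u v (P * Q) = max_weight u v P + max_weight u v Q"
proof -
  define A where "A = leading_form (u, v) P"
  define B where "B = leading_form (u, v) Q"
  have rest: "u * int i + v * int j < max_weight u v S" if "(i, j) \<in> supp_xy (S - leading_form (u, v) S)" for i j and S :: "'a poly poly"
  proof -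
    have "(i, j) \<in> supp_xy S" "u * int i + v * int j \<noteq> max_weight u v S"
      using that unfolding mem_supp_xy leading_form_eq coeff_xy_diff coeff_homogeneous_component by (auto split: if_splits)
    then show ?thesis using max_weight_ge[of i j S u v] by simp
  qed
  have hA: "homog_wt u v (max_weight u v P) A" and hB: "homog_wt u v (max_weight u v Q) B"
    unfolding A_def B_def by (rule homog_wt_leading_form)+
  have AB: "A * B \<noteq> 0" using assms by (simp add: A_def B_def leading_form_nonzero)
  have hAB: "homog_wt u v (max_weight u v P + max_weight u v Q) (A * B)" by (rule homog_wt_mult[OF hA hB])
  obtain k l where "(k, l) \<in> supp_xy (A * B)" "u * int k + v * int l = max_weight u v (A * B)"
    using max_weight_attained[OF AB] .
  then have mAB: "max_weight u v (A * B) = max_weight u v P + max_weight u v Q"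
    using hAB unfolding homog_wt_def by simp
  have PQ: "P * Q = A * B + (A * (Q - B) + (P - A) * Q)" by (simp add: algebra_simps)
  have "u * int i + v * int j < max_weight u v (A * B)" if ij: "(i, j) \<in> supp_xy (A * (Q - B) + (P - A) * Q)" for i j
  proof -
    from ij have "(i, j) \<in> supp_xy (A * (Q - B)) \<or> (i, j) \<in> supp_xy ((P - A) * Q)" by (auto simp: mem_supp_xy)
    then show ?thesis
    proof
      assume "(i, j) \<in> supp_xy (A * (Q - B))"
      then obtain k l m n where "(k, l) \<in> supp_xy A" "(m, n) \<in> supp_xy (Q - B)" "i = k + m" "j = l + n" by (rule supp_mult)
      with hA rest[of m n Q] show ?thesis unfolding mAB homog_wt_def B_def[symmetric] by (force simp: distrib_left)
    next
      assume "(i, j) \<in> supp_xy ((P - A) * Q)"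
      then obtain k l m n where "(k, l) \<in> supp_xy (P - A)" "(m, n) \<in> supp_xy Q" "i = k + m" "j = l + n" by (rule supp_mult)
      with max_weight_ge[of m n Q u v] rest[of k l P] show ?thesis unfolding mAB A_def[symmetric] by (simp add: distrib_left)
    qed
  qed
  from max_weight_add_less(2)[OF AB, where Q = "A * (Q - B) + (P - A) * Q", OF this]
  show ?thesis unfolding PQ[symmetric] mAB .
qed

lemma max_weight_const: "a \<noteq> 0 \<Longrightarrow> max_weight u v (const_xy a) = 0"
proof -
  assume "a \<noteq> 0"
  then have "supp_xy (const_xy a) = {(0, 0)}" by (auto simp: mem_supp_xy const_xy_eq_monom split: if_splits)
  then show ?thesis by (simp add: max_weight_def)
qed

lemma max_weight_at_poly:
  fixes F :: "'a::idom poly poly"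
  assumes F: "F \<noteq> 0" "max_weight u v F > 0"
  shows "p \<noteq> 0 \<Longrightarrow> at_poly F p \<noteq> 0 \<and> max_weight u v (at_poly F p) = int (degree p) * max_weight u v F"
proof (induction p)
  case (pCons c p)
  show ?case
  proof (cases "p = 0")
    case True
    then have "c \<noteq> 0" using pCons.prems by simp
    then show ?thesis using True max_weight_const[of c u v] by (simp add: at_poly_pCons) (simp add: const_xy_def)
  next
    case False
    then have IH: "at_poly F p \<noteq> 0" "max_weight u v (at_poly F p) = int (degree p) * max_weight u v F"
      using pCons.IH by blast+
    then have w: "F * at_poly F p \<noteq> 0" "max_weight u v (F * at_poly F p) = int (degree (pCons c p)) * max_weight u v F"
      using F False by (simp_all add: max_weight_mult algebra_simps)
    have less: "u * int i + v * int j < max_weight u v (F * at_poly F p)" if "(i, j) \<in> supp_xy (const_xy c)" for i j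
    proof -
      have "i = 0" "j = 0" using that by (auto simp: mem_supp_xy const_xy_eq_monom split: if_splits)
      then show ?thesis unfolding w(2) using F False by simp
    qed
    show ?thesis
      unfolding at_poly_pCons add.commute[of "const_xy c"] using max_weight_add_less[OF w(1) less] w(2) by simp
  qed
qed simp

section \<open>The centralizer of \<open>F\<close>\<close>

text \<open>Roots are split off p: the identity for the cofactor and the one for the linear factor,
  which comes from \<open>poly q e\<close> being nonzero, multiply to one for p.\<close>

lemma comaximal_of_no_common_root:
  fixes p q :: "'a::alg_closed_field poly"
  assumes "p \<noteq> 0" "\<And>e. poly p e = 0 \<Longrightarrow> poly q e \<noteq> 0"
  shows "\<exists>\<alpha> \<beta>. \<alpha> * p + \<beta> * q = 1"
  using assms
proof (induction "degree p" arbitrary: p)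
  case 0
  then obtain c where "p = [:c:]" by (metis degree_eq_zeroE)
  with 0 have "[:inverse c:] * p + 0 * q = 1" by (simp add: pCons_one)
  then show ?case by blast
next
  case (Suc n)
  then obtain e where e: "poly p e = 0" using alg_closed_imp_poly_has_root[of p] by auto
  then obtain p' where p: "p = [:- e, 1:] * p'" by (metis dvdE poly_eq_0_iff_dvd)
  have "p' \<noteq> 0" using Suc.prems(1) p by auto
  moreover have "n = degree p'" using Suc.hyps(2) \<open>p' \<noteq> 0\<close> unfolding p by (subst (asm) degree_mult_eq) auto
  moreover have "poly q x \<noteq> 0" if "poly p' x = 0" for x using Suc.prems(2)[of x] that by (simp add: p)
  ultimately obtain \<alpha> \<beta> where ab: "\<alpha> * p' + \<beta> * q = 1" using Suc.hyps(1) by blast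
  have qe: "poly q e \<noteq> 0" using Suc.prems(2) e by blast
  have "poly (q - [:poly q e:]) e = 0" by simp
  then obtain q1 where q1: "q - [:poly q e:] = [:- e, 1:] * q1" by (metis dvdE poly_eq_0_iff_dvd)
  define k where "k = [:inverse (poly q e):]"
  have "q - [:- e, 1:] * q1 = [:poly q e:]" unfolding q1[symmetric] by simp
  then have "k * (q - [:- e, 1:] * q1) = 1" using qe by (simp only:) (simp add: k_def pCons_one)
  moreover have "- k * q1 * L + k * q = k * (q - L * q1)" for L by (simp add: algebra_simps)
  ultimately have one: "- k * q1 * [:- e, 1:] + k * q = 1" by (simp only:)
  have "1 = (\<alpha> * p' + \<beta> * q) * (- k * q1 * [:- e, 1:] + k * q)" unfolding ab one by simp
  also have "\<dots> = (\<alpha> * (- k * q1)) * p + (\<alpha> * p' * k + \<beta> * (- k * q1 * [:- e, 1:] + k * q)) * q"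
    unfolding p by (simp only: algebra_simps)
  finally show ?case by metis
qed

lemma degree_at_poly:
  fixes F :: "'a::idom poly poly"
  shows "degree (at_poly F p) = degree p * degree F"
proof -
  have "map_poly const_xy p = map_poly (\<lambda>x. [:x:]) (map_poly (\<lambda>c. [:c:]) p)"
    by (rule poly_eqI) (simp add: coeff_map_poly const_xy_def)
  then have "at_poly F p = pcompose (map_poly (\<lambda>c. [:c:]) p) F"
    unfolding at_poly_def pcompose_altdef by simp
  then show ?thesis by (simp add: degree_pcompose degree_map_poly)
qed

text \<open>Multiply 1 = \<alpha> \<gamma> + \<beta> \<gamma>', evaluated at F, by
  \<open>deriv_y F\<close>. Both terms are divisible by Y, since \<gamma>(F) is the square of Y and
  \<gamma>'(F) times \<open>deriv_y F\<close> is the y-derivative of that square.\<close>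

lemma squarefree_value_not_square:
  fixes F Y :: "'a::{alg_closed_field, field_char_0} poly poly"
  assumes sq: "Y\<^sup>2 = at_poly F \<gamma>" and \<gamma>: "\<And>e. poly \<gamma> e = 0 \<Longrightarrow> poly (pderiv \<gamma>) e \<noteq> 0"
    and deg: "degree \<gamma> \<ge> 2" and F: "degree F > 0"
  shows False
proof -
  interpret ring_map "at_poly F" by (rule ring_map_at_poly)
  have "\<gamma> \<noteq> 0" using deg by auto
  then obtain \<alpha> \<beta> where ab: "\<alpha> * \<gamma> + \<beta> * pderiv \<gamma> = 1" using comaximal_of_no_common_root \<gamma> by blast
  have const: "deriv_y (const_xy c) = 0" for c :: 'a
    by (simp add: const_xy_eq_monom deriv_y_monom) (simp add: monom_xy_def)
  have "2 * Y * deriv_y Y = deriv_y (Y\<^sup>2)"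
    unfolding power2_eq_square derivation_mult[OF derivation_deriv_y] by (simp add: mult_ac)
  also have "\<dots> = at_poly F (pderiv \<gamma>) * deriv_y F"
    unfolding sq by (rule derivation_at_poly[OF derivation_deriv_y const])
  finally have d: "at_poly F (pderiv \<gamma>) * deriv_y F = 2 * Y * deriv_y Y" ..
  have "deriv_y F = at_poly F (\<alpha> * \<gamma> + \<beta> * pderiv \<gamma>) * deriv_y F" unfolding ab by simp
  also have "\<dots> = at_poly F \<alpha> * Y\<^sup>2 * deriv_y F + at_poly F \<beta> * (at_poly F (pderiv \<gamma>) * deriv_y F)"
    unfolding map_add map_mult sq by (simp add: algebra_simps)
  also have "\<dots> = Y * (at_poly F \<alpha> * Y * deriv_y F + at_poly F \<beta> * 2 * deriv_y Y)"
    unfolding d by (simp add: algebra_simps power2_eq_square)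
  finally have "Y dvd deriv_y F" by (rule dvdI)
  moreover have "deriv_y F \<noteq> 0" using F by (simp add: deriv_y_def pderiv_eq_0_iff)
  ultimately have "degree Y \<le> degree (deriv_y F)" by (rule dvd_imp_degree_le)
  also have "\<dots> = degree F - 1" unfolding deriv_y_def by (rule degree_pderiv)
  finally have "degree Y < degree F" using F by simp
  moreover have "2 * degree Y = degree \<gamma> * degree F"
  proof -
    have "2 * degree Y = degree (Y\<^sup>2)" by (cases "Y = 0") (simp_all add: degree_power_eq)
    then show ?thesis unfolding sq degree_at_poly .
  qed
  moreover have "2 * degree F \<le> degree \<gamma> * degree F" using deg by simp
  ultimately show False by linarith
qed

theorem (in generic_pair) jacobian_eq_0: "c = 0"
  using integral_over_F monic_relation_jacobian_eq_0[OF jac] by metis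

theorem (in generic_pair) square_plus_const: "\<exists>P u0. F = P\<^sup>2 + const_xy u0"
proof -
  obtain u v where edge: "edge u v" by (rule exists_edge)
  obtain a a' d \<epsilon> where aa: "a + a' = 1" and \<delta>: "u * int a' - v * int a \<noteq> 0" and d: "d \<ge> 1"
    and M: "max_weight u v F = 2 * int d" "max_weight u v G = int b * int d"
    and f0: "initial_form u v a a' F \<noteq> 0"
    and ord: "\<And>r. r \<noteq> 0 \<Longrightarrow> poly (initial_form u v a a' F) r = 0 \<Longrightarrow> order r (initial_form u v a a' F) = 2"
    and root: "\<exists>r. r \<noteq> 0 \<and> poly (initial_form u v a a' F) r = 0"
    using edge_facts[OF edge] by metis
  let ?w = "max_weight u v"
  let ?i = "initial_form u v a a'"
  define f where "f = ?i F"
  obtain r where r: "order r f = 2" using ord root unfolding f_def by blast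
  have f: "f \<noteq> 0" using f0 by (simp add: f_def)
  have degf: "degree f > 0" using order_degree[OF f, of r] r by simp
  note D = derivation_jacobian[of F]
  define A where "A h \<longleftrightarrow> jacobian_xy F h = 0" for h
  have A_const: "A (const_xy e)" and A_F: "A (at_poly F p)" and A_G: "A G" for e p
    using jac jacobian_eq_0 by (simp_all add: A_def jacobian_at_poly) (simp add: const_xy_def)
  have A_diff: "A (x - y)" and A_mult: "A (x * y)" if "A x" "A y" for x y
    using that by (simp_all add: A_def derivation_diff[OF D] derivation_mult[OF D])

  \<comment> \<open>A negative weight contradicts the comparison of degrees with f. The multiplicity
    \<mu> in the initial form of h at the double root r of f then measures the weight of h in units
    of d.\<close>
  have weight: "\<exists>\<mu>. ?w h = int d * int \<mu> \<and> smult 2 (f * pderiv (?i h)) = smult (of_nat \<mu>) (?i h * pderiv f)"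
    if h: "A h" "h \<noteq> 0" for h
  proof -
    have J: "jacobian_xy F h = const_xy 0" using h(1) by (simp add: A_def const_xy_def)
    have ih: "?i h \<noteq> 0" using initial_form_nonzero[OF h(2) \<delta>] .
    have eq: "of_int (2 * int d) * (f * pderiv (?i h)) = of_int (?w h) * (pderiv f * ?i h)"
      using initial_form_bracket[OF nonzero(1) h(2) aa J, of u v] unfolding M(1) f_def by simp
    have "?w h \<ge> 0"
    proof (rule ccontr)
      assume neg: "\<not> ?w h \<ge> 0"
      define k where "k = nat (- ?w h)"
      have k: "?w h = - int k" "k > 0" using neg by (simp_all add: k_def)
      have "smult (of_nat (2 * d)) (pderiv (?i h) * f) = smult (- of_nat k) (?i h * pderiv f)"
        using eq unfolding k(1) by (simp add: of_int_poly of_nat_poly mult_ac)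
      from pderiv_eq_degree[OF this ih f]
      have "(of_nat (2 * d * degree (?i h) + k * degree f) :: 'k) = 0" by (simp add: algebra_simps)
      then have "k * degree f = 0" by (metis add_is_0 of_nat_eq_0_iff)
      then show False using k(2) degf by simp
    qed
    then obtain k where k: "?w h = int k" using nonneg_int_cases by blast
    have eq': "smult (of_nat (2 * d)) (f * pderiv (?i h)) = smult (of_nat k) (?i h * pderiv f)"
      using eq unfolding k by (simp add: of_int_poly of_nat_poly mult_ac)
    from log_derivative_eq[OF eq' f ih] obtain e where e: "e \<noteq> 0" "?i h ^ (2 * d) = smult e (f ^ k)" by blast
    define \<mu> where "\<mu> = order r (?i h)"
    have "2 * d * \<mu> = order r (?i h ^ (2 * d))" using ih by (simp add: order_power \<mu>_def)
    also have "\<dots> = k * 2" unfolding e(2) using e(1) f r by (simp add: order_smult order_power)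
    finally have k\<mu>: "k = d * \<mu>" by simp
    have "smult (of_nat d) (smult 2 (f * pderiv (?i h))) = smult (of_nat d) (smult (of_nat \<mu>) (?i h * pderiv f))"
      using eq' unfolding k\<mu> by (simp add: mult_ac)
    then have "smult 2 (f * pderiv (?i h)) = smult (of_nat \<mu>) (?i h * pderiv f)"
      using d by (metis smult_cancel of_nat_eq_0_iff not_one_le_zero)
    then show ?thesis using k k\<mu> by auto
  qed

  \<comment> \<open>Equal weights give the initial forms equal logarithmic derivatives. So these
    forms, and with them the leading forms, are proportional, and a multiple of k cancels the
    leading form of h.\<close>
  have reduce: "\<exists>e. h - const_xy e * k = 0 \<or> ?w (h - const_xy e * k) < ?w h"
    if h: "A h" "h \<noteq> 0" and k: "A k" "k \<noteq> 0" and w: "?w h = ?w k" for h k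
  proof -
    obtain \<mu> where \<mu>: "?w h = int d * int \<mu>" "smult 2 (f * pderiv (?i h)) = smult (of_nat \<mu>) (?i h * pderiv f)"
      using weight[OF h] by blast
    obtain \<nu> where \<nu>: "?w k = int d * int \<nu>" "smult 2 (f * pderiv (?i k)) = smult (of_nat \<nu>) (?i k * pderiv f)"
      using weight[OF k] by blast
    have "\<nu> = \<mu>" using \<mu>(1) \<nu>(1) w d by simp
    have "smult 2 (f * (pderiv (?i h) * ?i k)) = smult 2 (f * pderiv (?i h)) * ?i k" by (simp add: mult_ac)
    also have "\<dots> = ?i h * (smult (of_nat \<mu>) (?i k * pderiv f))" unfolding \<mu>(2) by (simp add: mult_ac)
    also have "\<dots> = smult 2 (f * (?i h * pderiv (?i k)))"
      unfolding \<nu>(2)[unfolded \<open>\<nu> = \<mu>\<close>, symmetric] by (simp add: mult_ac)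
    finally have "smult (1 / 2) (smult 2 (f * (pderiv (?i h) * ?i k))) = smult (1 / 2) (smult 2 (f * (?i h * pderiv (?i k))))"
      by (rule arg_cong)
    then have "pderiv (?i h) * ?i k = ?i h * pderiv (?i k)" using f by simp
    then obtain e where e: "?i h = smult e (?i k)"
      using wronskian_eq_0_imp_smult initial_form_nonzero[OF k(2) \<delta>] by blast
    define g where "g = h - const_xy e * k"
    interpret dh: ring_map "dehom a a' :: 'k poly poly \<Rightarrow> _" by (rule ring_map_dehom)
    have ck: "coeff_xy (const_xy e * p) i j = e * coeff_xy p i j" for p i j
      by (simp add: coeff_xy_def const_xy_def)
    have comp: "homogeneous_component (u, v) (?w h) g = leading_form (u, v) h - const_xy e * leading_form (u, v) k"
      by (rule poly_xy_eqI) (simp add: leading_form_eq coeff_homogeneous_component g_def ck w)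
    have "dehom a a' (homogeneous_component (u, v) (?w h) g) = 0"
      using e unfolding comp initial_form_eq dh.map_diff dh.map_mult const_xy_eq_monom dehom_monom
      by (simp add: monom_0)
    then have comp0: "homogeneous_component (u, v) (?w h) g = 0"
      using dehom_homog_eq_0[OF homog_wt_component \<delta>] by blast
    have "?w g < ?w h" if g0: "g \<noteq> 0"
    proof -
      obtain i j where ij: "(i, j) \<in> supp_xy g" "u * int i + v * int j = ?w g"
        using max_weight_attained[OF g0] .
      have "u * int i + v * int j \<noteq> ?w h"
        using ij(1) arg_cong[OF comp0, of "\<lambda>p. coeff_xy p i j"]
        by (auto simp: coeff_homogeneous_component mem_supp_xy)
      moreover have "(i, j) \<in> supp_xy h \<or> (i, j) \<in> supp_xy k"
        using ij(1) by (auto simp: mem_supp_xy g_def ck)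
      then have "u * int i + v * int j \<le> ?w h" using max_weight_ge[of i j _ u v] w by metis
      ultimately show ?thesis using ij(2) by simp
    qed
    then show ?thesis unfolding g_def by blast
  qed

  \<comment> \<open>In units of d the weight of F is 2, so nonzero polynomials in F have even
    weight. G shows that odd weights occur in the centralizer.\<close>
  define odd_weight where "odd_weight \<beta> \<longleftrightarrow> odd \<beta> \<and> (\<exists>h. A h \<and> h \<noteq> 0 \<and> ?w h = int d * int \<beta>)" for \<beta>
  have "odd_weight b" unfolding odd_weight_def using b A_G nonzero M(2) by (auto simp: mult.commute)
  define \<beta> where "\<beta> = (LEAST \<beta>. odd_weight \<beta>)"
  have "odd_weight \<beta>" unfolding \<beta>_def using \<open>odd_weight b\<close> by (rule LeastI)
  then obtain Y where \<beta>: "odd \<beta>" and Y: "A Y" "Y \<noteq> 0" "?w Y = int d * int \<beta>"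
    unfolding odd_weight_def by blast
  have minimal: "\<beta> \<le> \<mu>" if "A h" "h \<noteq> 0" "?w h = int d * int \<mu>" "odd \<mu>" for h \<mu>
    unfolding \<beta>_def using that by (intro Least_le) (auto simp: odd_weight_def)
  have wF: "?w F > 0" using M(1) d by simp
  have w_poly: "at_poly F p \<noteq> 0" "?w (at_poly F p) = int d * int (2 * degree p)" if "p \<noteq> 0" for p
    using max_weight_at_poly[OF nonzero(1) wF that] unfolding M(1) by simp_all

  \<comment> \<open>The centralizer is K[F] + K[F] Y, with control of the degrees: an even \<mu> is
    the weight of a power of F, an odd one, being at least \<beta>, that of a power of F times Y,
    and so the leading form can be removed.\<close>
  have span: "\<exists>p q. h = at_poly F p + at_poly F q * Y \<and> 2 * degree p \<le> \<mu> \<and> (q = 0 \<or> 2 * degree q + \<beta> \<le> \<mu>)"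
    if "A h" "h \<noteq> 0" "?w h = int d * int \<mu>" for h \<mu>
    using that
  proof (induction \<mu> arbitrary: h rule: less_induct)
    case (less \<mu>)
    interpret ring_map "at_poly F" by (rule ring_map_at_poly)
    have "\<exists>p0 q0. (\<exists>k. k = at_poly F p0 + at_poly F q0 * Y \<and> A k \<and> k \<noteq> 0 \<and> ?w k = ?w h)
      \<and> 2 * degree p0 \<le> \<mu> \<and> (q0 = 0 \<or> 2 * degree q0 + \<beta> \<le> \<mu>)"
    proof (cases "even \<mu>")
      case True
      then obtain n where n: "\<mu> = 2 * n" by blast
      have m: "monom (1 :: 'k) n \<noteq> 0" "degree (monom (1 :: 'k) n) = n" by (simp_all add: degree_monom_eq)
      show ?thesis
        using w_poly[OF m(1)] A_F[of "monom 1 n"] m(2) n less.prems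
        by (intro exI[of _ "monom 1 n"] exI[of _ 0]) auto
    next
      case False
      then have "\<beta> \<le> \<mu>" using minimal less.prems by blast
      moreover have "even (\<mu> - \<beta>)" using False \<beta> by simp
      ultimately obtain n where n: "\<mu> = \<beta> + 2 * n" by (metis dvd_def le_add_diff_inverse)
      have m: "monom (1 :: 'k) n \<noteq> 0" "degree (monom (1 :: 'k) n) = n" by (simp_all add: degree_monom_eq)
      have "at_poly F (monom 1 n) * Y \<noteq> 0" using w_poly(1)[OF m(1)] Y by simp
      moreover have "?w (at_poly F (monom 1 n) * Y) = ?w h"
        unfolding max_weight_mult[OF w_poly(1)[OF m(1)] Y(2)] w_poly(2)[OF m(1)] m(2) Y(3) less.prems(3) n
        by (simp add: algebra_simps)
      ultimately show ?thesis
        using A_mult[OF A_F Y(1)] m(2) n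
        by (intro exI[of _ 0] exI[of _ "monom 1 n"]) auto
    qed
    then obtain p0 q0 k where k: "k = at_poly F p0 + at_poly F q0 * Y" "A k" "k \<noteq> 0" "?w k = ?w h"
      and p0: "2 * degree p0 \<le> \<mu>" and q0: "q0 = 0 \<or> 2 * degree q0 + \<beta> \<le> \<mu>" by blast
    from reduce[OF less.prems(1,2) k(2,3) k(4)[symmetric]]
    obtain e where e: "h - const_xy e * k = 0 \<or> ?w (h - const_xy e * k) < ?w h" by blast
    define h1 where "h1 = h - const_xy e * k"
    have A1: "A h1" unfolding h1_def using less.prems(1) k(2) A_const by (intro A_diff A_mult)
    have "\<exists>p q. h1 = at_poly F p + at_poly F q * Y \<and> 2 * degree p \<le> \<mu> \<and> (q = 0 \<or> 2 * degree q + \<beta> \<le> \<mu>)"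
    proof (cases "h1 = 0")
      case True
      then show ?thesis by (intro exI[of _ 0]) simp
    next
      case False
      obtain \<nu> where \<nu>: "?w h1 = int d * int \<nu>" using weight[OF A1 False] by blast
      have "?w h1 < ?w h" using e False unfolding h1_def by blast
      then have "\<nu> < \<mu>" unfolding \<nu> less.prems(3) using d by simp
      from less.IH[OF this A1 False \<nu>] \<open>\<nu> < \<mu>\<close> show ?thesis by fastforce
    qed
    then obtain p1 q1 where h1: "h1 = at_poly F p1 + at_poly F q1 * Y"
      and p1: "2 * degree p1 \<le> \<mu>" and q1: "q1 = 0 \<or> 2 * degree q1 + \<beta> \<le> \<mu>" by blast
    have "h = at_poly F (p1 + smult e p0) + at_poly F (q1 + smult e q0) * Y"
      using h1 unfolding h1_def k(1) by (simp add: at_poly_smult algebra_simps)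
    moreover have "2 * degree (p1 + smult e p0) \<le> \<mu>"
      using p0 p1 degree_add_le_max[of p1 "smult e p0"] degree_smult_le[of e p0] by linarith
    moreover have "q1 + smult e q0 = 0 \<or> 2 * degree (q1 + smult e q0) + \<beta> \<le> \<mu>"
      using q0 q1 degree_add_le_max[of q1 "smult e q0"] degree_smult_le[of e q0] by fastforce
    ultimately show ?case by blast
  qed

  interpret at: ring_map "at_poly F" by (rule ring_map_at_poly)
  have Y2: "A (Y\<^sup>2)" "Y\<^sup>2 \<noteq> 0" "?w (Y\<^sup>2) = int d * int (2 * \<beta>)"
    using A_mult[OF Y(1) Y(1)] Y(2) by (simp_all add: power2_eq_square max_weight_mult Y(3))
  obtain p q where pq: "Y\<^sup>2 = at_poly F p + at_poly F q * Y" and q: "q = 0 \<or> 2 * degree q + \<beta> \<le> 2 * \<beta>"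
    using span[OF Y2] by blast
  define q2 where "q2 = smult (1 / 2) q"
  have qq: "q = q2 + q2" by (simp add: q2_def flip: smult_add_left)
  define Y1 where "Y1 = Y + - at_poly F q2"
  define \<gamma> where "\<gamma> = p + q2 * q2"
  have sq: "Y1\<^sup>2 = at_poly F \<gamma>"
  proof -
    have "Y1\<^sup>2 = Y\<^sup>2 - (at_poly F q2 + at_poly F q2) * Y + at_poly F q2 * at_poly F q2"
      unfolding Y1_def power2_eq_square by (simp add: algebra_simps)
    moreover have "at_poly F q = at_poly F q2 + at_poly F q2" by (subst qq) (rule at.map_add)
    ultimately show ?thesis unfolding pq \<gamma>_def at.map_add at.map_mult by simp
  qed
  have less: "u * int i + v * int j < ?w Y" if "(i, j) \<in> supp_xy (- at_poly F q2)" for i j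
  proof -
    have "(i, j) \<in> supp_xy (at_poly F q2)" using that coeff_xy_diff[of 0 "at_poly F q2" i j] by (simp add: mem_supp_xy)
    then have "q2 \<noteq> 0" and le: "u * int i + v * int j \<le> ?w (at_poly F q2)"
      using max_weight_ge[of i j "at_poly F q2" u v] by (auto simp: mem_supp_xy)
    have "q \<noteq> 0" "degree q2 = degree q" using \<open>q2 \<noteq> 0\<close> by (auto simp: q2_def)
    \<comment> \<open>The control of degrees gives \<le>, and equality is impossible because \<beta>
      is odd. So completing the square does not change the weight of Y.\<close>
    then have "2 * degree q2 < \<beta>" using q \<beta> by (metis add_le_imp_le_right dvd_triv_left le_neq_implies_less mult_2)
    then have "int d * int (2 * degree q2) < int d * int \<beta>" using d by (simp only: mult_less_cancel_left_pos of_nat_0_less_iff of_nat_less_iff)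
    then show ?thesis using le w_poly(2)[OF \<open>q2 \<noteq> 0\<close>] Y(3) by simp
  qed
  have Y1: "Y1 \<noteq> 0" "?w Y1 = int d * int \<beta>"
    unfolding Y1_def using max_weight_add_less[OF Y(2), where Q = "- at_poly F q2", OF less] Y(3) by auto
  have AY1: "A Y1" unfolding Y1_def using A_diff[OF Y(1) A_F[of q2]] by simp
  have "\<gamma> \<noteq> 0" using sq Y1(1) by auto
  have deg\<gamma>: "degree \<gamma> = \<beta>"
  proof -
    have "int d * int (2 * degree \<gamma>) = ?w Y1 + ?w Y1"
      unfolding w_poly(2)[OF \<open>\<gamma> \<noteq> 0\<close>, symmetric] sq[symmetric] power2_eq_square using Y1(1) by (rule max_weight_mult[OF Y1(1)])
    then have "int d * int (2 * degree \<gamma>) = int d * int (2 * \<beta>)" unfolding Y1(2) by (simp add: algebra_simps)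
    then show ?thesis using d by simp
  qed
  \<comment> \<open>A double root e of \<gamma> would make F - e divide \<open>Y1\<close>; the
    quotient again commutes with F and has odd weight \<beta> - 2, against the minimality of
    \<beta>.\<close>
  have squarefree: "poly (pderiv \<gamma>) e \<noteq> 0" if e: "poly \<gamma> e = 0" for e
  proof
    assume e': "poly (pderiv \<gamma>) e = 0"
    obtain \<gamma>1 where g1: "\<gamma> = [:- e, 1:] * \<gamma>1" using e by (metis dvdE poly_eq_0_iff_dvd)
    have "poly \<gamma>1 e = 0" using e' unfolding g1 pderiv_mult by (simp add: pderiv_pCons)
    then obtain \<gamma>2 where "\<gamma>1 = [:- e, 1:] * \<gamma>2" by (metis dvdE poly_eq_0_iff_dvd)
    then have g2: "\<gamma> = [:- e, 1:]\<^sup>2 * \<gamma>2" unfolding g1 by (simp only: power2_eq_square mult.assoc)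
    define E where "E = at_poly F [:- e, 1:]"
    have "E\<^sup>2 dvd Y1\<^sup>2" unfolding sq g2 at.map_mult at.map_power E_def by (rule dvd_triv_left)
    then have "E dvd Y1" by (rule square_dvd_square_imp_dvd)
    then obtain Z where Z: "Y1 = E * Z" by blast
    have nz: "E \<noteq> 0" "Z \<noteq> 0" using Z Y1(1) by auto
    have "jacobian_xy F Y1 = E * jacobian_xy F Z"
      unfolding Z derivation_mult[OF D] E_def jacobian_at_poly by simp
    then have AZ: "A Z" using AY1 nz(1) by (simp add: A_def)
    obtain \<nu> where \<nu>: "?w Z = int d * int \<nu>" using weight[OF AZ nz(2)] by blast
    have "?w E = int d * int 2" using w_poly(2)[of "[:- e, 1:]"] by (simp add: E_def)
    then have "int d * int \<beta> = int d * int 2 + int d * int \<nu>"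
      using max_weight_mult[OF nz, of u v] unfolding Z[symmetric] \<nu> Y1(2) by simp
    then have "int d * int \<beta> = int d * int (2 + \<nu>)" by (simp add: algebra_simps)
    then have "\<beta> = 2 + \<nu>" using d by simp
    then show False using minimal[OF AZ nz(2) \<nu>] \<beta> by simp
  qed
  have "degree F > 0"
  proof -
    obtain j where j: "(0, j) \<in> supp_xy F" "j \<ge> 2" by (rule axis_y)
    then have "coeff F j \<noteq> 0" by (auto simp: mem_supp_xy coeff_xy_def)
    from le_degree[OF this] j(2) show ?thesis by simp
  qed
  then have "\<not> degree \<gamma> \<ge> 2" using squarefree_value_not_square[OF sq squarefree] by blast
  then have "degree \<gamma> = 1" using deg\<gamma> \<beta> by (cases \<beta>) auto
  then obtain g0 g1 where g: "\<gamma> = [:g0, g1:]" "g1 \<noteq> 0"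
    by (metis degree_0 degree_pCons_eq_if one_neq_zero pCons_cases pCons_eq_0_iff degree_eq_zeroE Suc_inject One_nat_def)
  have sq': "Y1\<^sup>2 = const_xy g0 + F * const_xy g1"
    unfolding sq g at_poly_pCons by simp
  obtain z where z: "z\<^sup>2 = inverse g1" using nth_root_exists[of 2 "inverse g1"] by auto
  interpret cst: ring_map "const_xy :: 'k \<Rightarrow> _" by (rule ring_map_const_xy)
  have "(const_xy z * Y1)\<^sup>2 = const_xy (inverse g1) * (const_xy g0 + F * const_xy g1)"
    unfolding power_mult_distrib sq' cst.map_power[symmetric] z ..
  also have "\<dots> = const_xy (inverse g1 * g0) + F * const_xy (inverse g1 * g1)"
    by (simp only: cst.map_mult distrib_left mult_ac)
  also have "\<dots> = const_xy (inverse g1 * g0) + F" using g(2) by simp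
  finally have "F = (const_xy z * Y1)\<^sup>2 + const_xy (- (inverse g1 * g0))" by (simp only: cst.map_uminus) simp
  then show ?thesis by blast
qed

section \<open>Generic boundaries\<close>

lemma newton_polygon_le_max_weight:
  assumes "p \<in> newton_polygon P"
  shows "real_of_int u * fst p + real_of_int v * snd p \<le> real_of_int (max_weight u v P)"
proof -
  let ?H = "{p. (real_of_int u, real_of_int v) \<bullet> p \<le> real_of_int (max_weight u v P)}"
  have "newton_polygon P \<subseteq> ?H"
    unfolding newton_polygon_def
  proof (rule hull_minimal)
    show "(\<lambda>(i, j). (real i, real j)) ` supp_xy P \<subseteq> ?H"
    proof
      fix p assume "p \<in> (\<lambda>(i, j). (real i, real j)) ` supp_xy P"
      then obtain i j where ij: "(i, j) \<in> supp_xy P" "p = (real i, real j)" by auto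
      have "real_of_int (u * int i + v * int j) \<le> real_of_int (max_weight u v P)"
        using max_weight_ge[OF ij(1), of u v] by (simp only: of_int_le_iff)
      then show "p \<in> ?H" by (simp add: ij(2) inner_prod_def)
    qed
    show "convex ?H" by (rule convex_halfspace_le)
  qed
  with assms show ?thesis by (auto simp: inner_prod_def)
qed

lemma max_weight_in_newton_polygon:
  assumes "P \<noteq> 0"
  obtains p where "p \<in> newton_polygon P" "real_of_int u * fst p + real_of_int v * snd p = real_of_int (max_weight u v P)"
proof -
  obtain i j where ij: "(i, j) \<in> supp_xy P" "u * int i + v * int j = max_weight u v P"
    using max_weight_attained[OF assms] .
  have "(real i, real j) \<in> newton_polygon P"
    unfolding newton_polygon_def using ij(1) by (intro hull_inc) force
  moreover have "real_of_int u * real i + real_of_int v * real j = real_of_int (max_weight u v P)"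
    unfolding ij(2)[symmetric] by simp
  ultimately show thesis using that by simp
qed

text \<open>A homothety of ratio 2/b scales support functions by 2/b, and these are integers at
  integer directions, so similarity becomes an identity of integers. F and G are nonzero because
  their polygons are nonempty.\<close>

lemma generic_boundaries_imp_generic_pair:
  fixes F G :: "'k::{alg_closed_field, field_char_0} poly poly"
  assumes gb: "generic_boundaries 2 b F G" and b: "b \<ge> 2" "coprime 2 b"
  shows "\<exists>c. generic_pair F G b c"
proof -
  note gb1 = gb[unfolded generic_boundaries_def]
  note gb2 = conjunct2[OF gb1]
  note gb3 = conjunct2[OF gb2]
  note gb4 = conjunct2[OF gb3]
  obtain c where J: "jacobian_xy F G = const_xy c" using conjunct1[OF gb1] by (rule rangeE)
  note tri = conjunct1[OF gb2]
  define \<rho> where "\<rho> = (2 :: real) / real b"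
  have NF: "newton_polygon F = (\<lambda>p. \<rho> *\<^sub>R p) ` newton_polygon G"
    using conjunct1[OF gb3] unfolding conjunct1[OF gb4] \<rho>_def by simp
  have "odd b" using b(2) by simp
  then have b3: "b \<ge> 3" using b(1) by (cases "b = 2") auto
  have nz: "P \<noteq> 0" if "(0, 0) \<in> newton_polygon P" for P :: "'k poly poly"
  proof
    assume "P = 0"
    then have e: "supp_xy P = {}" by simp
    show False using that unfolding newton_polygon_def e by simp
  qed
  have FG: "F \<noteq> 0" "G \<noteq> 0" using tri nz by auto
  have \<rho>: "\<rho> > 0" using b by (simp add: \<rho>_def)
  have sim: "int b * max_weight u v F = 2 * max_weight u v G" for u v
  proof -
    have lin: "real_of_int u * fst (\<rho> *\<^sub>R p) + real_of_int v * snd (\<rho> *\<^sub>R p)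
        = \<rho> * (real_of_int u * fst p + real_of_int v * snd p)" for p :: "real \<times> real"
      by (simp add: algebra_simps)
    have "real_of_int (max_weight u v F) = \<rho> * real_of_int (max_weight u v G)"
    proof (rule antisym)
      obtain p where p: "p \<in> newton_polygon F" "real_of_int u * fst p + real_of_int v * snd p = real_of_int (max_weight u v F)"
        using max_weight_in_newton_polygon[OF FG(1)] .
      then obtain p' where p': "p' \<in> newton_polygon G" "p = \<rho> *\<^sub>R p'" unfolding NF by blast
      show "real_of_int (max_weight u v F) \<le> \<rho> * real_of_int (max_weight u v G)"
        using newton_polygon_le_max_weight[OF p'(1), of u v] \<rho> unfolding p(2)[symmetric] p'(2) lin by simp
    next
      obtain p where p: "p \<in> newton_polygon G" "real_of_int u * fst p + real_of_int v * snd p = real_of_int (max_weight u v G)"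
        using max_weight_in_newton_polygon[OF FG(2)] .
      then have "\<rho> *\<^sub>R p \<in> newton_polygon F" unfolding NF by blast
      from newton_polygon_le_max_weight[OF this, of u v]
      show "\<rho> * real_of_int (max_weight u v G) \<le> real_of_int (max_weight u v F)" unfolding lin p(2) .
    qed
    then have "real b * real_of_int (max_weight u v F) = 2 * real_of_int (max_weight u v G)"
      using b by (simp add: \<rho>_def field_simps)
    then have "real_of_int (int b * max_weight u v F) = real_of_int (2 * max_weight u v G)" by simp
    then show ?thesis by (simp only: of_int_eq_iff)
  qed
  have ge: "max_weight u v F \<ge> 0" "max_weight u v F \<ge> u" "max_weight u v F \<ge> v" for u v
    using newton_polygon_le_max_weight[of "(0, 0)" F u v] newton_polygon_le_max_weight[of "(1, 0)" F u v]
      newton_polygon_le_max_weight[of "(0, 1)" F u v] tri by auto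
  have gen: "\<not> t\<^sup>2 dvd R" if "w \<in> directions" "R\<^sup>2 = leading_form w F" "t \<in> two_point_polys" for w R t
    using conjunct2[OF gb4] that by blast
  have "generic_pair F G b c"
    by (rule generic_pair.intro) (use \<open>odd b\<close> b3 FG J sim ge gen in auto)
  then show ?thesis ..
qed

theorem theorem1p3:
  fixes F G :: "'k::{alg_closed_field, field_char_0} poly poly" and a b :: nat
  assumes "a = 2" and "b \<ge> 2" and "coprime a b"
    and "generic_boundaries a b F G"
  shows "(\<exists>P u0. F = P\<^sup>2 + const_xy u0) \<and> jacobian_xy F G = 0"
proof -
  obtain c where "generic_pair F G b c"
    using generic_boundaries_imp_generic_pair assms by blast
  then interpret generic_pair F G b c .
  have "jacobian_xy F G = 0" using jac jacobian_eq_0 by (simp add: const_xy_def)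
  with square_plus_const show ?thesis by blast
qed

end
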